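(* Let $\mathfrak k$ be a two-step nilpotent Lie algebra with centre $\mathfrak z$, $H$ a Lie group with Lie algebra $\mathfrak h$, and $\phi:\mathfrak h\to\mathfrak{der}(\mathfrak k)$ a Lie algebra homomorphism into the derivations of $\mathfrak k$. Let $G$ be the Lie group corresponding to the Lie algebra $\mathfrak g$ given as the semi-direct sum $$\mathfrak g=\mathfrak h\ltimes_\phi\mathfrak k,$$ and let $n=\dim G\ge3$. Let $g$ be a pseudo-Riemannian left-invariant metric on $G$ such that $\mathfrak z^\perp=\mathfrak k$ and $\mathfrak g=\mathfrak h^\perp\oplus\mathfrak z$. Then the conformal class of $g$ on $G$ admits a Ricci-flat ambient metric, namely $$\widetilde g=2\,d(\rho t)\,dt+t^2\Big(g+\frac{2\rho}{n-2}Ric(g)\Big),$$ where $Ric(g)$ is the Ricci tensor of $g$.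
   Context: All Lie algebras are real and finite dimensional. $\mathfrak{der}(\mathfrak k)\subset\mathfrak{gl}(\mathfrak k)$ is the Lie algebra of derivations. In $\mathfrak h\ltimes_\phi\mathfrak k$ (vector space $\mathfrak h\oplus\mathfrak k$) the bracket restricts to the given ones on $\mathfrak h$ and $\mathfrak k$ and $[X,Y]=\phi(X)Y$ for $X\in\mathfrak h,Y\in\mathfrak k$. The orthogonal complements are with respect to the inner product on $\mathfrak g$ defined by the left-invariant metric $g$. $\widetilde g$ is defined on $(0,\infty)\times G\times(-\epsilon,\epsilon)$ with coordinates $t\in(0,\infty)$, $\rho\in(-\epsilon,\epsilon)$, and $2\,d(\rho t)\,dt=2\rho\,dt^2+2t\,dt\,d\rho$. A Ricci-flat ambient metric for $[g]$ is a metric of the form $\widetilde g=2\,dt\,d(\rho t)+t^2(g+h(\rho))$ with $h|_{\rho=0}=0$ and $Ric(\widetilde g)=0$. *)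

theory Defs
  imports "HOL-Analysis.Analysis" "HOL-Algebra.Group"
begin

section \<open>Smooth functions between normed spaces\<close>

text \<open>On an open set \<open>S\<close> of a finite-dimensional space, \<open>Ck_on k f S\<close> is continuous differentiability of
  order \<open>k\<close>: \<open>f\<close> is differentiable and all its directional derivatives are of class \<open>k - 1\<close>.\<close>

primrec Ck_on :: "nat \<Rightarrow> ('a::real_normed_vector \<Rightarrow> 'b::real_normed_vector) \<Rightarrow> 'a set \<Rightarrow> bool" where
  "Ck_on 0 f S \<longleftrightarrow> continuous_on S f"
| "Ck_on (Suc k) f S \<longleftrightarrow> (\<forall>x\<in>S. f differentiable (at x)) \<and>
     (\<forall>v. Ck_on k (\<lambda>x. frechet_derivative f (at x) v) S)"

definition smooth_on :: "('a::real_normed_vector \<Rightarrow> 'b::real_normed_vector) \<Rightarrow> 'a set \<Rightarrow> bool" where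
  "smooth_on f S \<longleftrightarrow> (\<forall>k. Ck_on k f S)"


section \<open>Smooth manifolds\<close>

text \<open>A manifold comes with an indexed atlas. Tensor fields on it are families indexed by the charts,
  given by their local expressions on the chart images; the values of a chart outside its domain, and
  of a local expression outside the chart image, are irrelevant.\<close>

record ('i, 'p, 'e) manifold =
  mf_top :: "'p topology"
  chart_index :: "'i set"
  chart_dom :: "'i \<Rightarrow> 'p set"
  chart_map :: "'i \<Rightarrow> 'p \<Rightarrow> 'e"

definition chart_image :: "('i, 'p, 'e) manifold \<Rightarrow> 'i \<Rightarrow> 'e set" where
  "chart_image M i = chart_map M i ` chart_dom M i"

definition local_dom :: "('i, 'p, 'e) manifold \<Rightarrow> ('j, 'q, 'f) manifold \<Rightarrow> ('p \<Rightarrow> 'q) \<Rightarrow> 'i \<Rightarrow> 'j \<Rightarrow> 'e set" where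
  "local_dom M N f i j = chart_map M i ` {p \<in> chart_dom M i. f p \<in> chart_dom N j}"

definition local_rep :: "('i, 'p, 'e) manifold \<Rightarrow> ('j, 'q, 'f) manifold \<Rightarrow> ('p \<Rightarrow> 'q) \<Rightarrow> 'i \<Rightarrow> 'j \<Rightarrow> 'e \<Rightarrow> 'f" where
  "local_rep M N f i j = chart_map N j \<circ> f \<circ> inv_into (chart_dom M i) (chart_map M i)"

definition smooth_manifold :: "('i, 'p, 'e::euclidean_space) manifold \<Rightarrow> bool" where
  "smooth_manifold M \<longleftrightarrow>
     Hausdorff_space (mf_top M) \<and> second_countable (mf_top M) \<and>
     topspace (mf_top M) = (\<Union>i\<in>chart_index M. chart_dom M i) \<and>
     (\<forall>i\<in>chart_index M. openin (mf_top M) (chart_dom M i) \<and> open (chart_image M i) \<and>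
        homeomorphic_map (subtopology (mf_top M) (chart_dom M i)) (top_of_set (chart_image M i)) (chart_map M i)) \<and>
     (\<forall>i\<in>chart_index M. \<forall>j\<in>chart_index M. smooth_on (local_rep M M id i j) (local_dom M M id i j))"

definition smooth_map ::
  "('i, 'p, 'e::euclidean_space) manifold \<Rightarrow> ('j, 'q, 'f::euclidean_space) manifold \<Rightarrow> ('p \<Rightarrow> 'q) \<Rightarrow> bool" where
  "smooth_map M N f \<longleftrightarrow> continuous_map (mf_top M) (mf_top N) f \<and>
     (\<forall>i\<in>chart_index M. \<forall>j\<in>chart_index N. smooth_on (local_rep M N f i j) (local_dom M N f i j))"

definition prod_manifold ::
  "('i, 'p, 'e) manifold \<Rightarrow> ('j, 'q, 'f) manifold \<Rightarrow> ('i \<times> 'j, 'p \<times> 'q, 'e \<times> 'f) manifold" where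
  "prod_manifold M N =
     \<lparr>mf_top = prod_topology (mf_top M) (mf_top N),
      chart_index = chart_index M \<times> chart_index N,
      chart_dom = (\<lambda>(i, j). chart_dom M i \<times> chart_dom N j),
      chart_map = (\<lambda>(i, j) (p, q). (chart_map M i p, chart_map N j q))\<rparr>"

definition open_submanifold :: "'e::euclidean_space set \<Rightarrow> (unit, 'e, 'e) manifold" where
  "open_submanifold S =
     \<lparr>mf_top = top_of_set S, chart_index = UNIV, chart_dom = (\<lambda>_. S), chart_map = (\<lambda>_ x. x)\<rparr>"


section \<open>Vector fields and metrics\<close>

text \<open>\<open>X\<close> is \<open>f\<close>-related to itself. For \<open>f = id\<close> this is the transformation law of a vector field under
  changes of charts.\<close>

definition preserves_field ::
  "('i, 'p, 'e::euclidean_space) manifold \<Rightarrow> ('p \<Rightarrow> 'p) \<Rightarrow> ('i \<Rightarrow> 'e \<Rightarrow> 'e) \<Rightarrow> bool" where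
  "preserves_field M f X \<longleftrightarrow>
     (\<forall>i\<in>chart_index M. \<forall>j\<in>chart_index M. \<forall>x\<in>local_dom M M f i j.
        X j (local_rep M M f i j x) = frechet_derivative (local_rep M M f i j) (at x) (X i x))"

text \<open>Local expressions of vector fields are normalised to zero outside the chart images, so that equality
  of vector fields is equality of functions.\<close>

definition smooth_vector_field ::
  "('i, 'p, 'e::euclidean_space) manifold \<Rightarrow> ('i \<Rightarrow> 'e \<Rightarrow> 'e) \<Rightarrow> bool" where
  "smooth_vector_field M X \<longleftrightarrow>
     (\<forall>i\<in>chart_index M. smooth_on (X i) (chart_image M i)) \<and>
     preserves_field M id X \<and>
     (\<forall>i x. \<not> (i \<in> chart_index M \<and> x \<in> chart_image M i) \<longrightarrow> X i x = 0)"

definition vf_bracket ::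
  "('i, 'p, 'e::euclidean_space) manifold \<Rightarrow> ('i \<Rightarrow> 'e \<Rightarrow> 'e) \<Rightarrow> ('i \<Rightarrow> 'e \<Rightarrow> 'e) \<Rightarrow> 'i \<Rightarrow> 'e \<Rightarrow> 'e" where
  "vf_bracket M X Y i x =
     (if i \<in> chart_index M \<and> x \<in> chart_image M i
      then frechet_derivative (Y i) (at x) (X i x) - frechet_derivative (X i) (at x) (Y i x)
      else 0)"

text \<open>\<open>f\<^sup>* s = s\<close>; for \<open>f = id\<close> this is the transformation law of a covariant 2-tensor.\<close>

definition preserves_form ::
  "('i, 'p, 'e::euclidean_space) manifold \<Rightarrow> ('p \<Rightarrow> 'p) \<Rightarrow> ('i \<Rightarrow> 'e \<Rightarrow> 'e \<Rightarrow> 'e \<Rightarrow> real) \<Rightarrow> bool" where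
  "preserves_form M f s \<longleftrightarrow>
     (\<forall>i\<in>chart_index M. \<forall>j\<in>chart_index M. \<forall>x\<in>local_dom M M f i j. \<forall>v w.
        s j (local_rep M M f i j x)
          (frechet_derivative (local_rep M M f i j) (at x) v)
          (frechet_derivative (local_rep M M f i j) (at x) w) = s i x v w)"

definition pseudo_riemannian_metric ::
  "('i, 'p, 'e::euclidean_space) manifold \<Rightarrow> ('i \<Rightarrow> 'e \<Rightarrow> 'e \<Rightarrow> 'e \<Rightarrow> real) \<Rightarrow> bool" where
  "pseudo_riemannian_metric M s \<longleftrightarrow>
     preserves_form M id s \<and>
     (\<forall>i\<in>chart_index M.
        (\<forall>v w. smooth_on (\<lambda>x. s i x v w) (chart_image M i)) \<and>
        (\<forall>x\<in>chart_image M i. bilinear (s i x) \<and> (\<forall>v w. s i x v w = s i x w v) \<and>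
           (\<forall>v. (\<forall>w. s i x v w = 0) \<longrightarrow> v = 0)))"


section \<open>The Ricci tensor\<close>

text \<open>Local expressions for a metric \<open>\<gamma>\<close> on an open subset of a vector space. With \<open>\<Gamma> = christoffel \<gamma> x\<close>, the
  Levi-Civita connection is \<open>\<nabla>\<^sub>u W = \<partial>\<^sub>u W + \<Gamma>(u, W)\<close>; the conventions are
  \<open>R(u,v) = [\<nabla>\<^sub>u, \<nabla>\<^sub>v] - \<nabla>\<^bsub>[u,v]\<^esub>\<close> and \<open>Ric(v,w) = tr (u \<mapsto> R(u,v)w)\<close>, so that round spheres have positive
  Ricci tensor.\<close>

definition metric_deriv :: "('e::euclidean_space \<Rightarrow> 'e \<Rightarrow> 'e \<Rightarrow> real) \<Rightarrow> 'e \<Rightarrow> 'e \<Rightarrow> 'e \<Rightarrow> 'e \<Rightarrow> real" where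
  "metric_deriv \<gamma> x u v w = frechet_derivative (\<lambda>y. \<gamma> y v w) (at x) u"

definition christoffel :: "('e::euclidean_space \<Rightarrow> 'e \<Rightarrow> 'e \<Rightarrow> real) \<Rightarrow> 'e \<Rightarrow> 'e \<Rightarrow> 'e \<Rightarrow> 'e" where
  "christoffel \<gamma> x u v = (THE z. \<forall>w. 2 * \<gamma> x z w =
     metric_deriv \<gamma> x u v w + metric_deriv \<gamma> x v u w - metric_deriv \<gamma> x w u v)"

definition curvature :: "('e::euclidean_space \<Rightarrow> 'e \<Rightarrow> 'e \<Rightarrow> real) \<Rightarrow> 'e \<Rightarrow> 'e \<Rightarrow> 'e \<Rightarrow> 'e \<Rightarrow> 'e" where
  "curvature \<gamma> x u v w =
     frechet_derivative (\<lambda>y. christoffel \<gamma> y v w) (at x) u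
     - frechet_derivative (\<lambda>y. christoffel \<gamma> y u w) (at x) v
     + christoffel \<gamma> x u (christoffel \<gamma> x v w) - christoffel \<gamma> x v (christoffel \<gamma> x u w)"

definition ricci :: "('e::euclidean_space \<Rightarrow> 'e \<Rightarrow> 'e \<Rightarrow> real) \<Rightarrow> 'e \<Rightarrow> 'e \<Rightarrow> 'e \<Rightarrow> real" where
  "ricci \<gamma> x v w = (\<Sum>b\<in>Basis. curvature \<gamma> x b v w \<bullet> b)"

definition ricci_tensor :: "('i \<Rightarrow> 'e::euclidean_space \<Rightarrow> 'e \<Rightarrow> 'e \<Rightarrow> real) \<Rightarrow> 'i \<Rightarrow> 'e \<Rightarrow> 'e \<Rightarrow> 'e \<Rightarrow> real" where
  "ricci_tensor s i = ricci (s i)"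

definition ricci_flat ::
  "('i, 'p, 'e::euclidean_space) manifold \<Rightarrow> ('i \<Rightarrow> 'e \<Rightarrow> 'e \<Rightarrow> 'e \<Rightarrow> real) \<Rightarrow> bool" where
  "ricci_flat M s \<longleftrightarrow> (\<forall>i\<in>chart_index M. \<forall>x\<in>chart_image M i. \<forall>v w. ricci_tensor s i x v w = 0)"


section \<open>Ambient metrics\<close>

definition ambient_space ::
  "('i, 'p, 'e) manifold \<Rightarrow> real \<Rightarrow> (unit \<times> 'i \<times> unit, real \<times> 'p \<times> real, real \<times> 'e \<times> real) manifold" where
  "ambient_space M \<epsilon> =
     prod_manifold (open_submanifold {0<..}) (prod_manifold M (open_submanifold {-\<epsilon><..<\<epsilon>}))"

text \<open>\<open>2 d(\<rho>t) dt + t\<^sup>2 (g + h(\<rho>))\<close> at \<open>(t, x, \<rho>)\<close>, with \<open>d(\<rho>t) = \<rho> dt + t d\<rho>\<close> and the symmetric product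
  \<open>2 \<alpha> \<beta> = \<alpha> \<otimes> \<beta> + \<beta> \<otimes> \<alpha>\<close> of one-forms.\<close>

definition ambient_form ::
  "('i \<Rightarrow> 'e \<Rightarrow> 'e \<Rightarrow> 'e \<Rightarrow> real) \<Rightarrow> (real \<Rightarrow> 'i \<Rightarrow> 'e \<Rightarrow> 'e \<Rightarrow> 'e \<Rightarrow> real) \<Rightarrow>
   unit \<times> 'i \<times> unit \<Rightarrow> real \<times> 'e \<times> real \<Rightarrow> real \<times> 'e \<times> real \<Rightarrow> real \<times> 'e \<times> real \<Rightarrow> real" where
  "ambient_form g h = (\<lambda>(_, i, _) (t, x, \<rho>) (a, v, b) (a', v', b').
     (\<rho> * a + t * b) * a' + a * (\<rho> * a' + t * b') + t\<^sup>2 * (g i x v v' + h \<rho> i x v v'))"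

definition ricci_flat_ambient_metric ::
  "('i, 'p, 'e::euclidean_space) manifold \<Rightarrow> ('i \<Rightarrow> 'e \<Rightarrow> 'e \<Rightarrow> 'e \<Rightarrow> real) \<Rightarrow> real \<Rightarrow>
   (unit \<times> 'i \<times> unit \<Rightarrow> real \<times> 'e \<times> real \<Rightarrow> real \<times> 'e \<times> real \<Rightarrow> real \<times> 'e \<times> real \<Rightarrow> real) \<Rightarrow> bool" where
  "ricci_flat_ambient_metric M g \<epsilon> gt \<longleftrightarrow>
     (\<exists>h. gt = ambient_form g h \<and>
          (\<forall>i\<in>chart_index M. \<forall>x\<in>chart_image M i. \<forall>v w. h 0 i x v w = 0)) \<and>
     pseudo_riemannian_metric (ambient_space M \<epsilon>) gt \<and>
     ricci_flat (ambient_space M \<epsilon>) gt"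


section \<open>Lie algebras\<close>

text \<open>A Lie algebra is a bracket on a Euclidean-space type, of which only the vector space structure is
  used.\<close>

definition lie_algebra :: "('a::euclidean_space \<Rightarrow> 'a \<Rightarrow> 'a) \<Rightarrow> bool" where
  "lie_algebra br \<longleftrightarrow> bilinear br \<and> (\<forall>x. br x x = 0) \<and>
     (\<forall>x y z. br x (br y z) + br y (br z x) + br z (br x y) = 0)"

definition lie_centre :: "('a::euclidean_space \<Rightarrow> 'a \<Rightarrow> 'a) \<Rightarrow> 'a set" where
  "lie_centre br = {z. \<forall>x. br z x = 0}"

definition two_step_nilpotent :: "('a::euclidean_space \<Rightarrow> 'a \<Rightarrow> 'a) \<Rightarrow> bool" where
  "two_step_nilpotent br \<longleftrightarrow> (\<forall>x y z. br (br x y) z = 0) \<and> (\<exists>x y. br x y \<noteq> 0)"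

definition derivations :: "('a::euclidean_space \<Rightarrow> 'a \<Rightarrow> 'a) \<Rightarrow> ('a \<Rightarrow> 'a) set" where
  "derivations br = {D. linear D \<and> (\<forall>x y. D (br x y) = br (D x) y + br x (D y))}"

definition derivation_action ::
  "('h::euclidean_space \<Rightarrow> 'h \<Rightarrow> 'h) \<Rightarrow> ('k::euclidean_space \<Rightarrow> 'k \<Rightarrow> 'k) \<Rightarrow> ('h \<Rightarrow> 'k \<Rightarrow> 'k) \<Rightarrow> bool" where
  "derivation_action br\<^sub>h br\<^sub>k \<phi> \<longleftrightarrow>
     (\<forall>X. \<phi> X \<in> derivations br\<^sub>k) \<and>
     (\<forall>X X'. \<phi> (X + X') = (\<lambda>Y. \<phi> X Y + \<phi> X' Y)) \<and>
     (\<forall>r X. \<phi> (r *\<^sub>R X) = (\<lambda>Y. r *\<^sub>R \<phi> X Y)) \<and>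
     (\<forall>X X'. \<phi> (br\<^sub>h X X') = (\<lambda>Y. \<phi> X (\<phi> X' Y) - \<phi> X' (\<phi> X Y)))"

definition semidirect_bracket ::
  "('h::euclidean_space \<Rightarrow> 'h \<Rightarrow> 'h) \<Rightarrow> ('k::euclidean_space \<Rightarrow> 'k \<Rightarrow> 'k) \<Rightarrow> ('h \<Rightarrow> 'k \<Rightarrow> 'k) \<Rightarrow>
   'h \<times> 'k \<Rightarrow> 'h \<times> 'k \<Rightarrow> 'h \<times> 'k" where
  "semidirect_bracket br\<^sub>h br\<^sub>k \<phi> = (\<lambda>(X, Y) (X', Y'). (br\<^sub>h X X', br\<^sub>k Y Y' + \<phi> X Y' - \<phi> X' Y))"

definition orth_complement :: "('a \<Rightarrow> 'a \<Rightarrow> real) \<Rightarrow> 'a set \<Rightarrow> 'a set" where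
  "orth_complement B S = {x. \<forall>s\<in>S. B x s = 0}"

definition direct_sum_decomposition :: "'a::real_vector set \<Rightarrow> 'a set \<Rightarrow> bool" where
  "direct_sum_decomposition S T \<longleftrightarrow>
     subspace S \<and> subspace T \<and> S \<inter> T = {0} \<and> {s + t |s t. s \<in> S \<and> t \<in> T} = UNIV"


section \<open>Lie groups\<close>

definition lie_group :: "'p monoid \<Rightarrow> ('i, 'p, 'e::euclidean_space) manifold \<Rightarrow> bool" where
  "lie_group G M \<longleftrightarrow> group G \<and> smooth_manifold M \<and> carrier G = topspace (mf_top M) \<and>
     smooth_map (prod_manifold M M) M (\<lambda>(a, b). a \<otimes>\<^bsub>G\<^esub> b) \<and>
     smooth_map M M (\<lambda>a. m_inv G a)"

definition left_invariant_fields ::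
  "'p monoid \<Rightarrow> ('i, 'p, 'e::euclidean_space) manifold \<Rightarrow> ('i \<Rightarrow> 'e \<Rightarrow> 'e) set" where
  "left_invariant_fields G M =
     {X. smooth_vector_field M X \<and> (\<forall>a\<in>carrier G. preserves_field M (\<lambda>p. a \<otimes>\<^bsub>G\<^esub> p) X)}"

text \<open>\<open>\<theta>\<close> is an isomorphism from the Lie algebra with bracket \<open>br\<close> onto the Lie algebra of left-invariant
  vector fields.\<close>

definition lie_algebra_of ::
  "'p monoid \<Rightarrow> ('i, 'p, 'e::euclidean_space) manifold \<Rightarrow>
   ('a::euclidean_space \<Rightarrow> 'a \<Rightarrow> 'a) \<Rightarrow> ('a \<Rightarrow> 'i \<Rightarrow> 'e \<Rightarrow> 'e) \<Rightarrow> bool" where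
  "lie_algebra_of G M br \<theta> \<longleftrightarrow>
     (\<forall>a b. \<theta> (a + b) = (\<lambda>i x. \<theta> a i x + \<theta> b i x)) \<and>
     (\<forall>r a. \<theta> (r *\<^sub>R a) = (\<lambda>i x. r *\<^sub>R \<theta> a i x)) \<and>
     bij_betw \<theta> UNIV (left_invariant_fields G M) \<and>
     (\<forall>a b. \<theta> (br a b) = vf_bracket M (\<theta> a) (\<theta> b))"

definition left_invariant_metric ::
  "'p monoid \<Rightarrow> ('i, 'p, 'e::euclidean_space) manifold \<Rightarrow> ('i \<Rightarrow> 'e \<Rightarrow> 'e \<Rightarrow> 'e \<Rightarrow> real) \<Rightarrow> bool" where
  "left_invariant_metric G M g \<longleftrightarrow> pseudo_riemannian_metric M g \<and>
     (\<forall>a\<in>carrier G. preserves_form M (\<lambda>p. a \<otimes>\<^bsub>G\<^esub> p) g)"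

text \<open>The inner product that \<open>g\<close> defines on the Lie algebra, by evaluation at the identity; by the
  transformation laws it does not depend on the chart.\<close>

definition metric_at_one ::
  "'p monoid \<Rightarrow> ('i, 'p, 'e) manifold \<Rightarrow> ('a \<Rightarrow> 'i \<Rightarrow> 'e \<Rightarrow> 'e) \<Rightarrow>
   ('i \<Rightarrow> 'e \<Rightarrow> 'e \<Rightarrow> 'e \<Rightarrow> real) \<Rightarrow> 'a \<Rightarrow> 'a \<Rightarrow> real" where
  "metric_at_one G M \<theta> g a b =
     (let i = (SOME i. i \<in> chart_index M \<and> \<one>\<^bsub>G\<^esub> \<in> chart_dom M i);
          x = chart_map M i \<one>\<^bsub>G\<^esub>
      in g i x (\<theta> a i x) (\<theta> b i x))"

end

theory Submission
  imports Defs
begin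

text \<open>The left-invariant fields, together with \<open>\<partial>\<^sub>t\<close> and \<open>\<partial>\<^sub>\<rho>\<close>, form a frame of the ambient space in which
  the ambient metric depends on \<open>t\<close> and \<open>\<rho>\<close> only, so that its Ricci tensor is a trace computed in \<open>\<gg>\<close>. The
  Levi-Civita product preserves the flag \<open>\<zz> \<subseteq> \<kk> \<subseteq> \<gg>\<close>, and \<open>R(\<cdot>,v)w\<close> strictly lowers it when \<open>w \<in> \<kk>\<close>; hence \<open>Ric\<close>
  annihilates \<open>\<kk>\<close>. Adding to the metric a multiple of a form \<open>H\<close> that annihilates \<open>\<kk>\<close> changes the Levi-Civita
  product by a map that annihilates \<open>\<kk>\<close> and takes values in the null ideal \<open>\<zz>\<close>, which contributes no trace. The
  ambient Ricci tensor therefore reduces to \<open>Ric - (n - 2)/2 H\<close>, which vanishes for \<open>H = 2/(n - 2) Ric\<close>.\<close>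

section \<open>Calculus of smooth functions\<close>

text \<open>The obstacle is that all tensors live in charts, with Christoffel symbols given by a
  definite description, while the argument is algebra on \<open>\<gg>\<close>. The bridge is a
  statement about frames: coefficients that are torsion-free and metric must, by nondegeneracy, be
  the Levi-Civita ones. Connections are therefore guessed from the Koszul formula and checked, never
  solved for in coordinates.

  The hypotheses on the metric are used in the form that \<open>\<zz>\<close> and
  \<open>\<kk>\<close> are orthogonal complements of each other; that the complement of
  \<open>\<kk>\<close> lies in \<open>\<zz>\<close> is what the decomposition with the complement of
  \<open>\<hh>\<close> gives.

  The factor n - 2 arises as follows. Up to maps without trace, the ambient curvature operator
  differs from the one on \<open>\<gg>\<close> by -H/2 times the identity, of trace -(n/2) H, and by
  two rank-one maps of trace H/2 each.

  Since H annihilates \<open>\<kk>\<close>, the form B + \<rho> H is nondegenerate for every \<rho>,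
  and its Levi-Civita product is exactly affine in \<rho>. This is why the expansion in \<rho> stops
  after the first order.\<close>

lemma frechet_derivativeI:
  "(f has_derivative f') (at x) \<Longrightarrow> frechet_derivative f (at x) = f'"
  by (rule frechet_derivative_at[symmetric])

lemma frechet_derivative_bilinear:
  assumes "bounded_bilinear h" "f differentiable (at x)" "g differentiable (at x)"
  shows "(\<lambda>y. h (f y) (g y)) differentiable (at x)"
    and "frechet_derivative (\<lambda>y. h (f y) (g y)) (at x) v =
      h (f x) (frechet_derivative g (at x) v) + h (frechet_derivative f (at x) v) (g x)"
proof -
  have "((\<lambda>y. h (f y) (g y)) has_derivative
      (\<lambda>v. h (f x) (frechet_derivative g (at x) v) + h (frechet_derivative f (at x) v) (g x))) (at x)"
    using assms(2,3) unfolding frechet_derivative_works by (rule bounded_bilinear.FDERIV[OF assms(1)])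
  then show "(\<lambda>y. h (f y) (g y)) differentiable (at x)"
    and "frechet_derivative (\<lambda>y. h (f y) (g y)) (at x) v =
      h (f x) (frechet_derivative g (at x) v) + h (frechet_derivative f (at x) v) (g x)"
    by (auto simp: differentiable_def frechet_derivativeI)
qed

lemma frechet_derivative_bounded_linear:
  assumes "bounded_linear h" "f differentiable (at x)"
  shows "(\<lambda>y. h (f y)) differentiable (at x)"
    and "frechet_derivative (\<lambda>y. h (f y)) (at x) v = h (frechet_derivative f (at x) v)"
proof -
  have "((\<lambda>y. h (f y)) has_derivative (\<lambda>v. h (frechet_derivative f (at x) v))) (at x)"
    using assms(2) unfolding frechet_derivative_works by (rule bounded_linear.has_derivative[OF assms(1)])
  then show "(\<lambda>y. h (f y)) differentiable (at x)"
    and "frechet_derivative (\<lambda>y. h (f y)) (at x) v = h (frechet_derivative f (at x) v)"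
    by (auto simp: differentiable_def frechet_derivativeI)
qed

lemma frechet_derivative_add:
  assumes "f differentiable (at x)" "g differentiable (at x)"
  shows "frechet_derivative (\<lambda>y. f y + g y) (at x) v =
    frechet_derivative f (at x) v + frechet_derivative g (at x) v"
  using frechet_derivativeI[OF has_derivative_add[OF assms[unfolded frechet_derivative_works]]] by simp


text \<open>\<open>frechet_derivative\<close> is a choice among the derivatives at x, so it suffices
  that f and g have the same derivatives there; this covers points where neither is
  differentiable.\<close>

lemma frechet_derivative_cong_open:
  assumes "open S" "x \<in> S" "\<And>y. y \<in> S \<Longrightarrow> f y = g y"
  shows "frechet_derivative f (at x) = frechet_derivative g (at x)"
proof -
  have "(f has_derivative f') (at x) \<longleftrightarrow> (g has_derivative f') (at x)" for f'
    using has_derivative_transform_within_open[of f f' x UNIV S g]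
      has_derivative_transform_within_open[of g f' x UNIV S f] assms by auto
  then show ?thesis
    by (simp add: frechet_derivative_def)
qed

lemma differentiable_cong_open:
  assumes "f differentiable (at x)" "open S" "x \<in> S" "\<And>y. y \<in> S \<Longrightarrow> f y = g y"
  shows "g differentiable (at x)"
  using assms has_derivative_transform_within_open[of f _ x UNIV S g] unfolding differentiable_def by blast

section \<open>Closure properties of C^k and smooth functions\<close>

lemma Ck_on_cong:
  assumes "open S" "\<And>x. x \<in> S \<Longrightarrow> f x = g x" "Ck_on k f S"
  shows "Ck_on k g S"
  using assms(2,3)
proof (induction k arbitrary: f g)
  case 0
  then show ?case using continuous_on_cong[of S S f g] by auto
next
  case (Suc k)
  have "g differentiable (at x)" if "x \<in> S" for x
    using differentiable_cong_open[OF _ assms(1) that] Suc.prems that by auto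
  moreover have "Ck_on k (\<lambda>x. frechet_derivative g (at x) v) S" for v
    by (rule Suc.IH[of "\<lambda>x. frechet_derivative f (at x) v"])
      (use Suc.prems in \<open>simp_all add: frechet_derivative_cong_open[OF assms(1), of _ f g]\<close>)
  ultimately show ?case by simp
qed


lemma Ck_on_SucD: "Ck_on (Suc k) f S \<Longrightarrow> Ck_on k f S"
proof (induction k arbitrary: f)
  case 0
  then show ?case
    by (auto intro!: continuous_at_imp_continuous_on differentiable_imp_continuous_within)
next
  case (Suc k)
  have "Ck_on k (\<lambda>x. frechet_derivative f (at x) v) S" for v
    using Suc by (metis Ck_on.simps(2))
  with Suc.prems show ?case by simp
qed

lemma Ck_on_const: "Ck_on k (\<lambda>x. c) S"
  by (induction k arbitrary: c) (auto simp: frechet_derivative_const)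

lemma Ck_on_bounded_linear_id: "bounded_linear f \<Longrightarrow> Ck_on k f S"
proof (cases k)
  case (Suc m)
  assume "bounded_linear f"
  then have *: "(f has_derivative f) (at x)" for x
    by (rule bounded_linear_imp_has_derivative)
  show ?thesis
    using * by (auto simp: Suc differentiable_def Ck_on_const frechet_derivativeI[OF *])
qed (auto intro: linear_continuous_on)

lemma Ck_on_bounded_linear:
  assumes "open S" "bounded_linear h" "Ck_on k f S"
  shows "Ck_on k (\<lambda>x. h (f x)) S"
  using assms(3)
proof (induction k arbitrary: f)
  case 0
  then show ?case using assms(2) by (auto intro: bounded_linear.continuous_on)
next
  case (Suc k)
  have "Ck_on k (\<lambda>x. frechet_derivative (\<lambda>x. h (f x)) (at x) v) S" for v
    by (rule Ck_on_cong[OF assms(1), of "\<lambda>x. h (frechet_derivative f (at x) v)"])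
      (use Suc in \<open>simp_all add: frechet_derivative_bounded_linear[OF assms(2)]\<close>)
  then show ?case
    using Suc.prems frechet_derivative_bounded_linear(1)[OF assms(2), of f] by auto
qed

lemma Ck_on_add:
  assumes "open S" "Ck_on k f S" "Ck_on k g S"
  shows "Ck_on k (\<lambda>x. f x + g x) S"
  using assms(2,3)
proof (induction k arbitrary: f g)
  case 0
  then show ?case by (auto intro: continuous_on_add)
next
  case (Suc k)
  have "Ck_on k (\<lambda>x. frechet_derivative (\<lambda>x. f x + g x) (at x) v) S" for v
    by (rule Ck_on_cong[OF assms(1), of "\<lambda>x. frechet_derivative f (at x) v + frechet_derivative g (at x) v"])
      (use Suc in \<open>simp_all add: frechet_derivative_add\<close>)
  then show ?case
    using Suc.prems by auto
qed

text \<open>Leibniz rule: each summand pairs a derivative with an undifferentiated factor, whose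
  order is lowered to k by \<open>Ck_on_SucD\<close> before the induction hypothesis
  applies.\<close>

lemma Ck_on_bilinear:
  assumes "open S" "bounded_bilinear h" "Ck_on k f S" "Ck_on k g S"
  shows "Ck_on k (\<lambda>x. h (f x) (g x)) S"
  using assms(3,4)
proof (induction k arbitrary: f g)
  case 0
  then show ?case using assms(2) by (auto intro: bounded_bilinear.continuous_on)
next
  case (Suc k)
  have "Ck_on k (\<lambda>x. frechet_derivative (\<lambda>x. h (f x) (g x)) (at x) v) S" for v
  proof (rule Ck_on_cong[OF assms(1)])
    show "Ck_on k (\<lambda>x. h (f x) (frechet_derivative g (at x) v) + h (frechet_derivative f (at x) v) (g x)) S"
      using Suc.prems Suc.prems[THEN Ck_on_SucD] by (intro Ck_on_add assms(1) Suc.IH) auto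
  qed (use Suc.prems in \<open>simp add: frechet_derivative_bilinear[OF assms(2)]\<close>)
  then show ?case
    using Suc.prems frechet_derivative_bilinear(1)[OF assms(2), of f _ g] by auto
qed

lemma Ck_on_sum:
  assumes "open S" "\<And>i. i \<in> A \<Longrightarrow> Ck_on k (f i) S"
  shows "Ck_on k (\<lambda>x. \<Sum>i\<in>A. f i x) S"
  using assms(2) by (induction A rule: infinite_finite_induct) (auto intro: Ck_on_const Ck_on_add assms(1))

lemma frechet_derivative_affine:
  assumes "bounded_linear L" "f differentiable (at (L x + c))"
  shows "(\<lambda>y. f (L y + c)) differentiable (at x)"
    and "frechet_derivative (\<lambda>y. f (L y + c)) (at x) v = frechet_derivative f (at (L x + c)) (L v)"
proof -
  have 1: "((\<lambda>y. L y + c) has_derivative L) (at x)"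
    by (auto intro!: derivative_eq_intros bounded_linear_imp_has_derivative assms(1))
  have "((\<lambda>y. f (L y + c)) has_derivative (\<lambda>v. frechet_derivative f (at (L x + c)) (L v))) (at x)"
    using assms(2) unfolding frechet_derivative_works by (rule has_derivative_compose[OF 1])
  then show "(\<lambda>y. f (L y + c)) differentiable (at x)"
    and "frechet_derivative (\<lambda>y. f (L y + c)) (at x) v = frechet_derivative f (at (L x + c)) (L v)"
    by (auto simp: differentiable_def frechet_derivativeI)
qed

text \<open>An affine substitution turns the direction v into the constant direction
  \<open>L v\<close>, so a derivative of the composite is again a composite of the same form.
  Freezing one argument of the group multiplication and projecting to a factor of the ambient space
  are of this kind.\<close>

lemma Ck_on_affine:
  assumes "open T" "bounded_linear L" "\<And>x. x \<in> T \<Longrightarrow> L x + c \<in> S" "Ck_on k f S"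
  shows "Ck_on k (\<lambda>x. f (L x + c)) T"
  using assms(4)
proof (induction k arbitrary: f)
  case 0
  have "continuous_on T (\<lambda>x. L x + c)"
    by (intro continuous_intros linear_continuous_on assms(2))
  then show ?case using 0 assms(3)
    by (auto intro!: continuous_on_compose2[of S f T])
next
  case (Suc k)
  have "Ck_on k (\<lambda>x. frechet_derivative (\<lambda>x. f (L x + c)) (at x) v) T" for v
  proof (rule Ck_on_cong[OF assms(1)])
    show "Ck_on k (\<lambda>x. frechet_derivative f (at (L x + c)) (L v)) T"
      using Suc.prems by (intro Suc.IH) simp
  qed (use Suc.prems assms(3) in \<open>simp add: frechet_derivative_affine[OF assms(2)]\<close>)
  then show ?case
    using Suc.prems frechet_derivative_affine(1)[OF assms(2), of f] assms(3) by auto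
qed

lemma smooth_on_differentiable: "smooth_on f S \<Longrightarrow> x \<in> S \<Longrightarrow> f differentiable (at x)"
  unfolding smooth_on_def by (metis Ck_on.simps(2))

lemma smooth_on_frechet_derivative:
  "smooth_on f S \<Longrightarrow> smooth_on (\<lambda>x. frechet_derivative f (at x) v) S"
  unfolding smooth_on_def by (metis Ck_on.simps(2))


lemma smooth_on_cong:
  "open S \<Longrightarrow> smooth_on f S \<Longrightarrow> (\<And>x. x \<in> S \<Longrightarrow> f x = g x) \<Longrightarrow> smooth_on g S"
  unfolding smooth_on_def by (blast intro: Ck_on_cong)

lemma smooth_on_const: "smooth_on (\<lambda>x. c) S"
  unfolding smooth_on_def by (blast intro: Ck_on_const)

lemma smooth_on_linear: "bounded_linear f \<Longrightarrow> smooth_on f S"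
  unfolding smooth_on_def by (blast intro: Ck_on_bounded_linear_id)

lemma smooth_on_bounded_linear:
  "open S \<Longrightarrow> bounded_linear h \<Longrightarrow> smooth_on f S \<Longrightarrow> smooth_on (\<lambda>x. h (f x)) S"
  unfolding smooth_on_def by (blast intro: Ck_on_bounded_linear)

lemma smooth_on_add:
  "open S \<Longrightarrow> smooth_on f S \<Longrightarrow> smooth_on g S \<Longrightarrow> smooth_on (\<lambda>x. f x + g x) S"
  unfolding smooth_on_def by (blast intro: Ck_on_add)

lemma smooth_on_bilinear:
  "open S \<Longrightarrow> bounded_bilinear h \<Longrightarrow> smooth_on f S \<Longrightarrow> smooth_on g S \<Longrightarrow> smooth_on (\<lambda>x. h (f x) (g x)) S"
  unfolding smooth_on_def by (blast intro: Ck_on_bilinear)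

lemmas smooth_on_mult = smooth_on_bilinear[OF _ bounded_bilinear_mult]
lemmas smooth_on_scaleR = smooth_on_bilinear[OF _ bounded_bilinear_scaleR]

lemma smooth_on_sum:
  "open S \<Longrightarrow> (\<And>i. i \<in> A \<Longrightarrow> smooth_on (f i) S) \<Longrightarrow> smooth_on (\<lambda>x. \<Sum>i\<in>A. f i x) S"
  unfolding smooth_on_def by (blast intro: Ck_on_sum)

lemma smooth_on_affine:
  "open T \<Longrightarrow> bounded_linear L \<Longrightarrow> (\<And>x. x \<in> T \<Longrightarrow> L x + c \<in> S) \<Longrightarrow> smooth_on f S
    \<Longrightarrow> smooth_on (\<lambda>x. f (L x + c)) T"
  unfolding smooth_on_def by (blast intro: Ck_on_affine)

section \<open>Symmetry of second derivatives\<close>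

lemma has_real_derivative_line:
  fixes f :: "'a::real_normed_vector \<Rightarrow> real"
  assumes "f differentiable (at (p + r *\<^sub>R u))"
  shows "((\<lambda>r. f (p + r *\<^sub>R u)) has_real_derivative frechet_derivative f (at (p + r *\<^sub>R u)) u) (at r)"
proof -
  have lin: "linear (frechet_derivative f (at (p + r *\<^sub>R u)))"
    by (rule linear_frechet_derivative[OF assms])
  have 1: "((\<lambda>r. p + r *\<^sub>R u) has_derivative (\<lambda>h. h *\<^sub>R u)) (at r)"
    by (auto intro!: derivative_eq_intros)
  have "((\<lambda>r. f (p + r *\<^sub>R u)) has_derivative (\<lambda>h. frechet_derivative f (at (p + r *\<^sub>R u)) (h *\<^sub>R u))) (at r)"
    using assms unfolding frechet_derivative_works by (rule has_derivative_compose[OF 1])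
  then show ?thesis
    unfolding has_field_derivative_def
    by (rule has_derivative_eq_rhs) (simp add: fun_eq_iff linear_cmul[OF lin])
qed

text \<open>The mean value theorem is applied twice: along u to the difference of f on two lines
  that are \<open>s *\<^sub>R v\<close> apart, then along v to the derivative of f in direction
  u.\<close>

lemma second_difference_mean_value:
  fixes f :: "'a::real_normed_vector \<Rightarrow> real"
  assumes s: "s > 0"
    and sub: "\<And>a b. 0 \<le> a \<Longrightarrow> a \<le> s \<Longrightarrow> 0 \<le> b \<Longrightarrow> b \<le> s \<Longrightarrow> x + a *\<^sub>R u + b *\<^sub>R v \<in> U"
    and f: "Ck_on (Suc (Suc 0)) f U"
  obtains a b where "0 < a" "a < s" "0 < b" "b < s"
    "f (x + s *\<^sub>R u + s *\<^sub>R v) - f (x + s *\<^sub>R u) - f (x + s *\<^sub>R v) + f x =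
       s * s * frechet_derivative (\<lambda>y. frechet_derivative f (at y) u) (at (x + a *\<^sub>R u + b *\<^sub>R v)) v"
proof -
  have d1: "f differentiable (at y)" "(\<lambda>y. frechet_derivative f (at y) u) differentiable (at y)"
    if "y \<in> U" for y
    using f that by auto
  have "((\<lambda>r. f (x + r *\<^sub>R u + s *\<^sub>R v) - f (x + r *\<^sub>R u)) has_real_derivative
      frechet_derivative f (at (x + r *\<^sub>R u + s *\<^sub>R v)) u - frechet_derivative f (at (x + r *\<^sub>R u)) u) (at r)"
    if "0 \<le> r" "r \<le> s" for r
  proof -
    have e: "x + r *\<^sub>R u + s *\<^sub>R v = (x + s *\<^sub>R v) + r *\<^sub>R u" for r
      by simp
    have "x + r *\<^sub>R u + s *\<^sub>R v \<in> U" "x + r *\<^sub>R u \<in> U"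
      using sub[OF that, of s] sub[OF that, of 0] s by auto
    then show ?thesis
      unfolding e by (intro DERIV_diff has_real_derivative_line d1)
  qed
  from MVT2[OF s this] obtain a where a: "0 < a" "a < s"
    and 1: "f (x + s *\<^sub>R u + s *\<^sub>R v) - f (x + s *\<^sub>R u) - (f (x + s *\<^sub>R v) - f x) =
      s * (frechet_derivative f (at (x + a *\<^sub>R u + s *\<^sub>R v)) u - frechet_derivative f (at (x + a *\<^sub>R u)) u)"
    by auto
  have "((\<lambda>r. frechet_derivative f (at ((x + a *\<^sub>R u) + r *\<^sub>R v)) u) has_real_derivative
      frechet_derivative (\<lambda>y. frechet_derivative f (at y) u) (at ((x + a *\<^sub>R u) + r *\<^sub>R v)) v) (at r)"
    if "0 \<le> r" "r \<le> s" for r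
    using sub[of a r] a that by (intro has_real_derivative_line d1) auto
  from MVT2[OF s this] obtain b where b: "0 < b" "b < s"
    and 2: "frechet_derivative f (at (x + a *\<^sub>R u + s *\<^sub>R v)) u - frechet_derivative f (at (x + a *\<^sub>R u)) u =
      s * frechet_derivative (\<lambda>y. frechet_derivative f (at y) u) (at (x + a *\<^sub>R u + b *\<^sub>R v)) v"
    by auto
  show ?thesis
    by (rule that[OF a b]) (use 1 in \<open>simp add: 2 mult.assoc\<close>)
qed

text \<open>The second difference over a small parallelogram is symmetric in u and v. Computed in
  the two orders it is s * s times either mixed derivative at some nearby point, so the mixed
  derivatives take a common value arbitrarily close to x, and by continuity they cannot differ at
  x.\<close>

lemma second_derivative_commute_real:
  fixes f :: "'a::real_normed_vector \<Rightarrow> real"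
  assumes "open U" "x \<in> U" and f: "Ck_on (Suc (Suc 0)) f U"
  shows "frechet_derivative (\<lambda>y. frechet_derivative f (at y) u) (at x) v =
    frechet_derivative (\<lambda>y. frechet_derivative f (at y) v) (at x) u"
proof (rule ccontr)
  define A where "A = (\<lambda>y. frechet_derivative (\<lambda>y. frechet_derivative f (at y) u) (at y) v)"
  define A' where "A' = (\<lambda>y. frechet_derivative (\<lambda>y. frechet_derivative f (at y) v) (at y) u)"
  assume "\<not> ?thesis"
  then have e: "\<bar>A x - A' x\<bar> / 2 > 0"
    by (simp add: A_def A'_def)
  have "continuous_on U A" "continuous_on U A'"
    using f by (auto simp: A_def A'_def)
  then have "continuous (at x) A" "continuous (at x) A'"
    using assms(1,2) by (auto simp: continuous_on_eq_continuous_at)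
  then obtain d1 d2 where "d1 > 0" "\<forall>y. dist y x < d1 \<longrightarrow> dist (A y) (A x) < \<bar>A x - A' x\<bar> / 2"
    "d2 > 0" "\<forall>y. dist y x < d2 \<longrightarrow> dist (A' y) (A' x) < \<bar>A x - A' x\<bar> / 2"
    using e unfolding continuous_at_eps_delta by blast
  then have d: "d1 > 0" "\<And>y. dist y x < d1 \<Longrightarrow> dist (A y) (A x) < \<bar>A x - A' x\<bar> / 2"
    "d2 > 0" "\<And>y. dist y x < d2 \<Longrightarrow> dist (A' y) (A' x) < \<bar>A x - A' x\<bar> / 2"
    by auto
  obtain d3 where d3: "d3 > 0" "\<And>y. dist y x < d3 \<Longrightarrow> y \<in> U"
    using assms(1,2) unfolding open_dist by blast
  define d0 where "d0 = min d1 (min d2 d3)"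
  \<comment> \<open>This makes the whole parallelogram lie within distance \<open>d0\<close> of x;
    the summand 1 keeps the denominator positive when u and v are zero.\<close>
  define s where "s = d0 / (norm u + norm v + 1)"
  have pos: "norm u + norm v + 1 > 0"
    using norm_ge_zero[of u] norm_ge_zero[of v] by linarith
  have d0: "d0 > 0"
    using d d3 by (simp add: d0_def)
  then have s: "s > 0"
    using pos by (simp add: s_def)
  have near: "dist (x + a *\<^sub>R u + b *\<^sub>R v) x < d0" if "0 \<le> a" "a \<le> s" "0 \<le> b" "b \<le> s" for a b
  proof -
    have "dist (x + a *\<^sub>R u + b *\<^sub>R v) x \<le> a * norm u + b * norm v"
      using norm_triangle_ineq[of "a *\<^sub>R u" "b *\<^sub>R v"] that by (simp add: dist_norm add.assoc)
    also have "\<dots> \<le> s * norm u + s * norm v"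
      using that by (intro add_mono mult_right_mono) auto
    also have "\<dots> < s * (norm u + norm v + 1)"
      using s by (simp add: algebra_simps)
    also have "\<dots> = d0"
      using pos by (simp add: s_def)
    finally show ?thesis .
  qed
  have "x + a *\<^sub>R u + b *\<^sub>R v \<in> U" if "0 \<le> a" "a \<le> s" "0 \<le> b" "b \<le> s" for a b
    using near[OF that] d3 by (simp add: d0_def)
  note in_U = this
  obtain a b where ab:
    "0 < a" "a < s" "0 < b" "b < s"
    "f (x + s *\<^sub>R u + s *\<^sub>R v) - f (x + s *\<^sub>R u) - f (x + s *\<^sub>R v) + f x = s * s * A (x + a *\<^sub>R u + b *\<^sub>R v)"
    unfolding A_def by (rule second_difference_mean_value[OF s in_U f])
  have sw: "x + a *\<^sub>R v + b *\<^sub>R u = x + b *\<^sub>R u + a *\<^sub>R v" for a b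
    by simp
  have "x + a *\<^sub>R v + b *\<^sub>R u \<in> U" if "0 \<le> a" "a \<le> s" "0 \<le> b" "b \<le> s" for a b
    using near[of b a] that d3 unfolding sw by (simp add: d0_def)
  note in_U' = this
  obtain a' b' where ab':
    "0 < a'" "a' < s" "0 < b'" "b' < s"
    "f (x + s *\<^sub>R v + s *\<^sub>R u) - f (x + s *\<^sub>R v) - f (x + s *\<^sub>R u) + f x = s * s * A' (x + a' *\<^sub>R v + b' *\<^sub>R u)"
    unfolding A'_def by (rule second_difference_mean_value[OF s in_U' f])
  have "s * s * A (x + a *\<^sub>R u + b *\<^sub>R v) = s * s * A' (x + b' *\<^sub>R u + a' *\<^sub>R v)"
    using ab(5) ab'(5) unfolding sw by linarith
  then have eq: "A (x + a *\<^sub>R u + b *\<^sub>R v) = A' (x + b' *\<^sub>R u + a' *\<^sub>R v)"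
    using s by simp
  have "dist (A (x + a *\<^sub>R u + b *\<^sub>R v)) (A x) < \<bar>A x - A' x\<bar> / 2"
    using near[of a b] ab by (intro d) (simp add: d0_def)
  moreover have "dist (A' (x + b' *\<^sub>R u + a' *\<^sub>R v)) (A' x) < \<bar>A x - A' x\<bar> / 2"
    using near[of b' a'] ab' by (intro d) (simp add: d0_def)
  ultimately have "dist (A x) (A' x) < \<bar>A x - A' x\<bar>"
    unfolding eq by (rule dist_triangle_half_r)
  then show False
    by (simp add: dist_real_def)
qed

lemma second_derivative_commute:
  fixes f :: "'a::real_normed_vector \<Rightarrow> 'b::euclidean_space"
  assumes "open U" "x \<in> U" and f: "Ck_on (Suc (Suc 0)) f U"
  shows "frechet_derivative (\<lambda>y. frechet_derivative f (at y) u) (at x) v =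
    frechet_derivative (\<lambda>y. frechet_derivative f (at y) v) (at x) u"
proof (rule euclidean_eqI)
  fix b :: 'b
  have bl: "bounded_linear (\<lambda>z. z \<bullet> b)"
    by (rule bounded_linear_inner_left)
  have d: "f differentiable (at y)" "(\<lambda>y. frechet_derivative f (at y) w) differentiable (at y)"
    if "y \<in> U" for y w
    using f that by auto
  have "frechet_derivative (\<lambda>y. frechet_derivative f (at y) u) (at x) v \<bullet> b =
     frechet_derivative (\<lambda>y. frechet_derivative (\<lambda>y. f y \<bullet> b) (at y) u) (at x) v" for u v
  proof -
    have "frechet_derivative (\<lambda>y. frechet_derivative (\<lambda>y. f y \<bullet> b) (at y) u) (at x) =
      frechet_derivative (\<lambda>y. frechet_derivative f (at y) u \<bullet> b) (at x)"
      by (rule frechet_derivative_cong_open[OF assms(1,2)])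
        (simp add: frechet_derivative_bounded_linear[OF bl] d)
    then show ?thesis
      by (simp add: frechet_derivative_bounded_linear[OF bl] d assms(2))
  qed
  then show "frechet_derivative (\<lambda>y. frechet_derivative f (at y) u) (at x) v \<bullet> b =
      frechet_derivative (\<lambda>y. frechet_derivative f (at y) v) (at x) u \<bullet> b"
    using second_derivative_commute_real[OF assms(1,2) Ck_on_bounded_linear[OF assms(1) bl f]] by simp
qed


section \<open>Traces\<close>

definition lin_trace :: "('a::euclidean_space \<Rightarrow> 'a) \<Rightarrow> real" where
  "lin_trace T = (\<Sum>b\<in>Basis. T b \<bullet> b)"

lemma lin_trace_add: "lin_trace (\<lambda>x. S x + T x) = lin_trace S + lin_trace T"
  by (simp add: lin_trace_def inner_add_left sum.distrib)

lemma lin_trace_diff: "lin_trace (\<lambda>x. S x - T x) = lin_trace S - lin_trace T"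
  by (simp add: lin_trace_def inner_diff_left sum_subtractf)

lemma lin_trace_uminus: "lin_trace (\<lambda>x. - T x) = - lin_trace T"
  by (simp add: lin_trace_def sum_negf)

lemma lin_trace_scaleR: "lin_trace (\<lambda>x. r *\<^sub>R T x) = r * lin_trace T"
  by (simp add: lin_trace_def sum_distrib_left)

lemma lin_trace_id: "lin_trace (\<lambda>x::'a::euclidean_space. x) = real DIM('a)"
  by (simp add: lin_trace_def)

text \<open>Both traces expand to the same double sum of matrix entries. The two spaces may differ,
  which lets a trace be moved from the tangent space to the space that indexes a frame.\<close>

lemma lin_trace_commute:
  fixes A :: "'a::euclidean_space \<Rightarrow> 'b::euclidean_space" and C :: "'b \<Rightarrow> 'a"
  assumes "linear A" "linear C"
  shows "lin_trace (\<lambda>x. A (C x)) = lin_trace (\<lambda>x. C (A x))"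
proof -
  have A: "A (C b) \<bullet> b = (\<Sum>a\<in>Basis. (C b \<bullet> a) * (A a \<bullet> b))" for b
  proof -
    have "A (C b) = A (\<Sum>a\<in>Basis. (C b \<bullet> a) *\<^sub>R a)"
      by (simp add: euclidean_representation)
    also have "\<dots> = (\<Sum>a\<in>Basis. (C b \<bullet> a) *\<^sub>R A a)"
      by (simp add: linear_sum[OF assms(1)] linear_cmul[OF assms(1)])
    finally show ?thesis
      by (simp add: inner_sum_left)
  qed
  have C: "C (A a) \<bullet> a = (\<Sum>b\<in>Basis. (A a \<bullet> b) * (C b \<bullet> a))" for a
  proof -
    have "C (A a) = C (\<Sum>b\<in>Basis. (A a \<bullet> b) *\<^sub>R b)"
      by (simp add: euclidean_representation)
    also have "\<dots> = (\<Sum>b\<in>Basis. (A a \<bullet> b) *\<^sub>R C b)"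
      by (simp add: linear_sum[OF assms(2)] linear_cmul[OF assms(2)])
    finally show ?thesis
      by (simp add: inner_sum_left)
  qed
  show ?thesis
    unfolding lin_trace_def A C by (subst sum.swap) (simp add: mult.commute)
qed

lemma lin_trace_rank_one:
  assumes "linear f"
  shows "lin_trace (\<lambda>x. f x *\<^sub>R w) = f w"
proof -
  have "f w = f (\<Sum>b\<in>Basis. (w \<bullet> b) *\<^sub>R b)"
    by (simp add: euclidean_representation)
  also have "\<dots> = (\<Sum>b\<in>Basis. (w \<bullet> b) * f b)"
    by (simp add: linear_sum[OF assms] linear_cmul[OF assms])
  finally show ?thesis
    by (simp add: lin_trace_def mult.commute)
qed

section \<open>Vanishing of traces along a flag of subspaces\<close>

lemma subspace_projection:
  fixes S :: "'a::euclidean_space set"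
  assumes "subspace S"
  obtains P where "linear P" "\<And>x. P x \<in> S" "\<And>x. x \<in> S \<Longrightarrow> P x = x"
proof -
  have "\<exists>P. range P \<subseteq> S \<and> linear P \<and> (\<forall>v\<in>S. P (id v) = v)"
    using assms by (intro real_vector.linear_exists_left_inverse_on) (auto simp: linear_iff)
  then show ?thesis using that by auto
qed

text \<open>For a projection P onto S one has T = P T because T maps into S, and tr (P T) = tr (T P)
  = 0 because T annihilates S.\<close>

lemma lin_trace_nilpotent:
  assumes T: "linear T" and S: "subspace S" "\<And>x. T x \<in> S" "\<And>x. x \<in> S \<Longrightarrow> T x = 0"
  shows "lin_trace T = 0"
proof -
  obtain P where P: "linear P" "\<And>x. P x \<in> S" "\<And>x. x \<in> S \<Longrightarrow> P x = x"
    using subspace_projection[OF S(1)] by blast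
  have "lin_trace T = lin_trace (\<lambda>x. P (T x))"
    by (simp add: P(3) S(2))
  also have "\<dots> = lin_trace (\<lambda>x. T (P x))"
    by (rule lin_trace_commute[OF P(1) T])
  also have "\<dots> = 0"
    by (simp add: S(3) P(2) lin_trace_def)
  finally show ?thesis .
qed

text \<open>As before tr T = tr (T P); now T P maps into R and annihilates R, so the two-step case
  applies to it.\<close>

lemma lin_trace_filtration:
  assumes T: "linear T" and S: "subspace S" "subspace R"
    and "\<And>x. T x \<in> S" "\<And>x. x \<in> S \<Longrightarrow> T x \<in> R" "\<And>x. x \<in> R \<Longrightarrow> T x = 0" "R \<subseteq> S"
  shows "lin_trace T = 0"
proof -
  obtain P where P: "linear P" "\<And>x. P x \<in> S" "\<And>x. x \<in> S \<Longrightarrow> P x = x"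
    using subspace_projection[OF S(1)] by blast
  have "lin_trace T = lin_trace (\<lambda>x. P (T x))"
    by (simp add: P(3) assms(4))
  also have "\<dots> = lin_trace (\<lambda>x. T (P x))"
    by (rule lin_trace_commute[OF P(1) T])
  also have "\<dots> = 0"
    by (rule lin_trace_nilpotent[OF linear_compose[OF P(1) T, unfolded o_def] S(2)])
      (use P assms in auto)
  finally show ?thesis .
qed

lemma lin_trace_triple:
  fixes T :: "real \<times> 'a::euclidean_space \<times> real \<Rightarrow> real \<times> 'a \<times> real"
  shows "lin_trace T = fst (T (1, 0, 0)) + lin_trace (\<lambda>v. fst (snd (T (0, v, 0)))) + snd (snd (T (0, 0, 1)))"
proof -
  have inj: "inj_on (\<lambda>u. (u, 0)) A" "inj_on (\<lambda>u. (0, u)) A" for A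
    by (auto intro: inj_onI)
  have prod: "(\<Sum>b\<in>Basis. f b) = (\<Sum>b\<in>Basis. f (b, 0)) + (\<Sum>b\<in>Basis. f (0, b))"
    for f :: "'b::euclidean_space \<times> 'c::euclidean_space \<Rightarrow> real"
    unfolding Basis_prod_def
    by (subst sum.union_disjoint) (auto simp: sum.reindex[OF inj(1)] sum.reindex[OF inj(2)])
  show ?thesis
    by (simp add: lin_trace_def prod inner_prod_def zero_prod_def)
qed


section \<open>Curvature in a moving frame\<close>

lemma bilinear_left: "bilinear f \<Longrightarrow> linear (\<lambda>x. f x y)"
  and bilinear_right: "bilinear f \<Longrightarrow> linear (f x)"
  by (auto simp: bilinear_def)

text \<open>Expansion in the Euclidean basis reduces the family to finitely many vector-valued
  functions \<open>\<lambda>y. A y b\<close>, so the product rule follows from differentiability at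
  each fixed vector.\<close>

lemma linear_family_apply:
  fixes A :: "'z::real_normed_vector \<Rightarrow> 'a::euclidean_space \<Rightarrow> 'b::real_normed_vector"
  assumes U: "open U" "x \<in> U" and lin: "\<And>y. y \<in> U \<Longrightarrow> linear (A y)"
    and dA: "\<And>v. (\<lambda>y. A y v) differentiable (at x)" and dX: "X differentiable (at x)"
  shows "(\<lambda>y. A y (X y)) differentiable (at x)"
    and "frechet_derivative (\<lambda>y. A y (X y)) (at x) u =
      frechet_derivative (\<lambda>y. A y (X x)) (at x) u + A x (frechet_derivative X (at x) u)"
proof -
  have expand: "A y v = (\<Sum>b\<in>Basis. (v \<bullet> b) *\<^sub>R A y b)" if "y \<in> U" for y v
  proof -
    have "A y v = A y (\<Sum>b\<in>Basis. (v \<bullet> b) *\<^sub>R b)"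
      by (simp add: euclidean_representation)
    then show ?thesis
      by (simp add: linear_sum[OF lin[OF that]] linear_cmul[OF lin[OF that]])
  qed
  have *: "((\<lambda>y. A y (Y y)) has_derivative
      (\<lambda>u. \<Sum>b\<in>Basis. (Y x \<bullet> b) *\<^sub>R frechet_derivative (\<lambda>y. A y b) (at x) u
        + (frechet_derivative Y (at x) u \<bullet> b) *\<^sub>R A x b)) (at x)"
    if "Y differentiable (at x)" for Y
  proof (rule has_derivative_transform_within_open[OF _ U])
    show "((\<lambda>y. \<Sum>b\<in>Basis. (Y y \<bullet> b) *\<^sub>R A y b) has_derivative
      (\<lambda>u. \<Sum>b\<in>Basis. (Y x \<bullet> b) *\<^sub>R frechet_derivative (\<lambda>y. A y b) (at x) u
        + (frechet_derivative Y (at x) u \<bullet> b) *\<^sub>R A x b)) (at x)"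
      using that[unfolded frechet_derivative_works] dA[unfolded frechet_derivative_works]
      by (intro has_derivative_sum has_derivative_scaleR has_derivative_inner_left) auto
  qed (use expand in auto)
  show "(\<lambda>y. A y (X y)) differentiable (at x)"
    using *[OF dX] by (auto simp: differentiable_def)
  have c: "frechet_derivative (\<lambda>y. A y (X x)) (at x) u =
      (\<Sum>b\<in>Basis. (X x \<bullet> b) *\<^sub>R frechet_derivative (\<lambda>y. A y b) (at x) u)"
    using frechet_derivativeI[OF *[of "\<lambda>_. X x"]] by (simp add: frechet_derivative_const)
  show "frechet_derivative (\<lambda>y. A y (X y)) (at x) u =
      frechet_derivative (\<lambda>y. A y (X x)) (at x) u + A x (frechet_derivative X (at x) u)"
    unfolding frechet_derivativeI[OF *[OF dX]] c expand[OF U(2), of "frechet_derivative X (at x) u"]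
    by (simp add: sum.distrib)
qed

lemma linear_family_derivative:
  assumes U: "open U" "x \<in> U" and lin: "\<And>y. y \<in> U \<Longrightarrow> linear (A y)"
    and dA: "\<And>v. (\<lambda>y. A y v) differentiable (at x)"
  shows "linear (\<lambda>v. frechet_derivative (\<lambda>y. A y v) (at x) u)"
proof (rule linearI)
  show "frechet_derivative (\<lambda>y. A y (v + w)) (at x) u =
      frechet_derivative (\<lambda>y. A y v) (at x) u + frechet_derivative (\<lambda>y. A y w) (at x) u" for v w
  proof -
    have "frechet_derivative (\<lambda>y. A y (v + w)) (at x) = frechet_derivative (\<lambda>y. A y v + A y w) (at x)"
      by (rule frechet_derivative_cong_open[OF U]) (simp add: linear_add lin)
    then show ?thesis by (simp add: frechet_derivative_add dA)
  qed
  show "frechet_derivative (\<lambda>y. A y (r *\<^sub>R v)) (at x) u =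
      r *\<^sub>R frechet_derivative (\<lambda>y. A y v) (at x) u" for r v
  proof -
    have "frechet_derivative (\<lambda>y. A y (r *\<^sub>R v)) (at x) = frechet_derivative (\<lambda>y. r *\<^sub>R A y v) (at x)"
      by (rule frechet_derivative_cong_open[OF U]) (simp add: linear_cmul lin)
    then show ?thesis
      by (simp add: frechet_derivative_bounded_linear[OF bounded_linear_scaleR_right dA])
  qed
qed

lemma bilinear_family_apply:
  fixes A :: "'z::real_normed_vector \<Rightarrow> 'a::euclidean_space \<Rightarrow> 'b::euclidean_space \<Rightarrow> 'c::real_normed_vector"
  assumes U: "open U" "x \<in> U" and bil: "\<And>y. y \<in> U \<Longrightarrow> bilinear (A y)"
    and dA: "\<And>v w. (\<lambda>y. A y v w) differentiable (at x)"
    and dX: "X differentiable (at x)" and dY: "Y differentiable (at x)"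
  shows "(\<lambda>y. A y (X y) (Y y)) differentiable (at x)"
    and "frechet_derivative (\<lambda>y. A y (X y) (Y y)) (at x) u =
      frechet_derivative (\<lambda>y. A y (X x) (Y x)) (at x) u
      + A x (frechet_derivative X (at x) u) (Y x) + A x (X x) (frechet_derivative Y (at x) u)"
proof -
  note 1 = linear_family_apply[OF U bilinear_right[OF bil] dA dY]
  note 2 = linear_family_apply[OF U bilinear_left[OF bil] 1(1) dX]
  show "(\<lambda>y. A y (X y) (Y y)) differentiable (at x)"
    by (rule 2)
  show "frechet_derivative (\<lambda>y. A y (X y) (Y y)) (at x) u =
      frechet_derivative (\<lambda>y. A y (X x) (Y x)) (at x) u
      + A x (frechet_derivative X (at x) u) (Y x) + A x (X x) (frechet_derivative Y (at x) u)"
    by (simp add: 2(2) 1(2))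
qed


text \<open>\<open>E\<close> is a frame indexed by a fixed vector space and \<open>F\<close> its
  coframe; \<open>c\<close>, \<open>\<beta>\<close> and \<open>\<omega>\<close> are the bracket, the
  metric and the connection in that frame. There are two instances: the left-invariant fields on G,
  where \<open>\<beta>\<close> and \<open>\<omega>\<close> are constant, and the ambient frame,
  where they vary with t and \<rho>. With \<open>\<omega>\<close> as a parameter, a proposed
  connection only has to be checked.\<close>

locale metric_frame =
  fixes U :: "'e::euclidean_space set" and \<gamma> :: "'e \<Rightarrow> 'e \<Rightarrow> 'e \<Rightarrow> real"
    and E :: "'e \<Rightarrow> 'w::euclidean_space \<Rightarrow> 'e" and F :: "'e \<Rightarrow> 'e \<Rightarrow> 'w"
    and c :: "'w \<Rightarrow> 'w \<Rightarrow> 'w" and \<beta> :: "'e \<Rightarrow> 'w \<Rightarrow> 'w \<Rightarrow> real" and \<omega> :: "'e \<Rightarrow> 'w \<Rightarrow> 'w \<Rightarrow> 'w"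
  assumes open_U: "open U"
    and lin_E: "x \<in> U \<Longrightarrow> linear (E x)"
    and E_F: "x \<in> U \<Longrightarrow> E x (F x v) = v"
    and F_E: "x \<in> U \<Longrightarrow> F x (E x a) = a"
    and C2_E: "Ck_on (Suc (Suc 0)) (\<lambda>x. E x a) U"
    and diff_F: "x \<in> U \<Longrightarrow> (\<lambda>y. F y v) differentiable (at x)"
    and bil_c: "bilinear c"
    and bracket_E: "x \<in> U \<Longrightarrow> frechet_derivative (\<lambda>y. E y b) (at x) (E x a)
      - frechet_derivative (\<lambda>y. E y a) (at x) (E x b) = E x (c a b)"
    and bil_\<gamma>: "x \<in> U \<Longrightarrow> bilinear (\<gamma> x)"
    and sym_\<gamma>: "x \<in> U \<Longrightarrow> \<gamma> x v w = \<gamma> x w v"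
    and nondeg_\<gamma>: "x \<in> U \<Longrightarrow> (\<And>w. \<gamma> x v w = 0) \<Longrightarrow> v = 0"
    and diff_\<gamma>: "x \<in> U \<Longrightarrow> (\<lambda>y. \<gamma> y v w) differentiable (at x)"
    and \<gamma>_E: "x \<in> U \<Longrightarrow> \<gamma> x (E x a) (E x b) = \<beta> x a b"
    and bil_\<omega>: "x \<in> U \<Longrightarrow> bilinear (\<omega> x)"
    and diff_\<omega>: "x \<in> U \<Longrightarrow> (\<lambda>y. \<omega> y a b) differentiable (at x)"
    and torsion_\<omega>: "x \<in> U \<Longrightarrow> \<omega> x a b - \<omega> x b a = c a b"
    and metric_\<omega>: "x \<in> U \<Longrightarrow> frechet_derivative (\<lambda>y. \<beta> y b d) (at x) (E x a) =
      \<beta> x (\<omega> x a b) d + \<beta> x b (\<omega> x a d)"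
begin

definition conn :: "'e \<Rightarrow> 'e \<Rightarrow> 'e \<Rightarrow> 'e" where
  "conn x u w = E x (\<omega> x (F x u) (F x w)) - frechet_derivative (\<lambda>y. E y (F x w)) (at x) u"

definition frame_curvature :: "'e \<Rightarrow> 'w \<Rightarrow> 'w \<Rightarrow> 'w \<Rightarrow> 'w" where
  "frame_curvature x a p q =
     frechet_derivative (\<lambda>y. \<omega> y p q) (at x) (E x a) - frechet_derivative (\<lambda>y. \<omega> y a q) (at x) (E x p)
     + \<omega> x a (\<omega> x p q) - \<omega> x p (\<omega> x a q) - \<omega> x (c a p) q"

lemma lin_F: assumes "x \<in> U" shows "linear (F x)"
proof (rule linearI)
  show "F x (v + w) = F x v + F x w" for v w
    using F_E[OF assms, of "F x v + F x w"] by (simp add: linear_add[OF lin_E[OF assms]] E_F[OF assms])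
  show "F x (r *\<^sub>R v) = r *\<^sub>R F x v" for r v
    using F_E[OF assms, of "r *\<^sub>R F x v"] by (simp add: linear_cmul[OF lin_E[OF assms]] E_F[OF assms])
qed

lemma diff_E: "x \<in> U \<Longrightarrow> (\<lambda>y. E y a) differentiable (at x)"
  and diff_DE: "x \<in> U \<Longrightarrow> (\<lambda>y. frechet_derivative (\<lambda>y. E y a) (at y) v) differentiable (at x)"
  using C2_E[of a] by auto

lemma lin_DE: assumes "x \<in> U" shows "linear (\<lambda>a. frechet_derivative (\<lambda>y. E y a) (at x) u)"
  by (rule linear_family_derivative[OF open_U assms lin_E diff_E[OF assms]])


lemma lin_conn: assumes "x \<in> U" shows "linear (conn x u)"
proof -
  note l = linear_compose_sub[OF linear_compose[OF lin_F[OF assms]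
        linear_compose[OF bilinear_right[OF bil_\<omega>[OF assms], of "F x u"] lin_E[OF assms]]]
      linear_compose[OF lin_F[OF assms] lin_DE[OF assms, of u]]]
  show ?thesis
    using l by (simp add: conn_def[abs_def] o_def)
qed

text \<open>The antisymmetric part of \<open>\<omega>\<close> is the bracket \<open>c\<close>, and
  it cancels against the commutator of the frame fields in the second summand of
  \<open>conn\<close>.\<close>

lemma conn_commute:
  assumes "x \<in> U" shows "conn x u v = conn x v u"
proof -
  have "E x (\<omega> x (F x u) (F x v)) - E x (\<omega> x (F x v) (F x u)) = E x (c (F x u) (F x v))"
    by (simp add: torsion_\<omega>[OF assms, symmetric] linear_diff[OF lin_E[OF assms]])
  then show ?thesis
    using bracket_E[OF assms, of "F x v" "F x u"] by (simp add: conn_def E_F[OF assms] algebra_simps)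
qed

text \<open>Differentiating \<gamma>(E b, E d) = \<beta> b d along u produces derivatives of the
  frame, and these are exactly the difference between \<open>\<omega>\<close> and
  \<open>conn\<close>.\<close>

lemma metric_deriv_conn:
  assumes "x \<in> U"
  shows "metric_deriv \<gamma> x u v w = \<gamma> x (conn x u v) w + \<gamma> x v (conn x u w)"
proof -
  note bil = bil_\<gamma>[OF assms]
  define a b d where "a = F x u" and "b = F x v" and "d = F x w"
  have abd: "u = E x a" "v = E x b" "w = E x d" "F x u = a" "F x v = b" "F x w = d"
    by (simp_all add: a_def b_def d_def E_F[OF assms])
  have "frechet_derivative (\<lambda>y. \<gamma> y (E y b) (E y d)) (at x) = frechet_derivative (\<lambda>y. \<beta> y b d) (at x)"
    by (rule frechet_derivative_cong_open[OF open_U assms]) (simp add: \<gamma>_E)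
  then have "\<beta> x (\<omega> x a b) d + \<beta> x b (\<omega> x a d) =
      frechet_derivative (\<lambda>y. \<gamma> y v w) (at x) u
      + \<gamma> x (frechet_derivative (\<lambda>y. E y b) (at x) u) w
      + \<gamma> x v (frechet_derivative (\<lambda>y. E y d) (at x) u)"
    using bilinear_family_apply(2)[OF open_U assms bil_\<gamma> diff_\<gamma>[OF assms] diff_E[OF assms] diff_E[OF assms], of b d u]
      metric_\<omega>[OF assms, of b d a]
    by (simp add: abd)
  then show ?thesis
    by (simp add: \<gamma>_E[OF assms, symmetric] metric_deriv_def conn_def abd(4-6) bilinear_lsub[OF bil] bilinear_rsub[OF bil])
       (simp add: abd(1-3))
qed

text \<open>A symmetric metric connection solves the Koszul identity, because the mixed terms cancel
  among the three permuted derivatives of the metric. Nondegeneracy gives the uniqueness that the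
  definite description asks for.\<close>

lemma christoffel_eq_conn:
  assumes "x \<in> U" shows "christoffel \<gamma> x u v = conn x u v"
  unfolding christoffel_def
proof (rule the_equality)
  note bil = bil_\<gamma>[OF assms] and sym = sym_\<gamma>[OF assms]
  show *: "\<forall>w. 2 * \<gamma> x (conn x u v) w =
      metric_deriv \<gamma> x u v w + metric_deriv \<gamma> x v u w - metric_deriv \<gamma> x w u v"
  proof
    fix w
    show "2 * \<gamma> x (conn x u v) w =
      metric_deriv \<gamma> x u v w + metric_deriv \<gamma> x v u w - metric_deriv \<gamma> x w u v"
      unfolding metric_deriv_conn[OF assms] conn_commute[OF assms, of v u] conn_commute[OF assms, of w]
        sym[of "conn x u w" v] by simp
  qed
  fix z
  assume z: "\<forall>w. 2 * \<gamma> x z w =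
      metric_deriv \<gamma> x u v w + metric_deriv \<gamma> x v u w - metric_deriv \<gamma> x w u v"
  have "\<gamma> x (z - conn x u v) w = 0" for w
    using *[rule_format, of w] z[rule_format, of w] by (simp add: bilinear_lsub[OF bil])
  then have "z - conn x u v = 0"
    by (rule nondeg_\<gamma>[OF assms])
  then show "z = conn x u v" by simp
qed

lemma diff_conn:
  assumes "x \<in> U" shows "(\<lambda>y. conn y v w) differentiable (at x)"
  unfolding conn_def
proof (intro differentiable_diff)
  show "(\<lambda>y. E y (\<omega> y (F y v) (F y w))) differentiable (at x)"
    by (rule linear_family_apply(1)[OF open_U assms lin_E diff_E[OF assms]
        bilinear_family_apply(1)[OF open_U assms bil_\<omega> diff_\<omega>[OF assms] diff_F[OF assms] diff_F[OF assms]]])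
  show "(\<lambda>y. frechet_derivative (\<lambda>z. E z (F y w)) (at y) v) differentiable (at x)"
    by (rule linear_family_apply(1)[of U x "\<lambda>y a. frechet_derivative (\<lambda>z. E z a) (at y) v",
          OF open_U assms lin_DE diff_DE[OF assms] diff_F[OF assms]])
qed

text \<open>Differentiation of the identity \<open>E y (F y v) = v\<close>.\<close>

lemma deriv_F:
  assumes "x \<in> U"
  shows "frechet_derivative (\<lambda>y. F y v) (at x) u = - F x (frechet_derivative (\<lambda>y. E y (F x v)) (at x) u)"
proof -
  have "frechet_derivative (\<lambda>y. E y (F y v)) (at x) = frechet_derivative (\<lambda>y. v) (at x)"
    by (rule frechet_derivative_cong_open[OF open_U assms]) (simp add: E_F)
  then have "E x (frechet_derivative (\<lambda>y. F y v) (at x) u) = - frechet_derivative (\<lambda>y. E y (F x v)) (at x) u"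
    using linear_family_apply(2)[OF open_U assms lin_E diff_E[OF assms] diff_F[OF assms], of v u]
    by (simp add: frechet_derivative_const eq_neg_iff_add_eq_0 add.commute)
  then have "F x (E x (frechet_derivative (\<lambda>y. F y v) (at x) u)) = F x (- frechet_derivative (\<lambda>y. E y (F x v)) (at x) u)"
    by (rule arg_cong)
  then show ?thesis
    by (simp add: F_E[OF assms] linear_neg[OF lin_F[OF assms]])
qed

text \<open>Both sides compute \<open>\<nabla>\<^sub>u \<nabla>\<^sub>v (E q)\<close> for constant \<open>v\<close>, so that the terms surviving the antisymmetrisation
  in \<open>u, v\<close> are the curvature on one side and its frame expression on the other.\<close>

lemma second_covariant_derivative:
  fixes a p q :: 'w
  assumes "x \<in> U"
  defines "u \<equiv> E x a" and "v \<equiv> E x p"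
  shows "frechet_derivative (\<lambda>y. conn y v (E x q)) (at x) u + conn x u (conn x v (E x q))
      + frechet_derivative (\<lambda>y. frechet_derivative (\<lambda>z. E z q) (at y) v) (at x) u
      + conn x v (frechet_derivative (\<lambda>z. E z q) (at x) u)
      + conn x u (frechet_derivative (\<lambda>z. E z q) (at x) v) =
    E x (frechet_derivative (\<lambda>y. \<omega> y p q) (at x) u
      - \<omega> x (F x (frechet_derivative (\<lambda>y. E y p) (at x) u)) q + \<omega> x a (\<omega> x p q))"
proof -
  \<comment> \<open>The direction v is frozen as a vector, so its frame components
    \<open>F y v\<close> vary with y; their derivative yields the term with
    \<omega>(F(\<partial>E)).\<close>
  define N where "N = (\<lambda>y. E y (\<omega> y (F y v) q))"
  have Fv: "F x v = p" "F x u = a"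
    by (simp_all add: assms(2,3) F_E[OF assms(1)])
  have N: "N y = frechet_derivative (\<lambda>z. E z q) (at y) v + conn y v (E y q)" if "y \<in> U" for y
    by (simp add: N_def conn_def F_E[OF that])
  have "frechet_derivative N (at x) u =
      frechet_derivative (\<lambda>y. frechet_derivative (\<lambda>z. E z q) (at y) v + conn y v (E y q)) (at x) u"
    by (simp add: frechet_derivative_cong_open[OF open_U assms(1) N])
  also have "\<dots> = frechet_derivative (\<lambda>y. frechet_derivative (\<lambda>z. E z q) (at y) v) (at x) u
      + frechet_derivative (\<lambda>y. conn y v (E y q)) (at x) u"
    by (rule frechet_derivative_add[OF diff_DE[OF assms(1)]
        linear_family_apply(1)[of U x "\<lambda>y. conn y v", OF open_U assms(1) lin_conn diff_conn[OF assms(1)] diff_E[OF assms(1)]]])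
  also have "frechet_derivative (\<lambda>y. conn y v (E y q)) (at x) u =
      frechet_derivative (\<lambda>y. conn y v (E x q)) (at x) u + conn x v (frechet_derivative (\<lambda>z. E z q) (at x) u)"
    by (rule linear_family_apply(2)[of U x "\<lambda>y. conn y v", OF open_U assms(1) lin_conn diff_conn[OF assms(1)] diff_E[OF assms(1)]])
  finally have 1: "frechet_derivative N (at x) u =
      frechet_derivative (\<lambda>y. frechet_derivative (\<lambda>z. E z q) (at y) v) (at x) u
      + (frechet_derivative (\<lambda>y. conn y v (E x q)) (at x) u + conn x v (frechet_derivative (\<lambda>z. E z q) (at x) u))" .
  note d\<omega> = linear_family_apply[OF open_U assms(1) bilinear_left[OF bil_\<omega>, of _ q]
      diff_\<omega>[OF assms(1)] diff_F[OF assms(1), of v]]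
  have 2: "frechet_derivative N (at x) u = frechet_derivative (\<lambda>y. E y (\<omega> x p q)) (at x) u
      + E x (frechet_derivative (\<lambda>y. \<omega> y p q) (at x) u
        - \<omega> x (F x (frechet_derivative (\<lambda>y. E y p) (at x) u)) q)"
  proof -
    have "frechet_derivative (\<lambda>y. \<omega> y (F y v) q) (at x) u =
        frechet_derivative (\<lambda>y. \<omega> y p q) (at x) u
        - \<omega> x (F x (frechet_derivative (\<lambda>y. E y p) (at x) u)) q"
      using d\<omega>(2)[of u] by (simp add: deriv_F[OF assms(1)] Fv bilinear_lneg[OF bil_\<omega>[OF assms(1)]])
    then show ?thesis
      using linear_family_apply(2)[OF open_U assms(1) lin_E diff_E[OF assms(1)] d\<omega>(1), of u]
      by (simp add: N_def Fv)
  qed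
  have 3: "conn x u (N x) = E x (\<omega> x a (\<omega> x p q)) - frechet_derivative (\<lambda>y. E y (\<omega> x p q)) (at x) u"
    by (simp add: conn_def N_def F_E[OF assms(1)] Fv)
  have 4: "conn x u (N x) = conn x u (frechet_derivative (\<lambda>z. E z q) (at x) v) + conn x u (conn x v (E x q))"
    by (simp add: N[OF assms(1)] linear_add[OF lin_conn[OF assms(1)]])
  have 5: "E x (\<omega> x a (\<omega> x p q)) = conn x u (frechet_derivative (\<lambda>z. E z q) (at x) v)
      + conn x u (conn x v (E x q)) + frechet_derivative (\<lambda>y. E y (\<omega> x p q)) (at x) u"
    using 3 4 by (simp add: diff_eq_eq)
  have 6: "E x (frechet_derivative (\<lambda>y. \<omega> y p q) (at x) u
      - \<omega> x (F x (frechet_derivative (\<lambda>y. E y p) (at x) u)) q) =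
      frechet_derivative (\<lambda>y. frechet_derivative (\<lambda>z. E z q) (at y) v) (at x) u
      + (frechet_derivative (\<lambda>y. conn y v (E x q)) (at x) u + conn x v (frechet_derivative (\<lambda>z. E z q) (at x) u))
      - frechet_derivative (\<lambda>y. E y (\<omega> x p q)) (at x) u"
    using 1 2 by (simp add: eq_diff_eq add.commute)
  show ?thesis
    unfolding linear_add[OF lin_E[OF assms(1)]] 5 6 by (simp add: algebra_simps)
qed

text \<open>On exchanging a and p in \<open>second_covariant_derivative\<close>, the second
  derivative of the frame field \<open>E q\<close> is symmetric, and the two terms that apply
  \<open>conn\<close> to a first derivative of it trade places; only the curvature survives the
  subtraction.\<close>

lemma curvature_frame:
  assumes "x \<in> U"
  shows "curvature \<gamma> x (E x a) (E x p) (E x q) = E x (frame_curvature x a p q)"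
proof -
  have cong: "frechet_derivative (\<lambda>y. christoffel \<gamma> y v w) (at x) = frechet_derivative (\<lambda>y. conn y v w) (at x)" for v w
    by (rule frechet_derivative_cong_open[OF open_U assms]) (rule christoffel_eq_conn)
  \<comment> \<open>The derivatives of the frame fields along each other enter antisymmetrised,
    hence only through their bracket.\<close>
  have "c a p = F x (E x (c a p))"
    by (simp add: F_E[OF assms])
  also have "\<dots> = F x (frechet_derivative (\<lambda>y. E y p) (at x) (E x a))
      - F x (frechet_derivative (\<lambda>y. E y a) (at x) (E x p))"
    unfolding bracket_E[OF assms, symmetric] by (rule linear_diff[OF lin_F[OF assms]])
  finally have c: "\<omega> x (c a p) q = \<omega> x (F x (frechet_derivative (\<lambda>y. E y p) (at x) (E x a))) q
      - \<omega> x (F x (frechet_derivative (\<lambda>y. E y a) (at x) (E x p))) q"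
    by (simp add: bilinear_lsub[OF bil_\<omega>[OF assms]])
  note lin = linear_add[OF lin_E[OF assms]] linear_diff[OF lin_E[OF assms]]
  note R = second_covariant_derivative[OF assms, of p q a] second_covariant_derivative[OF assms, of a q p]
  have "E x (frame_curvature x a p q) =
      E x (frechet_derivative (\<lambda>y. \<omega> y p q) (at x) (E x a)
        - \<omega> x (F x (frechet_derivative (\<lambda>y. E y p) (at x) (E x a))) q + \<omega> x a (\<omega> x p q))
      - E x (frechet_derivative (\<lambda>y. \<omega> y a q) (at x) (E x p)
        - \<omega> x (F x (frechet_derivative (\<lambda>y. E y a) (at x) (E x p))) q + \<omega> x p (\<omega> x a q))"
    unfolding frame_curvature_def c lin by (simp add: algebra_simps)
  then show ?thesis
    unfolding R[symmetric] curvature_def cong christoffel_eq_conn[OF assms]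
      second_derivative_commute[OF open_U assms C2_E, of q "E x p" "E x a"]
    by simp
qed

lemma lin_frame_curvature:
  assumes "x \<in> U" shows "linear (\<lambda>a. frame_curvature x a p q)"
proof -
  note l = linear_compose[OF lin_E[OF assms] linear_frechet_derivative[OF diff_\<omega>[OF assms, of p q]], unfolded o_def]
    linear_family_derivative[OF open_U assms bilinear_left[OF bil_\<omega>, of _ q] diff_\<omega>[OF assms], of "E x p"]
    bilinear_left[OF bil_\<omega>[OF assms], of "\<omega> x p q"]
    linear_compose[OF bilinear_left[OF bil_\<omega>[OF assms], of q] bilinear_right[OF bil_\<omega>[OF assms], of p], unfolded o_def]
    linear_compose[OF bilinear_left[OF bil_c, of p] bilinear_left[OF bil_\<omega>[OF assms], of q], unfolded o_def]
  show ?thesis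
    unfolding frame_curvature_def
    by (intro linear_compose_sub linear_compose_add l)
qed

text \<open>The curvature operator and its frame expression are conjugate by \<open>E\<close>, so
  they have the same trace.\<close>

lemma ricci_frame:
  assumes "x \<in> U"
  shows "ricci \<gamma> x (E x p) (E x q) = lin_trace (\<lambda>a. frame_curvature x a p q)"
proof -
  have "curvature \<gamma> x u (E x p) (E x q) = E x (frame_curvature x (F x u) p q)" for u
    using curvature_frame[OF assms, of "F x u"] by (simp add: E_F[OF assms])
  then have "ricci \<gamma> x (E x p) (E x q) = lin_trace (\<lambda>u. E x (frame_curvature x (F x u) p q))"
    by (simp add: ricci_def lin_trace_def)
  also have "\<dots> = lin_trace (\<lambda>a. frame_curvature x (F x (E x a)) p q)"
    by (rule lin_trace_commute[OF lin_E[OF assms] linear_compose[OF lin_F[OF assms] lin_frame_curvature[OF assms], unfolded o_def]])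
  finally show ?thesis
    by (simp add: F_E[OF assms])
qed

end


section \<open>Nondegenerate forms\<close>

lemmas bilinear_rules = bilinear_ladd bilinear_radd bilinear_lmul bilinear_rmul bilinear_lneg bilinear_rneg
  bilinear_lsub bilinear_rsub bilinear_lzero bilinear_rzero

definition form_dual :: "('a::euclidean_space \<Rightarrow> 'a \<Rightarrow> real) \<Rightarrow> ('a \<Rightarrow> real) \<Rightarrow> 'a" where
  "form_dual B f = (THE z. \<forall>w. B z w = f w)"

locale nondegenerate_form =
  fixes B :: "'a::euclidean_space \<Rightarrow> 'a \<Rightarrow> real"
  assumes bil_B: "bilinear B"
    and sym_B: "B v w = B w v"
    and nondeg_B: "(\<And>w. B v w = 0) \<Longrightarrow> v = 0"
begin

lemma form_eqI: assumes "\<And>w. B x w = B y w" shows "x = y"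
  using nondeg_B[of "x - y"] assms by (simp add: bilinear_lsub[OF bil_B])

text \<open>J is the Gram operator of the possibly indefinite form B with respect to the Euclidean
  inner product. It is injective by nondegeneracy, hence bijective in finite dimension.\<close>

lemma gram_isomorphism:
  obtains J J' :: "'a \<Rightarrow> 'a" where "linear J" "linear J'" "\<And>x. J (J' x) = x" "\<And>x. J' (J x) = x"
    "\<And>x w. J x \<bullet> w = B x w"
proof -
  define J where "J = (\<lambda>x. \<Sum>b\<in>Basis. B x b *\<^sub>R b)"
  have lin: "linear J"
    unfolding J_def
    by (rule linearI) (simp_all add: bilinear_rules[OF bil_B] scaleR_add_left sum.distrib scaleR_sum_right)
  have J: "J x \<bullet> w = B x w" for x w
  proof -
    have "B x w = B x (\<Sum>b\<in>Basis. (w \<bullet> b) *\<^sub>R b)"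
      by (simp add: euclidean_representation)
    also have "\<dots> = (\<Sum>b\<in>Basis. (w \<bullet> b) * B x b)"
      using bilinear_right[OF bil_B, of x] by (simp add: linear_sum linear_cmul)
    finally show ?thesis
      by (simp add: J_def inner_sum_right inner_commute[of _ w] mult.commute)
  qed
  have "inj J"
    by (rule injI) (metis J form_eqI)
  then obtain J' where "linear J'" "\<forall>x. J' (J x) = x" "\<forall>x. J (J' x) = x"
    using eucl.linear_injective_isomorphism[OF lin] by auto
  then show ?thesis
    using that lin J by blast
qed

lemma form_dualI: "(\<And>w. B z w = f w) \<Longrightarrow> form_dual B f = z"
  unfolding form_dual_def by (rule the_equality) (auto intro: form_eqI)

lemma form_dual: assumes "linear f" shows "B (form_dual B f) w = f w"
proof -
  obtain J J' :: "'a \<Rightarrow> 'a" where J: "\<And>x. J (J' x) = x" "\<And>x w. J x \<bullet> w = B x w"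
    using gram_isomorphism by metis
  have "B (J' (\<Sum>b\<in>Basis. f b *\<^sub>R b)) w = f w" for w
  proof -
    have "f w = f (\<Sum>b\<in>Basis. (w \<bullet> b) *\<^sub>R b)"
      by (simp add: euclidean_representation)
    also have "\<dots> = (\<Sum>b\<in>Basis. (w \<bullet> b) * f b)"
      by (simp add: linear_sum[OF assms] linear_cmul[OF assms])
    finally show ?thesis
      by (simp add: J(2)[symmetric] J(1) inner_sum_right inner_commute[of _ w] mult.commute)
  qed
  then show ?thesis
    using form_dualI[of "J' (\<Sum>b\<in>Basis. f b *\<^sub>R b)" f] by simp
qed

text \<open>The vectors on the right do not depend on f, so smooth dependence of f on a parameter
  passes to its dual vector.\<close>

lemma form_dual_expand:
  assumes "linear f"
  shows "form_dual B f = (\<Sum>b\<in>Basis. f b *\<^sub>R form_dual B (\<lambda>w. w \<bullet> b))"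
proof (rule form_dualI)
  fix w
  have "B (\<Sum>b\<in>Basis. f b *\<^sub>R form_dual B (\<lambda>w. w \<bullet> b)) w = (\<Sum>b\<in>Basis. f b * (w \<bullet> b))"
    by (simp add: linear_sum[OF bilinear_left[OF bil_B, of w]] linear_cmul[OF bilinear_left[OF bil_B, of w]]
        form_dual bounded_linear.linear[OF bounded_linear_inner_left])
  also have "\<dots> = f (\<Sum>b\<in>Basis. (w \<bullet> b) *\<^sub>R b)"
    by (simp add: linear_sum[OF assms] linear_cmul[OF assms] mult.commute)
  finally show "B (\<Sum>b\<in>Basis. f b *\<^sub>R form_dual B (\<lambda>w. w \<bullet> b)) w = f w"
    by (simp add: euclidean_representation)
qed

text \<open>In terms of the Gram operator, skewness says that A is conjugate to minus its adjoint;
  the trace therefore equals its own negative.\<close>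

lemma lin_trace_skew:
  assumes A: "linear A" and skew: "\<And>u v. B (A u) v = - B u (A v)"
  shows "lin_trace A = 0"
proof -
  obtain J J' :: "'a \<Rightarrow> 'a" where J: "linear J" "linear J'" "\<And>x. J (J' x) = x" "\<And>x. J' (J x) = x"
    "\<And>x w. J x \<bullet> w = B x w"
    using gram_isomorphism by metis
  have "J (A x) = - adjoint A (J x)" for x
    by (rule euclidean_eqI) (simp add: J(5) skew adjoint_clauses(2)[OF A])
  then have "lin_trace A = lin_trace (\<lambda>x. J' (- adjoint A (J x)))"
    by (metis J(4))
  also have "\<dots> = lin_trace (\<lambda>x. - adjoint A (J (J' x)))"
    by (rule lin_trace_commute[OF J(2), of "\<lambda>x. - adjoint A (J x)"])
      (intro linear_compose_neg linear_compose[OF J(1) adjoint_linear[OF A], unfolded o_def])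
  also have "\<dots> = - lin_trace A"
    by (simp add: J(3) lin_trace_uminus) (simp add: lin_trace_def adjoint_clauses(2)[OF A] inner_commute[of _ "A _"])
  finally show ?thesis by simp
qed

end


section \<open>Metrics with null centre on a Lie algebra\<close>

text \<open>The situation on \<open>\<gg>\<close>, where \<open>K\<close> is the nilpotent ideal and \<open>Z\<close> its centre.\<close>

locale null_centre_metric = nondegenerate_form B for B :: "'a::euclidean_space \<Rightarrow> 'a \<Rightarrow> real" +
  fixes br :: "'a \<Rightarrow> 'a \<Rightarrow> 'a" and Z K :: "'a set"
  assumes lie: "lie_algebra br"
    and sub_Z: "subspace Z" and sub_K: "subspace K" and Z_sub_K: "Z \<subseteq> K"
    and Z_orth_K: "z \<in> Z \<Longrightarrow> k \<in> K \<Longrightarrow> B z k = 0"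
    and mem_K: "(\<And>z. z \<in> Z \<Longrightarrow> B a z = 0) \<Longrightarrow> a \<in> K"
    and mem_Z: "(\<And>k. k \<in> K \<Longrightarrow> B a k = 0) \<Longrightarrow> a \<in> Z"
    and br_K: "k \<in> K \<Longrightarrow> br a k \<in> K"
    and br_Z: "z \<in> Z \<Longrightarrow> br a z \<in> Z"
    and br_K_K: "k \<in> K \<Longrightarrow> k' \<in> K \<Longrightarrow> br k k' \<in> Z"
    and br_K_Z: "k \<in> K \<Longrightarrow> z \<in> Z \<Longrightarrow> br k z = 0"
begin

lemma bil_br: "bilinear br"
  using lie by (simp add: lie_algebra_def)

lemma br_commute: "br b a = - br a b"
proof -
  have 0: "br x x = 0" for x
    using lie by (simp add: lie_algebra_def)
  from 0[of "a + b"] have "br a b + br b a = 0"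
    unfolding bilinear_ladd[OF bil_br] bilinear_radd[OF bil_br] by (simp add: 0 add.commute)
  then show ?thesis
    by (simp add: eq_neg_iff_add_eq_0 add.commute)
qed

lemma jacobi: "br x (br y z) + br y (br z x) + br z (br x y) = 0"
  using lie by (simp add: lie_algebra_def)

lemma br_K': "k \<in> K \<Longrightarrow> br k a \<in> K"
  using br_K[of k a] br_commute[of k a] subspace_neg[OF sub_K] by simp

lemma br_Z': "z \<in> Z \<Longrightarrow> br z a \<in> Z"
  using br_Z[of z a] br_commute[of z a] subspace_neg[OF sub_Z] by simp

lemma K_orth_Z: "k \<in> K \<Longrightarrow> z \<in> Z \<Longrightarrow> B k z = 0"
  using Z_orth_K sym_B by metis

lemma in_K: "z \<in> Z \<Longrightarrow> z \<in> K"
  using Z_sub_K by blast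

text \<open>The Levi-Civita product from the Koszul formula: inner products of left-invariant fields
  are constant, so only the bracket terms remain.\<close>

definition lc :: "'a \<Rightarrow> 'a \<Rightarrow> 'a" where
  "lc a b = form_dual B (\<lambda>c. (B (br a b) c - B (br b c) a + B (br c a) b) / 2)"

lemma linear_half: "linear f \<Longrightarrow> linear (\<lambda>x. f x / 2 :: real)"
  using linear_compose_scale_right[of f "1/2"] by simp

lemma koszul: "2 * B (lc a b) c = B (br a b) c - B (br b c) a + B (br c a) b"
proof -
  have "linear (\<lambda>c. B (br a b) c - B (br b c) a + B (br c a) b)"
    by (rule linearI) (simp_all add: bilinear_rules[OF bil_B] bilinear_rules[OF bil_br] algebra_simps)
  from form_dual[OF linear_half[OF this], of c] show ?thesis
    by (simp add: lc_def field_simps)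
qed

lemma form_eq2I: assumes "\<And>w. 2 * B x w = 2 * B y w" shows "x = y"
  by (rule form_eqI) (use assms in simp)

lemma bil_lc: "bilinear lc"
  unfolding bilinear_def
proof (intro conjI allI linearI)
  note r = bilinear_rules[OF bil_B] bilinear_rules[OF bil_br]
  show "lc a (b + b') = lc a b + lc a b'" for a b b'
    by (rule form_eq2I) (simp add: koszul r algebra_simps flip: distrib_left)
  show "lc (a + a') b = lc a b + lc a' b" for a a' b
    by (rule form_eq2I) (simp add: koszul r algebra_simps flip: distrib_left)
  show "lc a (s *\<^sub>R b) = s *\<^sub>R lc a b" for a b s
    by (rule form_eq2I) (simp add: koszul r mult.left_commute[of 2], simp add: algebra_simps)
  show "lc (s *\<^sub>R a) b = s *\<^sub>R lc a b" for a b s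
    by (rule form_eq2I) (simp add: koszul r mult.left_commute[of 2], simp add: algebra_simps)
qed

lemma lc_torsion: "lc a b - lc b a = br a b"
proof (rule form_eq2I)
  fix w
  show "2 * B (lc a b - lc b a) w = 2 * B (br a b) w"
    using koszul[of a b w] koszul[of b a w] br_commute[of b a] br_commute[of w a] br_commute[of w b]
    by (simp add: bilinear_rules[OF bil_B] algebra_simps)
qed

lemma lc_metric: "B (lc a b) c + B b (lc a c) = 0"
  using koszul[of a b c] koszul[of a c b] br_commute[of b a] br_commute[of c a] br_commute[of c b]
  by (simp add: bilinear_rules[OF bil_B] sym_B[of b "lc a c"] algebra_simps)

lemma lc_swap: "lc b a = lc a b + br b a"
  using lc_torsion[of b a] by (simp add: algebra_simps)

text \<open>In the Koszul formula [k, z] = 0, while [z, w] lies in Z and is orthogonal to k, and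
  [w, k] lies in K and is orthogonal to z.\<close>

lemma lc_K_Z: assumes "k \<in> K" "z \<in> Z" shows "lc k z = 0"
proof (rule form_eq2I)
  fix w
  show "2 * B (lc k z) w = 2 * B 0 w"
    using assms by (simp add: koszul bilinear_rules[OF bil_B] br_K_Z br_Z' br_K K_orth_Z Z_orth_K)
qed

lemma lc_Z_K: assumes "z \<in> Z" "k \<in> K" shows "lc z k = 0"
  using lc_torsion[of z k] br_commute[of z k] assms by (simp add: lc_K_Z br_K_Z)

lemma lc_Z: assumes "z \<in> Z" shows "lc a z \<in> Z"
proof (rule mem_Z)
  fix k assume k: "k \<in> K"
  have "br z k = 0"
    using br_commute[of z k] br_K_Z[OF k assms] by simp
  then show "B (lc a z) k = 0"
    using koszul[of a z k] assms k
    by (simp add: bilinear_rules[OF bil_B] br_Z Z_orth_K br_K' K_orth_Z)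
qed


text \<open>Skewness of \<open>lc a\<close> moves the product onto z, where it stays in Z and is
  thus orthogonal to k.\<close>

lemma lc_K: assumes "k \<in> K" shows "lc a k \<in> K"
proof (rule mem_K)
  fix z assume z: "z \<in> Z"
  show "B (lc a k) z = 0"
    using lc_metric[of a k z] lc_Z[OF z, of a] assms by (simp add: K_orth_Z)
qed

lemma lc_K': assumes "k \<in> K" shows "lc k a \<in> K"
  unfolding lc_swap[of k a] using assms by (intro subspace_add[OF sub_K] lc_K br_K')

text \<open>Tested against K, every Koszul term pairs a bracket of K, which lies in Z, with an
  element of K.\<close>

lemma lc_K_K: assumes "k \<in> K" "k' \<in> K" shows "lc k k' \<in> Z"
proof (rule mem_Z)
  fix k'' assume "k'' \<in> K"
  with assms show "B (lc k k') k'' = 0"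
    using koszul[of k k' k''] by (simp add: br_K_K Z_orth_K)
qed

section \<open>Curvature of the Levi-Civita product\<close>

definition Rm :: "'a \<Rightarrow> 'a \<Rightarrow> 'a \<Rightarrow> 'a" where
  "Rm u v w = lc u (lc v w) - lc v (lc u w) - lc (br u v) w"

definition Ric :: "'a \<Rightarrow> 'a \<Rightarrow> real" where
  "Ric v w = lin_trace (\<lambda>u. Rm u v w)"

lemmas lin_rules = bilinear_rules[OF bil_lc] bilinear_rules[OF bil_br]

lemma lin_Rm: "linear (\<lambda>u. Rm u v w)" "linear (\<lambda>v. Rm u v w)" "linear (\<lambda>w. Rm u v w)"
  by (rule linearI; simp add: Rm_def lin_rules algebra_simps)+

lemma bil_Ric: "bilinear Ric"
  unfolding bilinear_def
proof (intro conjI allI linearI)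
  show "Ric a (b + b') = Ric a b + Ric a b'" for a b b'
    by (simp add: Ric_def linear_add[OF lin_Rm(3)] lin_trace_add)
  show "Ric (a + a') b = Ric a b + Ric a' b" for a a' b
    by (simp add: Ric_def linear_add[OF lin_Rm(2)] lin_trace_add)
  show "Ric a (s *\<^sub>R b) = s *\<^sub>R Ric a b" for a b s
    by (simp add: Ric_def linear_cmul[OF lin_Rm(3)] lin_trace_scaleR)
  show "Ric (s *\<^sub>R a) b = s *\<^sub>R Ric a b" for a b s
    by (simp add: Ric_def linear_cmul[OF lin_Rm(2)] lin_trace_scaleR)
qed

lemma lc_skew: "B (lc a b) c = - B b (lc a c)"
  using lc_metric[of a b c] by simp

lemma Rm_skew: "B (Rm u v w) x = - B w (Rm u v x)"
  by (simp add: Rm_def bilinear_rules[OF bil_B] lc_skew)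

text \<open>Vanishing torsion turns the cyclic sum into iterated brackets, and the Jacobi identity
  finishes.\<close>

lemma bianchi: "Rm u v w + Rm v w u + Rm w u v = 0"
proof -
  have "Rm u v w + Rm v w u + Rm w u v =
      lc u (lc v w - lc w v) - lc (br v w) u + (lc v (lc w u - lc u w) - lc (br w u) v)
      + (lc w (lc u v - lc v u) - lc (br u v) w)"
    by (simp add: Rm_def lin_rules)
  also have "\<dots> = br u (br v w) + br v (br w u) + br w (br u v)"
    by (simp add: lc_torsion)
  finally show ?thesis
    by (simp add: jacobi)
qed

text \<open>By the Bianchi identity the antisymmetric part of \<open>Ric\<close> is, up to sign, the
  trace of \<open>Rm v w\<close>, which is skew for B.\<close>

lemma Ric_commute: "Ric v w = Ric w v"
proof -
  have anti: "Rm u w v = - Rm w u v" for u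
    by (simp add: Rm_def br_commute[of u w] lin_rules)
  then have "Rm u v w - Rm u w v = - Rm v w u" for u
    using bianchi[of u v w] unfolding anti[of u] by (simp add: algebra_simps eq_neg_iff_add_eq_0)
  then have "Ric v w - Ric w v = - lin_trace (\<lambda>u. Rm v w u)"
    by (simp add: Ric_def flip: lin_trace_diff lin_trace_uminus)
  also have "lin_trace (\<lambda>u. Rm v w u) = 0"
    by (rule lin_trace_skew[OF lin_Rm(3) Rm_skew])
  finally show ?thesis by simp
qed

text \<open>Since k lies in K, all products ending in k stay in K. For u in K each term of
  \<open>Rm u v k\<close> contains a product of two elements of K and so lies in Z; for u in Z each
  contains a product of Z with K, which is 0.\<close>

lemma Ric_K: assumes "k \<in> K" shows "Ric v k = 0"
  unfolding Ric_def
proof (rule lin_trace_filtration[OF lin_Rm(1) sub_K sub_Z])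
  show "Rm u v k \<in> K" for u
    unfolding Rm_def by (intro subspace_diff sub_K lc_K assms)
  show "Rm u v k \<in> Z" if "u \<in> K" for u
    unfolding Rm_def
    by (intro subspace_diff sub_Z lc_K_K lc_Z lc_K that assms br_K')
  show "Rm u v k = 0" if "u \<in> Z" for u
    unfolding Rm_def
    by (simp add: lc_Z_K that assms lc_K br_Z' bilinear_rules[OF bil_lc])
qed (rule Z_sub_K)


lemma lin_trace_K_to_Z:
  assumes "linear T" "\<And>v. T v \<in> Z" "\<And>v. v \<in> K \<Longrightarrow> T v = 0"
  shows "lin_trace T = 0"
  by (rule lin_trace_nilpotent[OF assms(1) sub_K]) (use assms Z_sub_K in auto)

end


text \<open>H remains a general symmetric form annihilating K, so that the ambient Ricci tensor
  becomes an explicit expression in H; the choice of H is then read off from it.\<close>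

locale null_centre_perturbation = null_centre_metric +
  fixes H :: "'a \<Rightarrow> 'a \<Rightarrow> real"
  assumes bil_H: "bilinear H" and sym_H: "H v w = H w v" and H_K: "k \<in> K \<Longrightarrow> H v k = 0"
begin

lemma H_K': "k \<in> K \<Longrightarrow> H k v = 0"
  using H_K sym_H by metis

definition H_op :: "'a \<Rightarrow> 'a" where
  "H_op v = form_dual B (H v)"

text \<open>The Levi-Civita product of \<open>B + \<rho> H\<close> is \<open>lc + \<rho> S\<close> for every \<open>\<rho>\<close>: the correction is linear in \<open>\<rho>\<close>
  because it takes values in \<open>Z\<close>, on which \<open>H\<close> vanishes.\<close>

definition S :: "'a \<Rightarrow> 'a \<Rightarrow> 'a" where
  "S a b = form_dual B (\<lambda>c. (H (br a b) c - H (br b c) a + H (br c a) b) / 2 - H (lc a b) c)"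

lemma B_H_op: "B (H_op v) w = H v w"
  unfolding H_op_def by (rule form_dual) (rule bilinear_right[OF bil_H])

lemma B_H_op': "B w (H_op v) = H w v"
  by (simp add: sym_B[of w] B_H_op sym_H[of w])

text \<open>This is the coefficient of \<rho> in the Koszul formula for B + \<rho> H, where the term
  \<open>H (S a b) c\<close> has dropped out.\<close>

lemma B_S: "B (S a b) c = (H (br a b) c - H (br b c) a + H (br c a) b) / 2 - H (lc a b) c"
  unfolding S_def
  by (rule form_dual, rule linearI)
    (simp_all add: bilinear_rules[OF bil_H] lin_rules algebra_simps add_divide_distrib diff_divide_distrib)

lemma lin_H_op: "linear H_op"
  by (rule linearI; rule form_eqI) (simp_all add: B_H_op bilinear_rules[OF bil_B] bilinear_rules[OF bil_H])

lemma bil_S: "bilinear S"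
  unfolding bilinear_def
  by (intro conjI allI linearI; rule form_eqI)
    (simp_all add: B_S bilinear_rules[OF bil_B] bilinear_rules[OF bil_H] lin_rules field_simps)

lemma H_op_Z: "H_op v \<in> Z"
  by (rule mem_Z) (simp add: B_H_op H_K)

lemma H_op_K: "k \<in> K \<Longrightarrow> H_op k = 0"
  by (rule form_eqI) (simp add: B_H_op H_K' bilinear_rules[OF bil_B])

lemma S_Z: "S a b \<in> Z"
  by (rule mem_Z) (simp add: B_S H_K H_K' br_K br_K')

lemma S_K: "k \<in> K \<Longrightarrow> S a k = 0"
  by (rule form_eqI) (simp add: B_S H_K H_K' br_K br_K' lc_K bilinear_rules[OF bil_B])

lemma S_commute: "S a b = S b a"
proof (rule form_eqI)
  fix w
  have "H (lc a b) w - H (lc b a) w = H (br a b) w"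
    by (simp add: lc_torsion[symmetric] bilinear_rules[OF bil_H])
  then show "B (S a b) w = B (S b a) w"
    by (simp add: B_S br_commute[of a b] br_commute[of w a] br_commute[of w b] bilinear_rules[OF bil_H] field_simps)
qed

lemma S_K': "k \<in> K \<Longrightarrow> S k a = 0"
  using S_K S_commute by metis

text \<open>The first-order part in \<rho> of the compatibility of \<open>lc + \<rho> S\<close> with
  B + \<rho> H; the second-order part vanishes since H annihilates the values of
  \<open>S\<close>.\<close>

lemma S_metric: "B (S a b) c + B b (S a c) = - H (lc a b) c - H b (lc a c)"
  by (simp add: sym_B[of b "S a c"] sym_H[of b "lc a c"] B_S br_commute[of b a] br_commute[of c a] br_commute[of c b]
      bilinear_rules[OF bil_H] field_simps)

section \<open>The ambient connection and its Ricci trace\<close>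

definition amb_br :: "real \<times> 'a \<times> real \<Rightarrow> real \<times> 'a \<times> real \<Rightarrow> real \<times> 'a \<times> real" where
  "amb_br p q = (0, br (fst (snd p)) (fst (snd q)), 0)"

definition amb_form :: "real \<Rightarrow> real \<Rightarrow> real \<times> 'a \<times> real \<Rightarrow> real \<times> 'a \<times> real \<Rightarrow> real" where
  "amb_form t \<rho> = (\<lambda>(a, v, b) (a', v', b').
     2 * \<rho> * a * a' + t * (a * b' + b * a') + t\<^sup>2 * (B v v' + \<rho> * H v v'))"

text \<open>The Levi-Civita connection of the ambient metric in the frame \<open>\<partial>\<^sub>t\<close>, left-invariant fields, \<open>\<partial>\<^sub>\<rho>\<close>,
  obtained from the Koszul formula.\<close>

definition amb_conn :: "real \<Rightarrow> real \<Rightarrow> real \<times> 'a \<times> real \<Rightarrow> real \<times> 'a \<times> real \<Rightarrow> real \<times> 'a \<times> real" where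
  "amb_conn t \<rho> = (\<lambda>(a, v, b) (a', v', b').
     (- (t / 2) * H v v',
      inverse t *\<^sub>R (a *\<^sub>R v' + a' *\<^sub>R v) + (1/2) *\<^sub>R (b *\<^sub>R H_op v' + b' *\<^sub>R H_op v) + lc v v' + \<rho> *\<^sub>R S v v',
      inverse t * (a * b' + a' * b) - B v v'))"

definition amb_conn_deriv ::
  "real \<Rightarrow> real \<Rightarrow> real \<Rightarrow> real \<times> 'a \<times> real \<Rightarrow> real \<times> 'a \<times> real \<Rightarrow> real \<times> 'a \<times> real" where
  "amb_conn_deriv t a0 b0 = (\<lambda>(a, v, b) (a', v', b').
     (- (a0 / 2) * H v v',
      (- a0 * (inverse t)\<^sup>2) *\<^sub>R (a *\<^sub>R v' + a' *\<^sub>R v) + b0 *\<^sub>R S v v',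
      (- a0 * (inverse t)\<^sup>2) * (a * b' + a' * b)))"

lemmas amb_rules = lin_rules bilinear_rules[OF bil_B] bilinear_rules[OF bil_H] bilinear_rules[OF bil_S]
  linear_add[OF lin_H_op] linear_cmul[OF lin_H_op] linear_0[OF lin_H_op]

lemma bil_amb_br: "bilinear amb_br"
  unfolding bilinear_def by (intro conjI allI linearI) (simp_all add: amb_br_def amb_rules)

lemma bil_amb_conn: "bilinear (amb_conn t \<rho>)"
  unfolding bilinear_def
  by (intro conjI allI linearI) (auto simp: amb_conn_def amb_rules algebra_simps add_divide_distrib scaleR_add_left)

lemma amb_conn_torsion: "amb_conn t \<rho> p q - amb_conn t \<rho> q p = amb_br p q"
  by (cases p rule: prod_cases3, cases q rule: prod_cases3)
    (simp add: amb_conn_def amb_br_def sym_H sym_B S_commute lc_torsion[symmetric] algebra_simps)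

text \<open>The right-hand side is the derivative of \<open>amb_form\<close> along the frame vector
  \<open>(a0, v0, b0)\<close>, so this is metric compatibility. The component v0 contributes no
  derivative because the form depends on t and \<rho> only.\<close>

lemma amb_conn_metric:
  assumes "t \<noteq> 0"
  shows "amb_form t \<rho> (amb_conn t \<rho> (a0, v0, b0) (a, v, b)) (a', v', b')
      + amb_form t \<rho> (a, v, b) (amb_conn t \<rho> (a0, v0, b0) (a', v', b')) =
    2 * b0 * a * a' + a0 * (a * b' + b * a') + 2 * t * a0 * (B v v' + \<rho> * H v v') + t\<^sup>2 * (b0 * H v v')"
proof -
  \<comment> \<open>All terms quadratic in H disappear, since \<open>H_op\<close> and
    \<open>S\<close> take values in Z, where H vanishes.\<close>
  have Z: "H (H_op x) y = 0" "H y (H_op x) = 0" "H (S x x') y = 0" "H y (S x x') = 0" for x x' y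
    by (simp_all add: H_K H_K' in_K[OF H_op_Z] in_K[OF S_Z])
  have 1: "B v (lc v0 v') = - B (lc v0 v) v'"
    using lc_metric[of v0 v v'] by simp
  have 2: "B v (S v0 v') = - H (lc v0 v) v' - H v (lc v0 v') - B (S v0 v) v'"
    using S_metric[of v0 v v'] by simp
  show ?thesis
    using assms
    by (simp add: amb_form_def amb_conn_def amb_rules B_H_op B_H_op' Z 1 2
        sym_B[of v v0] sym_H[of v v0] power2_eq_square field_simps)
qed

text \<open>Most terms of the ambient Ricci tensor are traces of maps that annihilate \<open>K\<close> and have image in \<open>Z\<close>.\<close>

lemma amb_ricci:
  assumes "t \<noteq> 0"
  shows "lin_trace (\<lambda>u. amb_conn_deriv t (fst u) (snd (snd u)) (a2, v2, b2) (a3, v3, b3)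
      - amb_conn_deriv t a2 b2 u (a3, v3, b3)
      + amb_conn t \<rho> u (amb_conn t \<rho> (a2, v2, b2) (a3, v3, b3))
      - amb_conn t \<rho> (a2, v2, b2) (amb_conn t \<rho> u (a3, v3, b3))
      - amb_conn t \<rho> (amb_br u (a2, v2, b2)) (a3, v3, b3)) =
    Ric v2 v3 - (real DIM('a) - 2) / 2 * H v2 v3" (is "lin_trace ?T = _")
proof -
  define \<tau> where "\<tau> = inverse t"
  have \<tau>: "t * \<tau> = 1" "\<tau> * t = 1" "inverse t = \<tau>" "t * (\<tau> * x) = x" "\<tau> * (t * x) = x" for x
    using assms by (simp_all add: \<tau>_def)
  define Q where "Q = \<tau> *\<^sub>R (a2 *\<^sub>R v3 + a3 *\<^sub>R v2) + (1/2) *\<^sub>R (b2 *\<^sub>R H_op v3 + b3 *\<^sub>R H_op v2) + lc v2 v3 + \<rho> *\<^sub>R S v2 v3"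
  define R where "R = \<tau> * (a2 * b3 + a3 * b2) - B v2 v3"
  define q where "q = (\<lambda>v. \<tau> *\<^sub>R (a3 *\<^sub>R v) + (1/2) *\<^sub>R (b3 *\<^sub>R H_op v) + lc v v3 + \<rho> *\<^sub>R S v v3)"
  define M where "M = (\<lambda>v. (\<tau> * a2 * \<tau> * a3) *\<^sub>R v - b2 *\<^sub>R S v v3 - (H v2 v3 / 2) *\<^sub>R v + (R / 2) *\<^sub>R H_op v
      + lc v Q + \<rho> *\<^sub>R S v Q
      - (\<tau> * a2) *\<^sub>R q v + (1/2) *\<^sub>R (H v v3 *\<^sub>R v2) - (b2 / 2) *\<^sub>R H_op (q v) + (1/2) *\<^sub>R (B v v3 *\<^sub>R H_op v2)
      - lc v2 (q v) - \<rho> *\<^sub>R S v2 (q v)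
      - (\<tau> * a3) *\<^sub>R br v v2 - (b3 / 2) *\<^sub>R H_op (br v v2) - lc (br v v2) v3 - \<rho> *\<^sub>R S (br v v2) v3)"
  have lin_q: "linear q"
    unfolding q_def by (rule linearI) (simp_all add: amb_rules algebra_simps)
  have pq: "amb_conn t \<rho> (a2, v2, b2) (a3, v3, b3) = (- (t / 2) * H v2 v3, Q, R)"
    by (simp add: amb_conn_def Q_def R_def \<tau>(3))
  have uq: "amb_conn t \<rho> (0, v, 0) (a3, v3, b3) = (- (t / 2) * H v v3, q v, - B v v3)" for v
    by (simp add: amb_conn_def q_def \<tau>(3) amb_rules)
  have T: "fst (snd (?T (0, v, 0))) = M v" for v
    unfolding pq uq
    by (simp add: M_def amb_conn_def amb_conn_deriv_def amb_br_def \<tau>(3) amb_rules power2_eq_square)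
      (simp add: algebra_simps \<tau>)
  have T1: "fst (?T (1, 0, 0)) = 0"
    unfolding pq
    by (simp add: amb_conn_def amb_conn_deriv_def amb_br_def \<tau>(3) amb_rules)
      (simp add: algebra_simps \<tau>)
  have T3: "snd (snd (?T (0, 0, 1))) = 0"
    unfolding pq
    by (simp add: amb_conn_def amb_conn_deriv_def amb_br_def \<tau>(3) amb_rules power2_eq_square B_H_op')
      (simp add: algebra_simps \<tau>)
  \<comment> \<open>The terms of \<open>M\<close> that involve \<open>S\<close> or
    \<open>H_op\<close>, apart from the rank-one map through \<open>H_op v2\<close>: each
    annihilates K and takes values in Z.\<close>
  define N where "N = (\<lambda>v. - b2 *\<^sub>R S v v3 + (R / 2) *\<^sub>R H_op v
      + (b2 / 2) *\<^sub>R lc v (H_op v3) + (b3 / 2) *\<^sub>R lc v (H_op v2) + \<rho> *\<^sub>R lc v (S v2 v3) + \<rho> *\<^sub>R S v Q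
      - (\<tau> * a2) *\<^sub>R ((b3 / 2) *\<^sub>R H_op v + \<rho> *\<^sub>R S v v3) - (b2 / 2) *\<^sub>R H_op (q v)
      - (b3 / 2) *\<^sub>R lc v2 (H_op v) - \<rho> *\<^sub>R lc v2 (S v v3) - \<rho> *\<^sub>R S v2 (q v)
      - (b3 / 2) *\<^sub>R H_op (br v v2) - \<rho> *\<^sub>R S (br v v2) v3)"
  \<comment> \<open>The multiple of the identity comes from the t-component -(t/2) H v2 v3 of the
    inner covariant derivative, multiplied by 1/t. The rank-one maps come likewise from the t- and
    \<rho>-components of the other inner derivative. The bracketed term is zero because
    \<open>lc\<close> has torsion \<open>br\<close>.\<close>
  have M: "M v = (- (H v2 v3 / 2)) *\<^sub>R v + Rm v v2 v3 + (\<tau> * a3) *\<^sub>R (lc v v2 - br v v2 - lc v2 v)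
      + (1/2) *\<^sub>R (H v v3 *\<^sub>R v2) + (1/2) *\<^sub>R (B v v3 *\<^sub>R H_op v2) + N v" for v
    unfolding M_def N_def Rm_def Q_def q_def by (simp add: amb_rules algebra_simps)
  have q_K: "q v \<in> K" if "v \<in> K" for v
    unfolding q_def using that
    by (intro subspace_add[OF sub_K] subspace_scale[OF sub_K] lc_K' in_K[OF H_op_Z] in_K[OF S_Z])
  have lin_N: "linear N"
    unfolding N_def
    by (rule linearI) (simp_all add: amb_rules linear_add[OF lin_q] linear_cmul[OF lin_q] algebra_simps)
  have "lin_trace N = 0"
  proof (rule lin_trace_K_to_Z[OF lin_N])
    show "N v \<in> Z" for v
      unfolding N_def
      by (intro subspace_add[OF sub_Z] subspace_diff[OF sub_Z] subspace_scale[OF sub_Z] lc_Z H_op_Z S_Z)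
    show "N v = 0" if "v \<in> K" for v
      unfolding N_def using that
      by (simp add: S_K S_K' H_op_K lc_K_Z H_op_Z S_Z q_K br_K' amb_rules)
  qed
  moreover have "lc v v2 - br v v2 - lc v2 v = 0" for v
    by (simp add: lc_torsion[symmetric])
  \<comment> \<open>The identity has trace n; the rank-one maps have traces H v2 v3 / 2 and B (H_op
    v2) v3 / 2, which are equal and together give the last summand.\<close>
  ultimately have "lin_trace M = Ric v2 v3 - (real DIM('a) / 2) * H v2 v3 + H v2 v3"
    unfolding M lin_trace_add lin_trace_scaleR
    by (simp add: lin_trace_scaleR lin_trace_add lin_trace_id Ric_def lin_trace_def[of "\<lambda>v. 0"]
        lin_trace_rank_one[OF bilinear_left[OF bil_H]] lin_trace_rank_one[OF bilinear_left[OF bil_B]] B_H_op)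
  then show ?thesis
    unfolding lin_trace_triple[of ?T] T T1 T3 by (simp add: field_simps)
qed

end


section \<open>Left-invariant fields and metrics on a Lie group\<close>

context
  fixes M :: "('i, 'p, 'e::euclidean_space) manifold"
  assumes M: "smooth_manifold M"
begin

lemma chart_dom_openin: "i \<in> chart_index M \<Longrightarrow> openin (mf_top M) (chart_dom M i)"
  and chart_image_open: "i \<in> chart_index M \<Longrightarrow> open (chart_image M i)"
  using M by (auto simp: smooth_manifold_def)

lemma chart_dom_subset: "i \<in> chart_index M \<Longrightarrow> chart_dom M i \<subseteq> topspace (mf_top M)"
  using chart_dom_openin openin_subset by blast

lemma chart_homeomorphic:
  "i \<in> chart_index M \<Longrightarrow>
    homeomorphic_map (subtopology (mf_top M) (chart_dom M i)) (top_of_set (chart_image M i)) (chart_map M i)"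
  using M by (auto simp: smooth_manifold_def)

lemma chart_inj:
  assumes "i \<in> chart_index M" shows "inj_on (chart_map M i) (chart_dom M i)"
  using homeomorphic_imp_injective_map[OF chart_homeomorphic[OF assms]] chart_dom_subset[OF assms]
  by (simp add: Int_absorb1)

lemma chart_inv:
  "i \<in> chart_index M \<Longrightarrow> p \<in> chart_dom M i \<Longrightarrow> inv_into (chart_dom M i) (chart_map M i) (chart_map M i p) = p"
  using chart_inj by (rule inv_into_f_f)

lemma local_rep_chart:
  "i \<in> chart_index M \<Longrightarrow> p \<in> chart_dom M i \<Longrightarrow> local_rep M N f i j (chart_map M i p) = chart_map N j (f p)"
  by (simp add: local_rep_def chart_inv)

text \<open>A chart is a homeomorphism onto an open set, so openness in the manifold becomes
  openness in the vector space, where derivatives depend only on values in the domain.\<close>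

lemma local_dom_open:
  assumes "continuous_map (mf_top M) (mf_top M) f" "i \<in> chart_index M" "j \<in> chart_index M"
  shows "open (local_dom M M f i j)"
proof -
  have "openin (mf_top M) {p \<in> chart_dom M i. f p \<in> chart_dom M j}"
    by (rule openin_continuous_map_preimage_gen[OF assms(1) chart_dom_openin[OF assms(2)] chart_dom_openin[OF assms(3)]])
  then have "openin (subtopology (mf_top M) (chart_dom M i)) {p \<in> chart_dom M i. f p \<in> chart_dom M j}"
    by (auto simp: openin_subtopology)
  then have "openin (top_of_set (chart_image M i)) (local_dom M M f i j)"
    using homeomorphic_map_openness_eq[OF chart_homeomorphic[OF assms(2)]] by (auto simp: local_dom_def)
  then show ?thesis
    using openin_open_eq[OF chart_image_open[OF assms(2)]] by blast
qed

end


section \<open>Left translations and left-invariant fields in charts\<close>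

locale lie_group_manifold =
  fixes G :: "'p monoid" and M :: "('i, 'p, 'e::euclidean_space) manifold"
  assumes lie_group: "lie_group G M"
begin

sublocale group G
  using lie_group by (simp add: lie_group_def)

lemma smooth_M: "smooth_manifold M"
  and carrier_eq: "carrier G = topspace (mf_top M)"
  and smooth_mult: "smooth_map (prod_manifold M M) M (\<lambda>(a, b). a \<otimes>\<^bsub>G\<^esub> b)"
  using lie_group by (simp_all add: lie_group_def)

lemma dom_carrier: "i \<in> chart_index M \<Longrightarrow> p \<in> chart_dom M i \<Longrightarrow> p \<in> carrier G"
  using chart_dom_subset[OF smooth_M] carrier_eq by blast

lemma ex_chart: "p \<in> carrier G \<Longrightarrow> \<exists>i. i \<in> chart_index M \<and> p \<in> chart_dom M i"
  using smooth_M unfolding carrier_eq smooth_manifold_def by auto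

abbreviation L :: "'p \<Rightarrow> 'p \<Rightarrow> 'p" where "L a \<equiv> (\<lambda>p. a \<otimes>\<^bsub>G\<^esub> p)"

lemma continuous_L: assumes "a \<in> carrier G" shows "continuous_map (mf_top M) (mf_top M) (L a)"
proof -
  have "continuous_map (prod_topology (mf_top M) (mf_top M)) (mf_top M) (\<lambda>(a, b). a \<otimes>\<^bsub>G\<^esub> b)"
    using smooth_mult by (simp add: smooth_map_def prod_manifold_def)
  moreover have "continuous_map (mf_top M) (prod_topology (mf_top M) (mf_top M)) (\<lambda>p. (a, p))"
    using assms by (intro continuous_map_pairedI) (auto simp: carrier_eq)
  ultimately have "continuous_map (mf_top M) (mf_top M) ((\<lambda>(a, b). a \<otimes>\<^bsub>G\<^esub> b) \<circ> (\<lambda>p. (a, p)))"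
    using continuous_map_compose by blast
  then show ?thesis by (simp add: o_def)
qed

definition mult_rep :: "'i \<Rightarrow> 'i \<Rightarrow> 'i \<Rightarrow> 'e \<times> 'e \<Rightarrow> 'e" where
  "mult_rep i j k = local_rep (prod_manifold M M) M (\<lambda>(a, b). a \<otimes>\<^bsub>G\<^esub> b) (i, j) k"

lemma smooth_mult_rep:
  assumes "i \<in> chart_index M" "j \<in> chart_index M" "k \<in> chart_index M"
  shows "smooth_on (mult_rep i j k)
    ((\<lambda>(a, b). (chart_map M i a, chart_map M j b)) ` {(a, b) \<in> chart_dom M i \<times> chart_dom M j. a \<otimes>\<^bsub>G\<^esub> b \<in> chart_dom M k})"
proof -
  have "local_dom (prod_manifold M M) M (\<lambda>(a, b). a \<otimes>\<^bsub>G\<^esub> b) (i, j) k =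
    (\<lambda>(a, b). (chart_map M i a, chart_map M j b)) ` {(a, b) \<in> chart_dom M i \<times> chart_dom M j. a \<otimes>\<^bsub>G\<^esub> b \<in> chart_dom M k}"
    by (auto simp: local_dom_def prod_manifold_def)
  then show ?thesis
    using smooth_mult assms unfolding smooth_map_def mult_rep_def
    by (metis (no_types, lifting) SigmaI manifold.select_convs(2) prod_manifold_def)
qed

lemma mult_rep_chart:
  assumes "i \<in> chart_index M" "j \<in> chart_index M" "a \<in> chart_dom M i" "b \<in> chart_dom M j"
  shows "mult_rep i j k (chart_map M i a, chart_map M j b) = chart_map M k (a \<otimes>\<^bsub>G\<^esub> b)"
proof -
  have "inj_on (\<lambda>(a, b). (chart_map M i a, chart_map M j b)) (chart_dom M i \<times> chart_dom M j)"
    using chart_inj[OF smooth_M assms(1)] chart_inj[OF smooth_M assms(2)] by (auto simp: inj_on_def)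
  from inv_into_f_f[OF this, of "(a, b)"] show ?thesis
    using assms by (simp add: mult_rep_def local_rep_def prod_manifold_def)
qed

lemma mult_rep_differentiable:
  assumes "i \<in> chart_index M" "j \<in> chart_index M" "k \<in> chart_index M"
    "a \<in> chart_dom M i" "b \<in> chart_dom M j" "a \<otimes>\<^bsub>G\<^esub> b \<in> chart_dom M k"
  shows "mult_rep i j k differentiable (at (chart_map M i a, chart_map M j b))"
  by (rule smooth_on_differentiable[OF smooth_mult_rep[OF assms(1-3)]]) (use assms in force)

text \<open>In charts, left translation by a is multiplication with its first coordinate frozen.
  Writing its derivative as a partial derivative of \<open>mult_rep\<close> makes the smooth
  dependence on a accessible.\<close>

lemma translation_derivative:
  assumes "i \<in> chart_index M" "j \<in> chart_index M" "k \<in> chart_index M"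
    "a \<in> chart_dom M i" "b \<in> chart_dom M j" "a \<otimes>\<^bsub>G\<^esub> b \<in> chart_dom M k"
  shows "local_rep M M (L a) j k differentiable (at (chart_map M j b))"
    and "frechet_derivative (local_rep M M (L a) j k) (at (chart_map M j b)) v =
      frechet_derivative (mult_rep i j k) (at (chart_map M i a, chart_map M j b)) (0, v)"
proof -
  have a: "a \<in> carrier G"
    using assms(1,4) by (rule dom_carrier)
  have mem: "chart_map M j b \<in> local_dom M M (L a) j k"
    using assms by (auto simp: local_dom_def)
  have eq: "mult_rep i j k ((0, y) + (chart_map M i a, 0)) = local_rep M M (L a) j k y"
    if "y \<in> local_dom M M (L a) j k" for y
    using that assms by (auto simp: local_dom_def mult_rep_chart local_rep_chart[OF smooth_M])
  note op = local_dom_open[OF smooth_M continuous_L[OF a] assms(2,3)]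
  have bl: "bounded_linear (\<lambda>y::'e. (0::'e, y))"
    by (rule bounded_linear_Pair[OF bounded_linear_zero bounded_linear_ident])
  have "mult_rep i j k differentiable (at ((0, chart_map M j b) + (chart_map M i a, 0)))"
    using mult_rep_differentiable[OF assms] by simp
  note d = frechet_derivative_affine[OF bl this]
  show "local_rep M M (L a) j k differentiable (at (chart_map M j b))"
    by (rule differentiable_cong_open[OF d(1) op mem eq])
  show "frechet_derivative (local_rep M M (L a) j k) (at (chart_map M j b)) v =
      frechet_derivative (mult_rep i j k) (at (chart_map M i a, chart_map M j b)) (0, v)"
    using d(2)[of v] frechet_derivative_cong_open[OF op mem eq] by simp
qed

lemma translation_differentiable:
  assumes "j \<in> chart_index M" "k \<in> chart_index M"
    "a \<in> carrier G" "b \<in> chart_dom M j" "a \<otimes>\<^bsub>G\<^esub> b \<in> chart_dom M k"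
  shows "local_rep M M (L a) j k differentiable (at (chart_map M j b))"
  using ex_chart[OF assms(3)] translation_derivative(1) assms by blast

lemma translation_chain:
  assumes ind: "i \<in> chart_index M" "j \<in> chart_index M" "k \<in> chart_index M"
    and "a \<in> carrier G" "b \<in> carrier G"
    and p: "p \<in> chart_dom M i" "b \<otimes>\<^bsub>G\<^esub> p \<in> chart_dom M j" "a \<otimes>\<^bsub>G\<^esub> (b \<otimes>\<^bsub>G\<^esub> p) \<in> chart_dom M k"
  shows "frechet_derivative (local_rep M M (L (a \<otimes>\<^bsub>G\<^esub> b)) i k) (at (chart_map M i p)) v =
    frechet_derivative (local_rep M M (L a) j k) (at (chart_map M j (b \<otimes>\<^bsub>G\<^esub> p)))
      (frechet_derivative (local_rep M M (L b) i j) (at (chart_map M i p)) v)"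
proof -
  note op = local_dom_open[OF smooth_M continuous_L[OF assms(5)] ind(1,2)]
  have mem: "chart_map M i p \<in> local_dom M M (L b) i j"
    using p by (auto simp: local_dom_def)
  have eq: "(local_rep M M (L a) j k \<circ> local_rep M M (L b) i j) y = local_rep M M (L (a \<otimes>\<^bsub>G\<^esub> b)) i k y"
    if "y \<in> local_dom M M (L b) i j" for y
    using that ind assms(4,5) by (auto simp: local_dom_def local_rep_chart[OF smooth_M] m_assoc dom_carrier)
  have "frechet_derivative (local_rep M M (L (a \<otimes>\<^bsub>G\<^esub> b)) i k) (at (chart_map M i p)) =
      frechet_derivative (local_rep M M (L a) j k \<circ> local_rep M M (L b) i j) (at (chart_map M i p))"
    by (rule frechet_derivative_cong_open[OF op mem]) (rule eq[symmetric])
  also have "\<dots> = frechet_derivative (local_rep M M (L a) j k) (at (chart_map M j (b \<otimes>\<^bsub>G\<^esub> p))) \<circ>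
      frechet_derivative (local_rep M M (L b) i j) (at (chart_map M i p))"
    using translation_differentiable[OF ind(1,2) assms(5) p(1,2)]
      translation_differentiable[OF ind(2,3) assms(4) p(2,3)]
    by (subst frechet_derivative_compose) (simp_all add: local_rep_chart[OF smooth_M ind(1) p(1)])
  finally show ?thesis by simp
qed

text \<open>The identity and translation by the unit agree on the carrier, so the transformation law
  of a field under changes of charts is an instance of left-invariance.\<close>

lemma translation_one:
  assumes "i \<in> chart_index M" "j \<in> chart_index M"
  shows "local_dom M M id i j = local_dom M M (L \<one>\<^bsub>G\<^esub>) i j"
    and "x \<in> local_dom M M id i j \<Longrightarrow> local_rep M M id i j x = local_rep M M (L \<one>\<^bsub>G\<^esub>) i j x"
    and "x \<in> local_dom M M id i j \<Longrightarrow>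
      frechet_derivative (local_rep M M id i j) (at x) = frechet_derivative (local_rep M M (L \<one>\<^bsub>G\<^esub>) i j) (at x)"
proof -
  show dom: "local_dom M M id i j = local_dom M M (L \<one>\<^bsub>G\<^esub>) i j"
    unfolding local_dom_def using dom_carrier[OF assms(1)] by (intro image_cong) auto
  have eq: "local_rep M M id i j x = local_rep M M (L \<one>\<^bsub>G\<^esub>) i j x" if "x \<in> local_dom M M id i j" for x
    using that assms by (auto simp: local_dom_def local_rep_chart[OF smooth_M] dom_carrier)
  have op: "open (local_dom M M id i j)"
    unfolding dom by (rule local_dom_open[OF smooth_M continuous_L assms]) simp
  show "x \<in> local_dom M M id i j \<Longrightarrow> local_rep M M id i j x = local_rep M M (L \<one>\<^bsub>G\<^esub>) i j x"
    by (rule eq)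
  show "x \<in> local_dom M M id i j \<Longrightarrow>
      frechet_derivative (local_rep M M id i j) (at x) = frechet_derivative (local_rep M M (L \<one>\<^bsub>G\<^esub>) i j) (at x)"
    by (rule frechet_derivative_cong_open[OF op _ eq])
qed

text \<open>The field whose value at p is the derivative at the unit of left translation by p,
  applied to v; here v is a tangent vector at the unit in the chart \<open>i0\<close>. The zero
  branch is the normalisation required by \<open>smooth_vector_field\<close>.\<close>

definition left_inv_field :: "'i \<Rightarrow> 'e \<Rightarrow> 'i \<Rightarrow> 'e \<Rightarrow> 'e" where
  "left_inv_field i0 v i x =
     (if i \<in> chart_index M \<and> x \<in> chart_image M i
      then frechet_derivative (local_rep M M (L (inv_into (chart_dom M i) (chart_map M i) x)) i0 i)
        (at (chart_map M i0 \<one>\<^bsub>G\<^esub>)) v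
      else 0)"

context
  fixes i0 :: 'i
  assumes i0: "i0 \<in> chart_index M" "\<one>\<^bsub>G\<^esub> \<in> chart_dom M i0"
begin

lemma left_inv_field_chart:
  assumes "i \<in> chart_index M" "p \<in> chart_dom M i"
  shows "left_inv_field i0 v i (chart_map M i p) =
    frechet_derivative (local_rep M M (L p) i0 i) (at (chart_map M i0 \<one>\<^bsub>G\<^esub>)) v"
  using assms by (auto simp: left_inv_field_def chart_image_def chart_inv[OF smooth_M])

lemma left_inv_field_translate:
  assumes "a \<in> carrier G"
  shows "preserves_field M (L a) (left_inv_field i0 v)"
  unfolding preserves_field_def
proof (intro ballI)
  fix i j x assume ij: "i \<in> chart_index M" "j \<in> chart_index M" and "x \<in> local_dom M M (L a) i j"
  then obtain p where p: "x = chart_map M i p" "p \<in> chart_dom M i" "a \<otimes>\<^bsub>G\<^esub> p \<in> chart_dom M j"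
    by (auto simp: local_dom_def)
  have "p \<in> carrier G"
    using dom_carrier ij p by blast
  then show "left_inv_field i0 v j (local_rep M M (L a) i j x) =
      frechet_derivative (local_rep M M (L a) i j) (at x) (left_inv_field i0 v i x)"
    using ij p i0 translation_chain[OF i0(1) ij assms \<open>p \<in> carrier G\<close> i0(2), of v]
    by (simp add: local_rep_chart[OF smooth_M] left_inv_field_chart)
qed

text \<open>In a chart the field is a partial derivative of \<open>mult_rep\<close> in its second
  argument, taken at the unit and regarded as a function of the first argument.\<close>

lemma left_inv_field_smooth:
  assumes "i \<in> chart_index M"
  shows "smooth_on (left_inv_field i0 v i) (chart_image M i)"
proof (rule smooth_on_cong[OF chart_image_open[OF smooth_M assms]])
  have bl: "bounded_linear (\<lambda>y::'e. (y, 0::'e))"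
    by (rule bounded_linear_Pair[OF bounded_linear_ident bounded_linear_zero])
  show "smooth_on (\<lambda>x. frechet_derivative (mult_rep i i0 i) (at ((x, 0) + (0, chart_map M i0 \<one>\<^bsub>G\<^esub>))) (0, v)) (chart_image M i)"
  proof (rule smooth_on_affine[OF chart_image_open[OF smooth_M assms] bl _
        smooth_on_frechet_derivative[OF smooth_mult_rep[OF assms i0(1) assms]]])
    fix x assume "x \<in> chart_image M i"
    then obtain p where p: "p \<in> chart_dom M i" "x = chart_map M i p"
      by (auto simp: chart_image_def)
    have "(p, \<one>\<^bsub>G\<^esub>) \<in> {(a, b) \<in> chart_dom M i \<times> chart_dom M i0. a \<otimes>\<^bsub>G\<^esub> b \<in> chart_dom M i}"
      using p i0 dom_carrier[OF assms p(1)] by simp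
    then show "(x, 0) + (0, chart_map M i0 \<one>\<^bsub>G\<^esub>) \<in> (\<lambda>(a, b). (chart_map M i a, chart_map M i0 b)) `
        {(a, b) \<in> chart_dom M i \<times> chart_dom M i0. a \<otimes>\<^bsub>G\<^esub> b \<in> chart_dom M i}"
      by (rule rev_image_eqI) (simp add: p(2))
  qed
  fix x assume "x \<in> chart_image M i"
  then obtain p where p: "p \<in> chart_dom M i" "x = chart_map M i p"
    by (auto simp: chart_image_def)
  show "frechet_derivative (mult_rep i i0 i) (at ((x, 0) + (0, chart_map M i0 \<one>\<^bsub>G\<^esub>))) (0, v) = left_inv_field i0 v i x"
    using translation_derivative(2)[OF assms i0(1) assms p(1) i0(2), of v] p assms dom_carrier[OF assms p(1)]
    by (simp add: left_inv_field_chart)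
qed

lemma left_inv_field_mem: "left_inv_field i0 v \<in> left_invariant_fields G M"
proof -
  have "preserves_field M id (left_inv_field i0 v)"
    using left_inv_field_translate[OF one_closed, of v] translation_one
    unfolding preserves_field_def by simp
  then show ?thesis
    using left_inv_field_translate left_inv_field_smooth
    by (auto simp: left_invariant_fields_def smooth_vector_field_def) (auto simp: left_inv_field_def)
qed

lemma left_inv_field_one: "left_inv_field i0 v i0 (chart_map M i0 \<one>\<^bsub>G\<^esub>) = v"
proof -
  have mem: "chart_map M i0 \<one>\<^bsub>G\<^esub> \<in> local_dom M M (L \<one>\<^bsub>G\<^esub>) i0 i0"
    using i0 by (auto simp: local_dom_def)
  have eq: "local_rep M M (L \<one>\<^bsub>G\<^esub>) i0 i0 y = y" if "y \<in> local_dom M M (L \<one>\<^bsub>G\<^esub>) i0 i0" for y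
    using that i0 by (auto simp: local_dom_def local_rep_chart[OF smooth_M] dom_carrier)
  have "frechet_derivative (local_rep M M (L \<one>\<^bsub>G\<^esub>) i0 i0) (at (chart_map M i0 \<one>\<^bsub>G\<^esub>)) = frechet_derivative (\<lambda>y. y) (at (chart_map M i0 \<one>\<^bsub>G\<^esub>))"
    by (rule frechet_derivative_cong_open[OF local_dom_open[OF smooth_M continuous_L[OF one_closed] i0(1) i0(1)] mem eq])
  then show ?thesis
    by (simp add: left_inv_field_chart i0 frechet_derivative_ident)
qed

end

end


section \<open>Left-invariant metrics and the left-invariant frame\<close>

locale lie_group_metric = lie_group_manifold G M
  for G :: "'p monoid" and M :: "('i, 'p, 'e::euclidean_space) manifold" +
  fixes br :: "'a::euclidean_space \<Rightarrow> 'a \<Rightarrow> 'a" and \<theta> :: "'a \<Rightarrow> 'i \<Rightarrow> 'e \<Rightarrow> 'e"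
    and g :: "'i \<Rightarrow> 'e \<Rightarrow> 'e \<Rightarrow> 'e \<Rightarrow> real"
  assumes lie_alg: "lie_algebra_of G M br \<theta>"
    and left_inv: "left_invariant_metric G M g"
begin

abbreviation B :: "'a \<Rightarrow> 'a \<Rightarrow> real" where "B \<equiv> metric_at_one G M \<theta> g"

lemma linear_\<theta>: "linear (\<lambda>a. \<theta> a i x)"
  using lie_alg by (auto intro!: linearI simp: lie_algebra_of_def)

lemma \<theta>_mem: "\<theta> a \<in> left_invariant_fields G M"
  using lie_alg by (auto simp: lie_algebra_of_def bij_betw_def)

lemma \<theta>_smooth: "i \<in> chart_index M \<Longrightarrow> smooth_on (\<theta> a i) (chart_image M i)"
  and \<theta>_outside: "\<not> (i \<in> chart_index M \<and> x \<in> chart_image M i) \<Longrightarrow> \<theta> a i x = 0"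
  and \<theta>_change: "preserves_field M id (\<theta> a)"
  and \<theta>_translate: "p \<in> carrier G \<Longrightarrow> preserves_field M (L p) (\<theta> a)"
  using \<theta>_mem[of a] by (auto simp: left_invariant_fields_def smooth_vector_field_def)

lemma g_smooth: "i \<in> chart_index M \<Longrightarrow> smooth_on (\<lambda>x. g i x v w) (chart_image M i)"
  and g_bilinear: "i \<in> chart_index M \<Longrightarrow> x \<in> chart_image M i \<Longrightarrow> bilinear (g i x)"
  and g_sym: "i \<in> chart_index M \<Longrightarrow> x \<in> chart_image M i \<Longrightarrow> g i x v w = g i x w v"
  and g_nondeg: "i \<in> chart_index M \<Longrightarrow> x \<in> chart_image M i \<Longrightarrow> (\<And>w. g i x v w = 0) \<Longrightarrow> v = 0"
  and g_change: "preserves_form M id g"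
  and g_translate: "p \<in> carrier G \<Longrightarrow> preserves_form M (L p) g"
  using left_inv by (auto simp: left_invariant_metric_def pseudo_riemannian_metric_def)

text \<open>Left translation by \<open>d\<close> carries p to q, so the values of a left-invariant
  field or metric at any two points, in any two charts, determine each other.\<close>

lemma \<theta>_transport:
  assumes "i \<in> chart_index M" "p \<in> chart_dom M i" "j \<in> chart_index M" "q \<in> chart_dom M j"
  defines "d \<equiv> q \<otimes>\<^bsub>G\<^esub> inv\<^bsub>G\<^esub> p"
  shows "\<theta> a j (chart_map M j q) =
      frechet_derivative (local_rep M M (L d) i j) (at (chart_map M i p)) (\<theta> a i (chart_map M i p))" (is ?A)
    and "g j (chart_map M j q) (frechet_derivative (local_rep M M (L d) i j) (at (chart_map M i p)) v)
        (frechet_derivative (local_rep M M (L d) i j) (at (chart_map M i p)) w) = g i (chart_map M i p) v w" (is ?B)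
    and "linear (frechet_derivative (local_rep M M (L d) i j) (at (chart_map M i p)))"
proof -
  have c: "p \<in> carrier G" "q \<in> carrier G" "d \<in> carrier G"
    using assms dom_carrier by auto
  have dp: "d \<otimes>\<^bsub>G\<^esub> p = q"
    unfolding d_def using c by (simp add: m_assoc)
  have mem: "chart_map M i p \<in> local_dom M M (L d) i j"
    using assms(2,4) dp by (auto simp: local_dom_def)
  have rep: "local_rep M M (L d) i j (chart_map M i p) = chart_map M j q"
    using local_rep_chart[OF smooth_M assms(1,2), of M "L d" j] by (simp add: dp)
  show ?A
    using \<theta>_translate[OF c(3), of a] assms(1,3) mem rep unfolding preserves_field_def by metis
  show ?B
    using g_translate[OF c(3)] assms(1,3) mem rep unfolding preserves_form_def by metis
  show "linear (frechet_derivative (local_rep M M (L d) i j) (at (chart_map M i p)))"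
    using translation_differentiable[OF assms(1,3) c(3) assms(2)] assms(4) dp
    by (simp add: linear_frechet_derivative)
qed

text \<open>By transport, a left-invariant field that vanishes at one point vanishes at every point,
  and it is zero off the chart images by normalisation; injectivity of \<open>\<theta>\<close> then
  gives a = 0.\<close>

lemma \<theta>_injective:
  assumes "i \<in> chart_index M" "x \<in> chart_image M i" shows "inj (\<lambda>a. \<theta> a i x)"
proof (rule linear_injective_0[OF linear_\<theta>, THEN iffD2], intro allI impI)
  fix a assume 0: "\<theta> a i x = 0"
  obtain p where p: "p \<in> chart_dom M i" "x = chart_map M i p"
    using assms(2) by (auto simp: chart_image_def)
  have "\<theta> a j y = 0" for j y
  proof (cases "j \<in> chart_index M \<and> y \<in> chart_image M j")
    case True
    then obtain q where "j \<in> chart_index M" "q \<in> chart_dom M j" "y = chart_map M j q"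
      by (auto simp: chart_image_def)
    then show ?thesis
      using \<theta>_transport(1,3)[OF assms(1) p(1)] 0 p(2) by (simp add: linear_0)
  qed (rule \<theta>_outside)
  moreover have "\<theta> 0 j y = 0" for j y
    by (rule linear_0[OF linear_\<theta>])
  ultimately have "\<theta> a = \<theta> 0"
    by (simp add: fun_eq_iff)
  then show "a = 0"
    using lie_alg by (auto simp: lie_algebra_of_def bij_betw_def inj_on_def)
qed

text \<open>Every tangent vector at the unit extends to a left-invariant field, so evaluation at the
  unit is onto as well as injective. The Ricci trace counts the dimension of the Lie algebra, the
  constant in the ambient metric that of the charts.\<close>

lemma DIM_eq: "DIM('a) = DIM('e)"
proof -
  obtain i0 where i0: "i0 \<in> chart_index M" "\<one>\<^bsub>G\<^esub> \<in> chart_dom M i0"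
    using ex_chart[OF one_closed] by blast
  define x0 where "x0 = chart_map M i0 \<one>\<^bsub>G\<^esub>"
  have x0: "x0 \<in> chart_image M i0"
    using i0 by (auto simp: x0_def chart_image_def)
  have "\<exists>a. \<theta> a i0 x0 = v" for v
  proof -
    have "left_inv_field i0 v \<in> range \<theta>"
      using left_inv_field_mem[OF i0, of v] lie_alg by (simp add: lie_algebra_of_def bij_betw_def)
    then show ?thesis
      using left_inv_field_one[OF i0, of v] by (metis rangeE x0_def)
  qed
  then have "surj (\<lambda>a. \<theta> a i0 x0)"
    by (metis surjI)
  moreover have "dim (range (\<lambda>a. \<theta> a i0 x0)) = dim (UNIV :: 'a set)"
    by (rule eucl.dim_image_eq[OF linear_\<theta>]) (use \<theta>_injective[OF i0(1) x0] in simp)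
  ultimately show ?thesis by simp
qed

lemma \<theta>_surjective:
  assumes "i \<in> chart_index M" "x \<in> chart_image M i" shows "surj (\<lambda>a. \<theta> a i x)"
  using eucl.linear_injective_imp_surjective[OF linear_\<theta> \<theta>_injective[OF assms]] DIM_eq by simp

lemma g_\<theta>:
  assumes "i \<in> chart_index M" "x \<in> chart_image M i" shows "g i x (\<theta> a i x) (\<theta> b i x) = B a b"
proof -
  define i1 where "i1 = (SOME i. i \<in> chart_index M \<and> \<one>\<^bsub>G\<^esub> \<in> chart_dom M i)"
  have i1: "i1 \<in> chart_index M" "\<one>\<^bsub>G\<^esub> \<in> chart_dom M i1"
    using someI_ex[OF ex_chart[OF one_closed]] by (auto simp: i1_def)
  obtain p where p: "p \<in> chart_dom M i" "x = chart_map M i p"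
    using assms(2) by (auto simp: chart_image_def)
  show ?thesis
    using \<theta>_transport(1,2)[OF i1 assms(1) p(1)] p(2) by (simp add: metric_at_one_def Let_def i1_def)
qed

lemma B_nondegenerate: "nondegenerate_form B"
proof
  obtain i x where ix: "i \<in> chart_index M" "x \<in> chart_image M i"
    using ex_chart[OF one_closed] by (auto simp: chart_image_def)
  note r = bilinear_rules[OF g_bilinear[OF ix]]
  show "bilinear B"
    unfolding bilinear_def
    by (intro conjI allI linearI)
      (simp_all flip: g_\<theta>[OF ix] add: r linear_add[OF linear_\<theta>] linear_cmul[OF linear_\<theta>])
  show "B v w = B w v" for v w
    unfolding g_\<theta>[OF ix, symmetric] by (rule g_sym[OF ix])
  show "v = 0" if "\<And>w. B v w = 0" for v
  proof -
    have "g i x (\<theta> v i x) u = 0" for u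
    proof -
      obtain w where "u = \<theta> w i x"
        using \<theta>_surjective[OF ix] by (rule surjE)
      then show ?thesis
        using that[of w] g_\<theta>[OF ix] by simp
    qed
    then have "\<theta> v i x = 0"
      by (rule g_nondeg[OF ix])
    then show ?thesis
      using \<theta>_injective[OF ix] linear_injective_0[OF linear_\<theta>] by blast
  qed
qed

sublocale nondegenerate_form B
  by (rule B_nondegenerate)

text \<open>The inverse of evaluation at x, expressed by duality: only the constant form B is
  inverted, so smoothness in x follows from that of g and of the frame.\<close>

definition \<theta>_inv :: "'i \<Rightarrow> 'e \<Rightarrow> 'e \<Rightarrow> 'a" where
  "\<theta>_inv i x v = form_dual B (\<lambda>a. g i x v (\<theta> a i x))"

lemma \<theta>_inv_\<theta>:
  assumes "i \<in> chart_index M" "x \<in> chart_image M i" shows "\<theta>_inv i x (\<theta> a i x) = a"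
  unfolding \<theta>_inv_def by (rule form_dualI) (simp add: g_\<theta>[OF assms])

lemma \<theta>_\<theta>_inv:
  assumes "i \<in> chart_index M" "x \<in> chart_image M i" shows "\<theta> (\<theta>_inv i x v) i x = v"
proof -
  obtain a where "v = \<theta> a i x"
    using \<theta>_surjective[OF assms] by (rule surjE)
  then show ?thesis
    by (simp add: \<theta>_inv_\<theta>[OF assms])
qed

lemma \<theta>_inv_smooth:
  assumes "i \<in> chart_index M" shows "smooth_on (\<lambda>x. \<theta>_inv i x v) (chart_image M i)"
proof (rule smooth_on_cong[OF chart_image_open[OF smooth_M assms]])
  note op = chart_image_open[OF smooth_M assms]
  show "smooth_on (\<lambda>x. \<Sum>b\<in>Basis. (\<Sum>c\<in>Basis. (\<theta> b i x \<bullet> c) * g i x v c) *\<^sub>R form_dual B (\<lambda>w. w \<bullet> b)) (chart_image M i)"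
    by (intro smooth_on_sum smooth_on_scaleR smooth_on_mult op smooth_on_const g_smooth \<theta>_smooth assms
        smooth_on_bounded_linear[OF op bounded_linear_inner_left])
  fix x assume x: "x \<in> chart_image M i"
  note lin = bilinear_right[OF g_bilinear[OF assms x], of v]
  have "g i x v (\<theta> b i x) = (\<Sum>c\<in>Basis. (\<theta> b i x \<bullet> c) * g i x v c)" for b
  proof -
    have "g i x v (\<theta> b i x) = g i x v (\<Sum>c\<in>Basis. (\<theta> b i x \<bullet> c) *\<^sub>R c)"
      by (simp add: euclidean_representation)
    then show ?thesis
      by (simp add: linear_sum[OF lin] linear_cmul[OF lin])
  qed
  moreover have "linear (\<lambda>a. g i x v (\<theta> a i x))"
    using linear_compose[OF linear_\<theta> lin] by (simp add: o_def)
  ultimately show "(\<Sum>b\<in>Basis. (\<Sum>c\<in>Basis. (\<theta> b i x \<bullet> c) * g i x v c) *\<^sub>R form_dual B (\<lambda>w. w \<bullet> b)) = \<theta>_inv i x v"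
    by (simp add: \<theta>_inv_def form_dual_expand)
qed

lemma \<theta>_bracket:
  assumes "i \<in> chart_index M" "x \<in> chart_image M i"
  shows "frechet_derivative (\<theta> b i) (at x) (\<theta> a i x) - frechet_derivative (\<theta> a i) (at x) (\<theta> b i x) = \<theta> (br a b) i x"
proof -
  have "\<theta> (br a b) i x = vf_bracket M (\<theta> a) (\<theta> b) i x"
    using lie_alg by (simp add: lie_algebra_of_def)
  then show ?thesis
    using assms by (simp add: vf_bracket_def)
qed

lemma \<theta>_transition:
  assumes "i \<in> chart_index M" "j \<in> chart_index M" "x \<in> local_dom M M id i j"
  shows "\<theta> a j (local_rep M M id i j x) = frechet_derivative (local_rep M M id i j) (at x) (\<theta> a i x)"
    and "x \<in> chart_image M i" "local_rep M M id i j x \<in> chart_image M j"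
    and "local_rep M M id i j differentiable (at x)"
proof -
  obtain p where p: "x = chart_map M i p" "p \<in> chart_dom M i" "p \<in> chart_dom M j"
    using assms(3) by (auto simp: local_dom_def)
  then show "x \<in> chart_image M i" "local_rep M M id i j x \<in> chart_image M j"
    by (simp_all add: chart_image_def local_rep_chart[OF smooth_M assms(1)])
  show "\<theta> a j (local_rep M M id i j x) = frechet_derivative (local_rep M M id i j) (at x) (\<theta> a i x)"
    using \<theta>_change[of a] assms unfolding preserves_field_def by blast
  have "smooth_on (local_rep M M id i j) (local_dom M M id i j)"
    using smooth_M assms(1,2) unfolding smooth_manifold_def by blast
  then show "local_rep M M id i j differentiable (at x)"
    using assms(3) by (rule smooth_on_differentiable)
qed

end


section \<open>The ambient metric in a left-invariant frame\<close>

lemma chart_image_ambient: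
  "chart_image (ambient_space M \<epsilon>) (k, i, l) = {0<..} \<times> chart_image M i \<times> {-\<epsilon><..<\<epsilon>}"
  by (force simp: chart_image_def ambient_space_def prod_manifold_def open_submanifold_def)

lemma chart_index_ambient: "(k, i, l) \<in> chart_index (ambient_space M \<epsilon>) \<longleftrightarrow> i \<in> chart_index M"
  by (simp add: ambient_space_def prod_manifold_def open_submanifold_def)

lemma chart_dom_ambient:
  "chart_dom (ambient_space M \<epsilon>) (k, i, l) = {0<..} \<times> chart_dom M i \<times> {-\<epsilon><..<\<epsilon>}"
  by (simp add: ambient_space_def prod_manifold_def open_submanifold_def)

lemma chart_map_ambient: "chart_map (ambient_space M \<epsilon>) (k, i, l) (t, p, \<rho>) = (t, chart_map M i p, \<rho>)"
  by (simp add: ambient_space_def prod_manifold_def open_submanifold_def)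

lemma local_dom_ambient:
  "local_dom (ambient_space M \<epsilon>) (ambient_space M \<epsilon>) id (k, i, l) (k', j, l') =
    {0<..} \<times> local_dom M M id i j \<times> {-\<epsilon><..<\<epsilon>}"
  unfolding local_dom_def chart_dom_ambient by (force simp: chart_map_ambient)

lemma local_rep_ambient:
  assumes M: "smooth_manifold M" "i \<in> chart_index M" "p \<in> chart_dom M i" and "t > 0" "\<rho> \<in> {-\<epsilon><..<\<epsilon>}"
  shows "local_rep (ambient_space M \<epsilon>) (ambient_space M \<epsilon>) id (k, i, l) (k', j, l') (t, chart_map M i p, \<rho>) =
    (t, local_rep M M id i j (chart_map M i p), \<rho>)"
proof -
  have "inj_on (chart_map (ambient_space M \<epsilon>) (k, i, l)) (chart_dom (ambient_space M \<epsilon>) (k, i, l))"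
    using chart_inj[OF M(1,2)] unfolding chart_dom_ambient by (auto simp: inj_on_def chart_map_ambient)
  from inv_into_f_f[OF this, of "(t, p, \<rho>)"] show ?thesis
    using assms by (simp add: local_rep_def chart_dom_ambient chart_map_ambient chart_inv)
qed

lemma bounded_linear_middle: "bounded_linear (\<lambda>y::real \<times> 'e::euclidean_space \<times> real. fst (snd y))"
  and bounded_linear_insert: "bounded_linear (\<lambda>v. (0::real, v::'e, 0::real))"
  by (intro linear_conv_bounded_linear[THEN iffD1] linearI; simp)+

lemma smooth_on_middle:
  fixes f :: "'e::euclidean_space \<Rightarrow> 'b::real_normed_vector" and S T :: "real set"
  assumes "open S" "open U" "open T" "smooth_on f U"
  shows "smooth_on (\<lambda>y. f (fst (snd y))) (S \<times> U \<times> T)"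
proof -
  have "smooth_on (\<lambda>y. f (fst (snd y) + 0)) (S \<times> U \<times> T)"
    by (rule smooth_on_affine[OF _ bounded_linear_middle _ assms(4)]) (use assms in \<open>auto intro: open_Times\<close>)
  then show ?thesis by simp
qed

lemma has_derivative_middle:
  fixes f :: "'e::euclidean_space \<Rightarrow> 'b::real_normed_vector"
  assumes "f differentiable (at (fst (snd y)))"
  shows "((\<lambda>y::real \<times> 'e \<times> real. f (fst (snd y))) has_derivative
    (\<lambda>e. frechet_derivative f (at (fst (snd y))) (fst (snd e)))) (at y)"
  using has_derivative_compose[OF bounded_linear_imp_has_derivative[OF bounded_linear_middle]
      assms[unfolded frechet_derivative_works]] .

lemma has_derivative_triple:
  assumes "(f has_derivative f') (at x)" "(g has_derivative g') (at x)" "(h has_derivative h') (at x)"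
  shows "((\<lambda>y. (f y, g y, h y)) has_derivative (\<lambda>e. (f' e, g' e, h' e))) (at x)"
  by (rule has_derivative_Pair[OF assms(1) has_derivative_Pair[OF assms(2,3)]])

lemma bounded_linear_outer: "bounded_linear (fst :: real \<times> 'e::euclidean_space \<times> real \<Rightarrow> real)"
  "bounded_linear (\<lambda>y::real \<times> 'e::euclidean_space \<times> real. snd (snd y))"
  by (intro linear_conv_bounded_linear[THEN iffD1] linearI; simp)+


section \<open>The Ricci tensor of g and the ambient metric as a tensor\<close>

locale null_centre_lie_group = lie_group_metric G M br \<theta> g + null_centre_metric "metric_at_one G M \<theta> g" br Z K
  for G :: "'p monoid" and M :: "('i, 'p, 'e::euclidean_space) manifold"
    and br :: "'a::euclidean_space \<Rightarrow> 'a \<Rightarrow> 'a" and \<theta> :: "'a \<Rightarrow> 'i \<Rightarrow> 'e \<Rightarrow> 'e"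
    and g :: "'i \<Rightarrow> 'e \<Rightarrow> 'e \<Rightarrow> 'e \<Rightarrow> real" and Z K :: "'a set" +
  assumes dim: "DIM('e) \<ge> 3"
begin

lemma base_frame:
  assumes i: "i \<in> chart_index M"
  shows "metric_frame (chart_image M i) (g i) (\<lambda>x a. \<theta> a i x) (\<theta>_inv i) br (\<lambda>x. B) (\<lambda>x. lc)"
proof (rule metric_frame.intro)
  show "open (chart_image M i)"
    by (rule chart_image_open[OF smooth_M i])
  show "Ck_on (Suc (Suc 0)) (\<lambda>x. \<theta> a i x) (chart_image M i)" for a
    using \<theta>_smooth[OF i, of a] unfolding smooth_on_def by blast
  show "bilinear br" by (rule bil_br)
  fix x assume x: "x \<in> chart_image M i"
  show "linear (\<lambda>a. \<theta> a i x)" by (rule linear_\<theta>)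
  show "\<theta> (\<theta>_inv i x v) i x = v" for v by (rule \<theta>_\<theta>_inv[OF i x])
  show "\<theta>_inv i x (\<theta> a i x) = a" for a by (rule \<theta>_inv_\<theta>[OF i x])
  show "(\<lambda>y. \<theta>_inv i y v) differentiable (at x)" for v
    by (rule smooth_on_differentiable[OF \<theta>_inv_smooth[OF i] x])
  show "frechet_derivative (\<lambda>y. \<theta> b i y) (at x) (\<theta> a i x) - frechet_derivative (\<lambda>y. \<theta> a i y) (at x) (\<theta> b i x) = \<theta> (br a b) i x" for a b
    by (rule \<theta>_bracket[OF i x])
  show "bilinear (g i x)" by (rule g_bilinear[OF i x])
  show "g i x v w = g i x w v" for v w by (rule g_sym[OF i x])
  show "v = 0" if "\<And>w. g i x v w = 0" for v using that by (rule g_nondeg[OF i x])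
  show "(\<lambda>y. g i y v w) differentiable (at x)" for v w
    by (rule smooth_on_differentiable[OF g_smooth[OF i] x])
  show "g i x (\<theta> a i x) (\<theta> b i x) = B a b" for a b by (rule g_\<theta>[OF i x])
  show "bilinear lc" by (rule bil_lc)
  show "(\<lambda>y. lc a b) differentiable (at x)" for a b by simp
  show "lc a b - lc b a = br a b" for a b by (rule lc_torsion)
  show "frechet_derivative (\<lambda>y. B b d) (at x) (\<theta> a i x) = B (lc a b) d + B b (lc a d)" for a b d
    by (simp add: lc_metric frechet_derivative_const)
qed

text \<open>The connection coefficients are constant in the left-invariant frame, so the derivative
  terms of the frame curvature vanish and \<open>Rm\<close> remains.\<close>

lemma ricci_\<theta>:
  assumes "i \<in> chart_index M" "x \<in> chart_image M i"
  shows "ricci_tensor g i x (\<theta> p i x) (\<theta> q i x) = Ric p q"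
proof -
  interpret base: metric_frame "chart_image M i" "g i" "\<lambda>x a. \<theta> a i x" "\<theta>_inv i" br "\<lambda>x. B" "\<lambda>x. lc"
    by (rule base_frame[OF assms(1)])
  show ?thesis
    using base.ricci_frame[OF assms(2), of p q]
    by (simp add: ricci_tensor_def Ric_def Rm_def base.frame_curvature_def frechet_derivative_const)
qed

lemma ricci_\<theta>_inv:
  assumes "i \<in> chart_index M" "x \<in> chart_image M i"
  shows "ricci_tensor g i x v w = Ric (\<theta>_inv i x v) (\<theta>_inv i x w)"
  using ricci_\<theta>[OF assms, of "\<theta>_inv i x v" "\<theta>_inv i x w"] by (simp add: \<theta>_\<theta>_inv[OF assms])

text \<open>\<open>Ric\<close> is a constant form in the smooth coframe, so Christoffel symbols need
  not be differentiated for this.\<close>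

lemma ricci_smooth:
  assumes "i \<in> chart_index M" shows "smooth_on (\<lambda>x. ricci_tensor g i x v w) (chart_image M i)"
proof (rule smooth_on_cong[OF chart_image_open[OF smooth_M assms]])
  show "smooth_on (\<lambda>x. Ric (\<theta>_inv i x v) (\<theta>_inv i x w)) (chart_image M i)"
    by (rule smooth_on_bilinear[OF chart_image_open[OF smooth_M assms] _ \<theta>_inv_smooth[OF assms] \<theta>_inv_smooth[OF assms]])
      (use bil_Ric in \<open>simp add: bilinear_conv_bounded_bilinear\<close>)
qed (simp add: ricci_\<theta>_inv assms)

text \<open>The frame fields correspond under a change of charts and the Ricci tensor has the same
  constant coefficients in every chart, so its tensor law follows without that of the
  connection.\<close>

lemma ricci_change:
  assumes "i \<in> chart_index M" "j \<in> chart_index M" "x \<in> local_dom M M id i j"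
  shows "ricci_tensor g j (local_rep M M id i j x) (frechet_derivative (local_rep M M id i j) (at x) v)
    (frechet_derivative (local_rep M M id i j) (at x) w) = ricci_tensor g i x v w"
proof -
  note t = \<theta>_transition[OF assms]
  obtain p q where "v = \<theta> p i x" "w = \<theta> q i x"
    using \<theta>_\<theta>_inv[OF assms(1) t(2)] by metis
  then show ?thesis
    by (simp add: t(1)[symmetric] ricci_\<theta> t(2,3) assms)
qed

definition H :: "'a \<Rightarrow> 'a \<Rightarrow> real" where
  "H v w = 2 / (real DIM('e) - 2) * Ric v w"

sublocale null_centre_perturbation "metric_at_one G M \<theta> g" br Z K H
proof
  show "bilinear H"
    unfolding bilinear_def H_def
    by (intro conjI allI linearI) (simp_all add: bilinear_rules[OF bil_Ric] distrib_left)
  show "H v w = H w v" for v w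
    by (simp only: H_def Ric_commute[of v])
  show "H v k = 0" if "k \<in> K" for k v
    by (simp add: H_def Ric_K that)
qed

abbreviation gt :: "unit \<times> 'i \<times> unit \<Rightarrow> real \<times> 'e \<times> real \<Rightarrow> real \<times> 'e \<times> real \<Rightarrow> real \<times> 'e \<times> real \<Rightarrow> real" where
  "gt \<equiv> ambient_form g (\<lambda>\<rho> i x v w. 2 * \<rho> / (real DIM('e) - 2) * ricci_tensor g i x v w)"

lemma gt_\<theta>:
  assumes "i \<in> chart_index M" "x \<in> chart_image M i"
  shows "gt (k, i, l) (t, x, \<rho>) (a, \<theta> v i x, b) (a', \<theta> w i x, b') = amb_form t \<rho> (a, v, b) (a', w, b')"
  by (simp add: ambient_form_def amb_form_def H_def g_\<theta>[OF assms] ricci_\<theta>[OF assms] algebra_simps)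

lemma gt_bilinear:
  assumes "i \<in> chart_index M" "x \<in> chart_image M i" shows "bilinear (gt (k, i, l) (t, x, \<rho>))"
proof -
  have "bilinear (ricci_tensor g i x)"
  proof -
    interpret base: metric_frame "chart_image M i" "g i" "\<lambda>x a. \<theta> a i x" "\<theta>_inv i" br "\<lambda>x. B" "\<lambda>x. lc"
      by (rule base_frame[OF assms(1)])
    note lin = linear_add[OF base.lin_F[OF assms(2)]] linear_cmul[OF base.lin_F[OF assms(2)]]
    show ?thesis
      unfolding bilinear_def
      by (intro conjI allI linearI) (simp_all add: ricci_\<theta>_inv[OF assms] lin bilinear_rules[OF bil_Ric])
  qed
  note r = bilinear_rules[OF this] bilinear_rules[OF g_bilinear[OF assms]]
  show ?thesis
    unfolding bilinear_def
    by (intro conjI allI linearI) (auto simp: ambient_form_def r algebra_simps add_divide_distrib)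
qed

lemma gt_sym:
  assumes "i \<in> chart_index M" "x \<in> chart_image M i"
  shows "gt (k, i, l) (t, x, \<rho>) v w = gt (k, i, l) (t, x, \<rho>) w v"
proof -
  obtain a X b a' Y b' where "v = (a, X, b)" "w = (a', Y, b')"
    by (cases v rule: prod_cases3, cases w rule: prod_cases3)
  then show ?thesis
    by (simp add: ambient_form_def g_sym[OF assms, of Y X] ricci_\<theta>_inv[OF assms]
        Ric_commute[of "\<theta>_inv i x Y" "\<theta>_inv i x X"] algebra_simps)
qed

lemma gt_nondegenerate:
  assumes ix: "i \<in> chart_index M" "x \<in> chart_image M i" and t: "t > 0"
    and 0: "\<And>w. gt (k, i, l) (t, x, \<rho>) v w = 0"
  shows "v = 0"
proof -
  obtain a X b where v: "v = (a, X, b)"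
    by (cases v rule: prod_cases3)
  define u where "u = \<theta>_inv i x X"
  have X: "X = \<theta> u i x"
    by (simp add: u_def \<theta>_\<theta>_inv[OF ix])
  have 0: "amb_form t \<rho> (a, u, b) (a', w, b') = 0" for a' w b'
    using 0[of "(a', \<theta> w i x, b')"] unfolding v X gt_\<theta>[OF ix] .
  have "a = 0"
    using 0[of 0 0 1] t by (simp add: amb_form_def bilinear_rules[OF bil_B] bilinear_rules[OF bil_H])
  moreover from this have "b = 0"
    using 0[of 1 0 0] t by (simp add: amb_form_def bilinear_rules[OF bil_B] bilinear_rules[OF bil_H])
  moreover have B0: "B u w + \<rho> * H u w = 0" for w
    using 0[of 0 w 0] t by (simp add: amb_form_def)
  have "u \<in> K"
    using B0 by (intro mem_K) (metis H_K Z_sub_K add.right_neutral mult_zero_right subsetD)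
  then have "B u w = 0" for w
    using B0[of w] H_K'[of u w] by simp
  then have "u = 0"
    by (rule nondeg_B)
  ultimately show ?thesis
    by (simp add: v X linear_0[OF linear_\<theta>] zero_prod_def)
qed

lemma gt_smooth:
  assumes "i \<in> chart_index M"
  shows "smooth_on (\<lambda>y. gt (k, i, l) y v w) ({0<..} \<times> chart_image M i \<times> {-\<epsilon><..<\<epsilon>})"
proof -
  obtain a X b a' Y b' where vw: "v = (a, X, b)" "w = (a', Y, b')"
    by (cases v rule: prod_cases3, cases w rule: prod_cases3)
  note im = chart_image_open[OF smooth_M assms]
  have op: "open ({0::real<..} \<times> chart_image M i \<times> {-\<epsilon><..<\<epsilon>})"
    by (intro open_Times im) auto
  have eq: "gt (k, i, l) y v w = (snd (snd y) * a + fst y * b) * a' + a * (snd (snd y) * a' + fst y * b')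
      + fst y * fst y * (g i (fst (snd y)) X Y + snd (snd y) * (2 / (real DIM('e) - 2)) * ricci_tensor g i (fst (snd y)) X Y)" for y
    by (cases y rule: prod_cases3) (simp add: vw ambient_form_def power2_eq_square)
  show ?thesis
    unfolding eq
    by (intro smooth_on_add smooth_on_mult op smooth_on_const smooth_on_linear bounded_linear_outer
        smooth_on_middle[OF _ im _ g_smooth[OF assms]] smooth_on_middle[OF _ im _ ricci_smooth[OF assms]]) auto
qed

text \<open>The transition maps of the ambient space fix t and \<rho>, so the tensor law reduces to
  those of g and of its Ricci tensor.\<close>

lemma gt_change:
  fixes k l k' l' :: unit
  assumes ij: "i \<in> chart_index M" "j \<in> chart_index M" and y: "y \<in> {0<..} \<times> local_dom M M id i j \<times> {-\<epsilon><..<\<epsilon>}"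
  defines "\<tau> \<equiv> local_rep (ambient_space M \<epsilon>) (ambient_space M \<epsilon>) id (k, i, l) (k', j, l')"
  shows "gt (k', j, l') (\<tau> y) (frechet_derivative \<tau> (at y) v) (frechet_derivative \<tau> (at y) w) = gt (k, i, l) y v w"
proof -
  have op: "open ({0::real<..} \<times> local_dom M M id i j \<times> {-\<epsilon><..<\<epsilon>})"
    by (intro open_Times local_dom_open[OF smooth_M continuous_map_id] ij) auto
  have \<tau>: "(fst z, local_rep M M id i j (fst (snd z)), snd (snd z)) = \<tau> z"
    if "z \<in> {0<..} \<times> local_dom M M id i j \<times> {-\<epsilon><..<\<epsilon>}" for z
    using that ij unfolding \<tau>_def local_dom_def
    by (auto simp: local_rep_ambient[OF smooth_M])
  have x: "fst (snd y) \<in> local_dom M M id i j"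
    using y by auto
  note t = \<theta>_transition[OF ij x]
  have "((\<lambda>z. (fst z, local_rep M M id i j (fst (snd z)), snd (snd z))) has_derivative
      (\<lambda>e. (fst e, frechet_derivative (local_rep M M id i j) (at (fst (snd y))) (fst (snd e)), snd (snd e)))) (at y)"
    by (intro has_derivative_triple has_derivative_middle t(4) bounded_linear_imp_has_derivative bounded_linear_outer)
  from has_derivative_transform_within_open[OF this op y \<tau>]
  have d: "frechet_derivative \<tau> (at y) =
      (\<lambda>e. (fst e, frechet_derivative (local_rep M M id i j) (at (fst (snd y))) (fst (snd e)), snd (snd e)))"
    by (rule frechet_derivativeI)
  have "g j (local_rep M M id i j (fst (snd y))) (frechet_derivative (local_rep M M id i j) (at (fst (snd y))) X)
     (frechet_derivative (local_rep M M id i j) (at (fst (snd y))) Y) = g i (fst (snd y)) X Y" for X Y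
    using g_change ij x unfolding preserves_form_def by blast
  then show ?thesis
    using ricci_change[OF ij x] unfolding d \<tau>[OF y, symmetric]
    by (cases y rule: prod_cases3, cases v rule: prod_cases3, cases w rule: prod_cases3)
      (simp add: ambient_form_def)
qed

lemma gt_metric: "pseudo_riemannian_metric (ambient_space M \<epsilon>) gt"
  unfolding pseudo_riemannian_metric_def
proof (intro conjI ballI)
  show "preserves_form (ambient_space M \<epsilon>) id gt"
    unfolding preserves_form_def
  proof (intro ballI allI)
    fix c d y v w
    assume cd: "c \<in> chart_index (ambient_space M \<epsilon>)" "d \<in> chart_index (ambient_space M \<epsilon>)"
      and y: "y \<in> local_dom (ambient_space M \<epsilon>) (ambient_space M \<epsilon>) id c d"
    obtain k i l k' j l' where c: "c = (k, i, l)" "d = (k', j, l')"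
      by (cases c rule: prod_cases3, cases d rule: prod_cases3)
    show "gt d (local_rep (ambient_space M \<epsilon>) (ambient_space M \<epsilon>) id c d y)
        (frechet_derivative (local_rep (ambient_space M \<epsilon>) (ambient_space M \<epsilon>) id c d) (at y) v)
        (frechet_derivative (local_rep (ambient_space M \<epsilon>) (ambient_space M \<epsilon>) id c d) (at y) w) = gt c y v w"
      using cd y unfolding c chart_index_ambient local_dom_ambient by (rule gt_change)
  qed
next
  fix c assume "c \<in> chart_index (ambient_space M \<epsilon>)"
  then obtain k i l where c: "c = (k, i, l)" and i: "i \<in> chart_index M"
    by (cases c rule: prod_cases3) (auto simp: chart_index_ambient)
  show "\<forall>v w. smooth_on (\<lambda>y. gt c y v w) (chart_image (ambient_space M \<epsilon>) c)"
    unfolding c chart_image_ambient using gt_smooth[OF i] by blast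
  fix y assume "y \<in> chart_image (ambient_space M \<epsilon>) c"
  then obtain t x \<rho> where y: "y = (t, x, \<rho>)" and t: "t > 0" and x: "x \<in> chart_image M i"
    unfolding c chart_image_ambient by auto
  show "bilinear (gt c y)"
    unfolding c y by (rule gt_bilinear[OF i x])
  show "\<forall>v w. gt c y v w = gt c y w v"
    unfolding c y using gt_sym[OF i x] by blast
  show "\<forall>v. (\<forall>w. gt c y v w = 0) \<longrightarrow> v = 0"
    unfolding c y using gt_nondegenerate[OF i x t] by blast
qed

section \<open>The ambient frame and Ricci-flatness\<close>

definition amb_frame :: "'i \<Rightarrow> real \<times> 'e \<times> real \<Rightarrow> real \<times> 'a \<times> real \<Rightarrow> real \<times> 'e \<times> real" where
  "amb_frame i y p = (fst p, \<theta> (fst (snd p)) i (fst (snd y)), snd (snd p))"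

definition amb_coframe :: "'i \<Rightarrow> real \<times> 'e \<times> real \<Rightarrow> real \<times> 'e \<times> real \<Rightarrow> real \<times> 'a \<times> real" where
  "amb_coframe i y v = (fst v, \<theta>_inv i (fst (snd y)) (fst (snd v)), snd (snd v))"

lemma amb_conn_has_derivative:
  assumes "fst y \<noteq> 0"
  shows "((\<lambda>y::real \<times> 'e \<times> real. amb_conn (fst y) (snd (snd y)) p q) has_derivative
    (\<lambda>e. amb_conn_deriv (fst y) (fst e) (snd (snd e)) p q)) (at y)"
proof -
  obtain a v b a' v' b' where pq: "p = (a, v, b)" "q = (a', v', b')"
    by (cases p rule: prod_cases3, cases q rule: prod_cases3)
  note d = bounded_linear_imp_has_derivative[OF bounded_linear_outer(1)] bounded_linear_imp_has_derivative[OF bounded_linear_outer(2)]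
  show ?thesis
    unfolding pq amb_conn_def amb_conn_deriv_def prod.case
    by (rule has_derivative_triple)
      (use assms in \<open>auto intro!: derivative_eq_intros d simp: power2_eq_square field_simps\<close>)
qed

lemma amb_form_has_derivative:
  "((\<lambda>y::real \<times> 'e \<times> real. amb_form (fst y) (snd (snd y)) (a, v, b) (a', v', b')) has_derivative
    (\<lambda>e. 2 * snd (snd e) * a * a' + fst e * (a * b' + b * a')
      + 2 * fst y * fst e * (B v v' + snd (snd y) * H v v') + (fst y)\<^sup>2 * (snd (snd e) * H v v'))) (at y)"
proof -
  note d = bounded_linear_imp_has_derivative[OF bounded_linear_outer(1)] bounded_linear_imp_has_derivative[OF bounded_linear_outer(2)]
  show ?thesis
    unfolding amb_form_def prod.case
    by (auto intro!: derivative_eq_intros d simp: algebra_simps)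
qed

lemma amb_metric_frame:
  assumes i: "i \<in> chart_index M"
  shows "metric_frame ({0<..} \<times> chart_image M i \<times> {-\<epsilon><..<\<epsilon>}) (gt (k, i, l)) (amb_frame i) (amb_coframe i)
    amb_br (\<lambda>y. amb_form (fst y) (snd (snd y))) (\<lambda>y. amb_conn (fst y) (snd (snd y)))"
proof (rule metric_frame.intro)
  note im = chart_image_open[OF smooth_M i]
  show op: "open ({0::real<..} \<times> chart_image M i \<times> {-\<epsilon><..<\<epsilon>})"
    by (intro open_Times im) auto
  show "bilinear amb_br" by (rule bil_amb_br)
  have sm: "smooth_on (\<lambda>y. (0::real, f (fst (snd y)), 0::real) + c) ({0::real<..} \<times> chart_image M i \<times> {-\<epsilon><..<\<epsilon>})"
    if "smooth_on f (chart_image M i)" for f :: "'e \<Rightarrow> 'z::euclidean_space" and c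
    by (intro smooth_on_add op smooth_on_const smooth_on_bounded_linear[OF op bounded_linear_insert]
        smooth_on_middle[OF _ im _ that]) auto
  show "Ck_on (Suc (Suc 0)) (\<lambda>y. amb_frame i y p) ({0<..} \<times> chart_image M i \<times> {-\<epsilon><..<\<epsilon>})" for p
    using sm[OF \<theta>_smooth[OF i], of "fst (snd p)" "(fst p, 0, snd (snd p))"]
    by (simp add: smooth_on_def amb_frame_def)
  fix y :: "real \<times> 'e \<times> real" assume y: "y \<in> {0<..} \<times> chart_image M i \<times> {-\<epsilon><..<\<epsilon>}"
  then obtain t x \<rho> where yt: "y = (t, x, \<rho>)" and t: "t > 0" and x: "x \<in> chart_image M i"
    by auto
  show "linear (amb_frame i y)"
    by (rule linearI) (simp_all add: amb_frame_def linear_add[OF linear_\<theta>] linear_cmul[OF linear_\<theta>])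
  show "amb_frame i y (amb_coframe i y v) = v" for v
    using x by (simp add: amb_frame_def amb_coframe_def \<theta>_\<theta>_inv[OF i] yt)
  show "amb_coframe i y (amb_frame i y p) = p" for p
    using x by (simp add: amb_frame_def amb_coframe_def \<theta>_inv_\<theta>[OF i] yt)
  show "(\<lambda>z. amb_coframe i z v) differentiable (at y)" for v
    using smooth_on_differentiable[OF sm[OF \<theta>_inv_smooth[OF i], of "fst (snd v)" "(fst v, 0, snd (snd v))"] y]
    by (simp add: amb_coframe_def)
  have dE: "frechet_derivative (\<lambda>z. amb_frame i z p) (at y) e =
      (0, frechet_derivative (\<theta> (fst (snd p)) i) (at x) (fst (snd e)), 0)" for p e
  proof -
    have "\<theta> (fst (snd p)) i differentiable (at (fst (snd y)))"
      using smooth_on_differentiable[OF \<theta>_smooth[OF i] x] by (simp add: yt)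
    then have "((\<lambda>z. amb_frame i z p) has_derivative
        (\<lambda>e. (0, frechet_derivative (\<theta> (fst (snd p)) i) (at (fst (snd y))) (fst (snd e)), 0))) (at y)"
      unfolding amb_frame_def
      by (intro has_derivative_triple has_derivative_const has_derivative_middle)
    then show ?thesis
      by (simp add: frechet_derivativeI yt)
  qed
  show "frechet_derivative (\<lambda>z. amb_frame i z q) (at y) (amb_frame i y p)
      - frechet_derivative (\<lambda>z. amb_frame i z p) (at y) (amb_frame i y q) = amb_frame i y (amb_br p q)" for p q
    using \<theta>_bracket[OF i x, of "fst (snd q)" "fst (snd p)"]
    unfolding dE by (simp add: amb_frame_def amb_br_def yt)
  show "bilinear (gt (k, i, l) y)"
    unfolding yt by (rule gt_bilinear[OF i x])
  show "gt (k, i, l) y v w = gt (k, i, l) y w v" for v w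
    unfolding yt by (rule gt_sym[OF i x])
  show "v = 0" if "\<And>w. gt (k, i, l) y v w = 0" for v
    using gt_nondegenerate[OF i x t] that unfolding yt by blast
  show "(\<lambda>z. gt (k, i, l) z v w) differentiable (at y)" for v w
    by (rule smooth_on_differentiable[OF gt_smooth[OF i] y])
  show "gt (k, i, l) y (amb_frame i y p) (amb_frame i y q) = amb_form (fst y) (snd (snd y)) p q" for p q
    using gt_\<theta>[OF i x] by (simp add: yt amb_frame_def)
  show "bilinear (amb_conn (fst y) (snd (snd y)))"
    by (rule bil_amb_conn)
  show "(\<lambda>z. amb_conn (fst z) (snd (snd z)) p q) differentiable (at y)" for p q
    using amb_conn_has_derivative[of y p q] t by (auto simp: differentiable_def yt)
  show "amb_conn (fst y) (snd (snd y)) p q - amb_conn (fst y) (snd (snd y)) q p = amb_br p q" for p q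
    by (rule amb_conn_torsion)
  show "frechet_derivative (\<lambda>z. amb_form (fst z) (snd (snd z)) q r) (at y) (amb_frame i y p) =
      amb_form (fst y) (snd (snd y)) (amb_conn (fst y) (snd (snd y)) p q) r
      + amb_form (fst y) (snd (snd y)) q (amb_conn (fst y) (snd (snd y)) p r)" for p q r
  proof -
    obtain a0 v0 b0 a v b a' v' b' where "p = (a0, v0, b0)" "q = (a, v, b)" "r = (a', v', b')"
      by (cases p rule: prod_cases3, cases q rule: prod_cases3, cases r rule: prod_cases3)
    then show ?thesis
      using t by (simp add: frechet_derivativeI[OF amb_form_has_derivative] amb_conn_metric yt amb_frame_def)
  qed
qed

lemma gt_ricci_flat: "ricci_flat (ambient_space M \<epsilon>) gt"
  unfolding ricci_flat_def
proof (intro ballI allI)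
  fix c y v w
  assume "c \<in> chart_index (ambient_space M \<epsilon>)" and y: "y \<in> chart_image (ambient_space M \<epsilon>) c"
  then obtain k i l where c: "c = (k, i, l)" and i: "i \<in> chart_index M"
    by (cases c rule: prod_cases3) (auto simp: chart_index_ambient)
  interpret amb: metric_frame "{0<..} \<times> chart_image M i \<times> {-\<epsilon><..<\<epsilon>}" "gt (k, i, l)" "amb_frame i" "amb_coframe i"
    amb_br "\<lambda>y. amb_form (fst y) (snd (snd y))" "\<lambda>y. amb_conn (fst y) (snd (snd y))"
    by (rule amb_metric_frame[OF i])
  have y: "y \<in> {0<..} \<times> chart_image M i \<times> {-\<epsilon><..<\<epsilon>}"
    using y unfolding c chart_image_ambient .
  then have t: "fst y \<noteq> 0" by auto
  obtain a2 v2 b2 a3 v3 b3 where pq: "amb_coframe i y v = (a2, v2, b2)" "amb_coframe i y w = (a3, v3, b3)"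
    by (cases "amb_coframe i y v" rule: prod_cases3, cases "amb_coframe i y w" rule: prod_cases3)
  have "ricci_tensor gt c y v w = lin_trace (\<lambda>u. amb.frame_curvature y u (a2, v2, b2) (a3, v3, b3))"
    using amb.ricci_frame[OF y, of "(a2, v2, b2)" "(a3, v3, b3)"] amb.E_F[OF y]
    by (simp add: ricci_tensor_def c flip: pq)
  also have "\<dots> = Ric v2 v3 - (real DIM('a) - 2) / 2 * H v2 v3"
    unfolding amb.frame_curvature_def frechet_derivativeI[OF amb_conn_has_derivative[OF t]]
    using amb_ricci[OF t, of a2 v2 b2 a3 v3 b3 "snd (snd y)"]
    by (simp add: amb_frame_def)
  \<comment> \<open>The factor (n - 2)/2 cancels against the constant in \<open>H\<close>, which is
    legitimate because n is at least 3.\<close>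
  also have "\<dots> = 0"
    using dim by (simp add: H_def DIM_eq field_simps)
  finally show "ricci_tensor gt c y v w = 0" .
qed

lemma gt_ambient: "ricci_flat_ambient_metric M g \<epsilon> gt"
  unfolding ricci_flat_ambient_metric_def
  using gt_metric gt_ricci_flat
  by (intro conjI exI[of _ "\<lambda>\<rho> i x v w. 2 * \<rho> / (real DIM('e) - 2) * ricci_tensor g i x v w"]) auto

end


section \<open>Semidirect sums\<close>

lemma semidirect_lie_algebra:
  fixes br\<^sub>h :: "'h::euclidean_space \<Rightarrow> 'h \<Rightarrow> 'h" and br\<^sub>k :: "'k::euclidean_space \<Rightarrow> 'k \<Rightarrow> 'k"
  assumes h: "lie_algebra br\<^sub>h" and k: "lie_algebra br\<^sub>k" and \<phi>: "derivation_action br\<^sub>h br\<^sub>k \<phi>"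
  shows "lie_algebra (semidirect_bracket br\<^sub>h br\<^sub>k \<phi>)"
proof -
  have bil: "bilinear br\<^sub>h" "bilinear br\<^sub>k"
    using h k by (simp_all add: lie_algebra_def)
  have lin: "linear (\<phi> X)" and der: "\<phi> X (br\<^sub>k x y) = br\<^sub>k (\<phi> X x) y + br\<^sub>k x (\<phi> X y)" for X x y
    using \<phi> by (simp_all add: derivation_action_def derivations_def)
  have act: "\<phi> (X + X') Y = \<phi> X Y + \<phi> X' Y" "\<phi> (r *\<^sub>R X) Y = r *\<^sub>R \<phi> X Y"
    "\<phi> (br\<^sub>h X X') Y = \<phi> X (\<phi> X' Y) - \<phi> X' (\<phi> X Y)" for X X' Y r
    using \<phi> by (simp_all add: derivation_action_def)
  have anti: "br\<^sub>k y x = - br\<^sub>k x y" for x y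
  proof -
    have 0: "br\<^sub>k z z = 0" for z
      using k by (simp add: lie_algebra_def)
    from 0[of "x + y"] have "br\<^sub>k x y + br\<^sub>k y x = 0"
      unfolding bilinear_ladd[OF bil(2)] bilinear_radd[OF bil(2)] by (simp add: 0 add.commute)
    then show ?thesis
      by (simp add: eq_neg_iff_add_eq_0 add.commute)
  qed
  note r = bilinear_rules[OF bil(1)] bilinear_rules[OF bil(2)] linear_add[OF lin] linear_diff[OF lin]
    linear_cmul[OF lin] linear_neg[OF lin] act der
  have jac: "br\<^sub>h X (br\<^sub>h Y Z) + br\<^sub>h Y (br\<^sub>h Z X) + br\<^sub>h Z (br\<^sub>h X Y) = 0"
    "br\<^sub>k x (br\<^sub>k y z) + br\<^sub>k y (br\<^sub>k z x) + br\<^sub>k z (br\<^sub>k x y) = 0" for X Y Z x y z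
    using h k by (simp_all add: lie_algebra_def)
  show ?thesis
    unfolding lie_algebra_def
  proof (intro conjI allI)
    show "bilinear (semidirect_bracket br\<^sub>h br\<^sub>k \<phi>)"
      unfolding bilinear_def
      by (intro conjI allI linearI) (auto simp: semidirect_bracket_def r algebra_simps)
    show "semidirect_bracket br\<^sub>h br\<^sub>k \<phi> p p = 0" for p
      using h k by (cases p) (simp add: semidirect_bracket_def lie_algebra_def zero_prod_def)
    \<comment> \<open>The Jacobi identity splits by the number of arguments from the acting algebra:
      all three give its own Jacobi identity, two the homomorphism property of
      \<open>\<phi>\<close>, one the derivation property, and none the Jacobi identity of
      \<open>br\<^sub>k\<close>.\<close>
    fix p q s :: "'h \<times> 'k"
    obtain X x Y y Z z where pqs: "p = (X, x)" "q = (Y, y)" "s = (Z, z)"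
      by (cases p, cases q, cases s)
    have "br\<^sub>k x (br\<^sub>k y z) = - br\<^sub>k y (br\<^sub>k z x) - br\<^sub>k z (br\<^sub>k x y)"
      using jac(2)[of x y z] by (simp add: algebra_simps eq_neg_iff_add_eq_0)
    then show "semidirect_bracket br\<^sub>h br\<^sub>k \<phi> p (semidirect_bracket br\<^sub>h br\<^sub>k \<phi> q s)
        + semidirect_bracket br\<^sub>h br\<^sub>k \<phi> q (semidirect_bracket br\<^sub>h br\<^sub>k \<phi> s p)
        + semidirect_bracket br\<^sub>h br\<^sub>k \<phi> s (semidirect_bracket br\<^sub>h br\<^sub>k \<phi> p q) = 0"
      using jac(1)[of X Y Z]
      by (simp add: pqs semidirect_bracket_def zero_prod_def r anti[of x] anti[of y z] anti[of "\<phi> _ _" z] anti[of "\<phi> _ _" y])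
  qed
qed

theorem theorem1p4:
  fixes br\<^sub>h :: "'h::euclidean_space \<Rightarrow> 'h \<Rightarrow> 'h"
    and br\<^sub>k :: "'k::euclidean_space \<Rightarrow> 'k \<Rightarrow> 'k"
    and \<phi> :: "'h \<Rightarrow> 'k \<Rightarrow> 'k"
    and H :: "'q monoid" and MH :: "('j, 'q, 'f::euclidean_space) manifold"
    and \<theta>H :: "'h \<Rightarrow> 'j \<Rightarrow> 'f \<Rightarrow> 'f"
    and G :: "'p monoid" and M :: "('i, 'p, 'e::euclidean_space) manifold"
    and \<theta> :: "'h \<times> 'k \<Rightarrow> 'i \<Rightarrow> 'e \<Rightarrow> 'e"
    and g :: "'i \<Rightarrow> 'e \<Rightarrow> 'e \<Rightarrow> 'e \<Rightarrow> real"
    and \<epsilon> :: real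
  defines "\<zz> \<equiv> {0} \<times> lie_centre br\<^sub>k"
    and "\<kk> \<equiv> {0} \<times> UNIV"
    and "\<hh> \<equiv> UNIV \<times> {0}"
    and "B \<equiv> metric_at_one G M \<theta> g"
  assumes "lie_algebra br\<^sub>k" and "two_step_nilpotent br\<^sub>k"
    and "lie_algebra br\<^sub>h"
    and "lie_group H MH" and "lie_algebra_of H MH br\<^sub>h \<theta>H"
    and "derivation_action br\<^sub>h br\<^sub>k \<phi>"
    and "lie_group G M" and "lie_algebra_of G M (semidirect_bracket br\<^sub>h br\<^sub>k \<phi>) \<theta>"
    and "DIM('e) \<ge> 3"
    and "left_invariant_metric G M g"
    and "orth_complement B \<zz> = \<kk>"
    and "direct_sum_decomposition (orth_complement B \<hh>) \<zz>"
    and "\<epsilon> > 0"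
  shows "ricci_flat_ambient_metric M g \<epsilon>
           (ambient_form g (\<lambda>\<rho> i x v w. 2 * \<rho> / (real DIM('e) - 2) * ricci_tensor g i x v w))"
proof -
  note ks = assms(5) and nil = assms(6) and hs = assms(7) and act = assms(10) and orth = assms(15) and sum = assms(16)
  interpret lie_group_metric G M "semidirect_bracket br\<^sub>h br\<^sub>k \<phi>" \<theta> g
    using assms(11,12,14) by unfold_locales
  let ?br = "semidirect_bracket br\<^sub>h br\<^sub>k \<phi>"
  have bilk: "bilinear br\<^sub>k" and bilh: "bilinear br\<^sub>h"
    using ks hs by (simp_all add: lie_algebra_def)
  have lin: "linear (\<phi> X)" and der: "\<phi> X (br\<^sub>k x y) = br\<^sub>k (\<phi> X x) y + br\<^sub>k x (\<phi> X y)" for X x y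
    using act by (simp_all add: derivation_action_def derivations_def)
  have "\<phi> (0 *\<^sub>R 0) Y = 0 *\<^sub>R \<phi> 0 Y" for Y
    using act unfolding derivation_action_def by metis
  then have \<phi>0: "\<phi> 0 Y = 0" for Y
    by simp
  have Z_orth: "B z k = 0" if "z \<in> \<zz>" "k \<in> \<kk>" for z k
    using orth that sym_B[of z k] unfolding B_def orth_complement_def by auto
  have sub_centre: "subspace (lie_centre br\<^sub>k)"
    by (auto simp: subspace_def lie_centre_def bilinear_rules[OF bilk])
  interpret null_centre_lie_group G M ?br \<theta> g \<zz> \<kk>
  proof
    show "lie_algebra ?br"
      by (rule semidirect_lie_algebra[OF hs ks act])
    show "subspace \<zz>" "subspace \<kk>"
      unfolding \<zz>_def \<kk>_def by (intro subspace_Times sub_centre; simp)+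
    show "\<zz> \<subseteq> \<kk>"
      by (auto simp: \<zz>_def \<kk>_def)
    show "metric_at_one G M \<theta> g z k = 0" if "z \<in> \<zz>" "k \<in> \<kk>" for z k
      using Z_orth[OF that] by (simp add: B_def)
    show "a \<in> \<kk>" if "\<And>z. z \<in> \<zz> \<Longrightarrow> metric_at_one G M \<theta> g a z = 0" for a
      unfolding orth[symmetric] using that by (simp add: orth_complement_def B_def)
    \<comment> \<open>Split a = s + z along the given decomposition. Both a and z are orthogonal to
      \<open>\<kk>\<close>, hence so is s; as s is also orthogonal to \<open>\<hh>\<close>, it is
      orthogonal to everything and vanishes.\<close>
    show "a \<in> \<zz>" if a: "\<And>k. k \<in> \<kk> \<Longrightarrow> metric_at_one G M \<theta> g a k = 0" for a
    proof -
      obtain s z where sz: "s \<in> orth_complement B \<hh>" "z \<in> \<zz>" "a = s + z"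
      proof -
        have "{s + t |s t. s \<in> orth_complement B \<hh> \<and> t \<in> \<zz>} = UNIV"
          using sum unfolding direct_sum_decomposition_def by blast
        then have "a \<in> {s + t |s t. s \<in> orth_complement B \<hh> \<and> t \<in> \<zz>}"
          by simp
        then show ?thesis
          using that by blast
      qed
      have "metric_at_one G M \<theta> g s w = 0" for w
      proof -
        have w: "w = (fst w, 0) + (0, snd w)"
          by simp
        have k: "(0, snd w) \<in> \<kk>" and h: "(fst w, 0) \<in> \<hh>"
          by (auto simp: \<kk>_def \<hh>_def)
        have "metric_at_one G M \<theta> g s (0, snd w) = 0"
          using a[OF k] Z_orth[OF sz(2) k] unfolding sz(3) B_def by (simp add: bilinear_rules[OF bil_B])
        moreover have "metric_at_one G M \<theta> g s (fst w, 0) = 0"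
          using sz(1) h by (simp add: orth_complement_def B_def)
        ultimately show ?thesis
          by (subst w) (simp only: bilinear_radd[OF bil_B] add_0)
      qed
      then have "s = 0"
        by (rule nondeg_B)
      with sz show ?thesis by simp
    qed
    show "?br a k \<in> \<kk>" if "k \<in> \<kk>" for a k
      using that by (auto simp: \<kk>_def semidirect_bracket_def bilinear_rules[OF bilh] split: prod.splits)
    show "?br a z \<in> \<zz>" if z: "z \<in> \<zz>" for a z
    proof -
      obtain X Y W where aw: "a = (X, Y)" "z = (0, W)" and W: "\<And>x. br\<^sub>k W x = 0"
        using z by (cases a) (auto simp: \<zz>_def lie_centre_def)
      have "br\<^sub>k Y W = 0"
      proof -
        have 0: "br\<^sub>k u u = 0" for u
          using ks by (simp add: lie_algebra_def)
        from 0[of "Y + W"] show ?thesis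
          unfolding bilinear_ladd[OF bilk] bilinear_radd[OF bilk] by (simp add: 0 W)
      qed
      \<comment> \<open>The centre is stable under derivations: apply \<open>\<phi> X\<close> to
        [W, x] = 0 and use that W is central.\<close>
      moreover have "br\<^sub>k (\<phi> X W) x = 0" for x
        using der[of X W x] by (simp add: W linear_0[OF lin])
      ultimately show ?thesis
        by (simp add: aw \<zz>_def semidirect_bracket_def lie_centre_def bilinear_rules[OF bilh] \<phi>0)
    qed
    show "?br k k' \<in> \<zz>" if "k \<in> \<kk>" "k' \<in> \<kk>" for k k'
      using that nil
      by (auto simp: \<kk>_def \<zz>_def semidirect_bracket_def lie_centre_def two_step_nilpotent_def bilinear_rules[OF bilh] \<phi>0)
    show "?br k z = 0" if kz: "k \<in> \<kk>" "z \<in> \<zz>" for k z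
    proof -
      obtain Y W where YW: "k = (0, Y)" "z = (0, W)" and W: "\<And>x. br\<^sub>k W x = 0"
        using kz by (auto simp: \<kk>_def \<zz>_def lie_centre_def)
      have 0: "br\<^sub>k u u = 0" for u
        using ks by (simp add: lie_algebra_def)
      from 0[of "Y + W"] have "br\<^sub>k Y W = 0"
        unfolding bilinear_ladd[OF bilk] bilinear_radd[OF bilk] by (simp add: 0 W)
      then show ?thesis
        by (simp add: YW semidirect_bracket_def bilinear_rules[OF bilh] \<phi>0 zero_prod_def)
    qed
    show "DIM('e) \<ge> 3" by (rule assms(13))
  qed
  show ?thesis
    by (rule gt_ambient)
qed

end
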